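(* For every exchange matrix $\varepsilon$, the saturated modular complex $\widehat{\mathcal{M}}_{|\varepsilon|}$ is simply-connected.
   Context: Exchange matrices. $I$ is a finite set with frozen subset $I_0$; an exchange matrix $\varepsilon=(\varepsilon_{ij})_{i,j\in I}$ is $\frac12\mathbb{Z}$-valued, with $\varepsilon_{ij}\in\mathbb{Z}$ unless $(i,j)\in I_0\times I_0$, such that for some positive integers $d_j$ the matrix $(\varepsilon_{ij}d_j^{-1})$ is skew-symmetric. For $k\in I\setminus I_0$, $\mu_k(\varepsilon)=\varepsilon'$ with $\varepsilon'_{ij}=-\varepsilon_{ij}$ if $k\in\{i,j\}$, else $\varepsilon'_{ij}=\varepsilon_{ij}+\frac12(|\varepsilon_{ik}|\varepsilon_{kj}+\varepsilon_{ik}|\varepsilon_{kj}|)$. Permutations $\sigma$ of $I$ preserving $I_0$ setwise act by $\sigma(\varepsilon)_{ij}=\varepsilon_{\sigma^{-1}(i),\sigma^{-1}(j)}$. A mutation sequence is a finite composition (right to left) of mutations and such permutations; a mutation loop at $\varepsilon$ is one sending $\varepsilon$ to $\varepsilon$. Saturated cluster modular group. $\widehat{\Gamma}_\varepsilon$ is the group of mutation loops at $\varepsilon$ modulo the equivalence relation generated by: $\mu_k\mu_k=1$; $\sigma\mu_k\sigma^{-1}=\mu_{\sigma(k)}$; and the standard relations, applicable at any stage with current matrix $\varepsilon'$: if $i,j\in I\setminus I_0$ and $\varepsilon'_{ij}=-p\,\varepsilon'_{ji}=p$ with $(p,h)\in\{(0,2),(1,3),(2,4),(3,6)\}$, then $((i\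 j)\mu_i)^{h+2}=1$ and $((i\ j)\mu_j)^{h+2}=1$ (standard sequences, giving $(h+2)$-gons). Complex. Let $n=|I\setminus I_0|$ and let $T_{|\varepsilon|}$ be the $n$-regular tree with edges labeled by $I\setminus I_0$ (each vertex incident to exactly one edge of each label), each vertex $v$ carrying a matrix $\varepsilon^{(v)}$, with $\varepsilon^{(v_0)}=\varepsilon$ at a chosen vertex $v_0$ and matrices at the ends of an edge labeled $k$ related by $\mu_k$. Let $D$ be the group of automorphisms $\gamma$ of the tree, each equipped with a permutation $\sigma=\sigma(\gamma)$ of $I$ preserving $I_0$, such that $\gamma$ maps edges labeled $k$ to edges labeled $\sigma(k)$ and $\varepsilon^{(\gamma(v))}=\sigma(\varepsilon^{(v)})$ for all $v$. The map $\Phi_{v_0}:D\to\widehat{\Gamma}_\varepsilon$, $\gamma\mapsto\sigma(\gamma)\mu_{i_k}\cdots\mu_{i_1}$, where $i_1,\dots,i_k$ are the successive labels along the edge path from $v_0$ to $\gamma^{-1}(v_0)$, is a surjective homomorphism. The saturated exchange graph is $\widehat{\mathbb{E}}_{|\varepsilon|}=T_{|\varepsilon|}/\ker\Phi_{v_0}$. The saturated modular complex $\widehat{\mathcal{M}}_{|\varepsilon|}$ is the $2$-complex obtained from $\widehat{\mathbb{E}}_{|\varepsilon|}$ by attaching, to each cycle given by a standard sequence, a $2$-cell given by the corresponding standard $(h+2)$-gon. *)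

theory Defs
  imports "HOL-Analysis.Analysis" "HOL-Combinatorics.Permutations" "HOL-Algebra.Coset"
begin

section \<open>Exchange matrices and mutation sequences\<close>

text \<open>Matrices indexed by the finite set \<open>I\<close> are functions on the whole type that vanish
  outside \<open>I \<times> I\<close>. This normalisation is preserved by mutations and permutations, so that
  equality of matrices is plain equality of functions.\<close>

type_synonym 'i matrix = "'i \<Rightarrow> 'i \<Rightarrow> rat"

definition exchange_matrix :: "'i set \<Rightarrow> 'i set \<Rightarrow> 'i matrix \<Rightarrow> bool" where
  "exchange_matrix I I0 \<epsilon> \<longleftrightarrow>
     finite I \<and> I0 \<subseteq> I \<and>
     (\<forall>i\<in>I. \<forall>j\<in>I. 2 * \<epsilon> i j \<in> \<int>) \<and>
     (\<forall>i\<in>I. \<forall>j\<in>I. (i, j) \<notin> I0 \<times> I0 \<longrightarrow> \<epsilon> i j \<in> \<int>) \<and>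
     (\<exists>d :: 'i \<Rightarrow> nat. (\<forall>j\<in>I. d j > 0) \<and>
        (\<forall>i\<in>I. \<forall>j\<in>I. \<epsilon> i j / of_nat (d j) = - (\<epsilon> j i / of_nat (d i)))) \<and>
     (\<forall>i j. i \<notin> I \<or> j \<notin> I \<longrightarrow> \<epsilon> i j = 0)"

definition mutate :: "'i \<Rightarrow> 'i matrix \<Rightarrow> 'i matrix" where
  "mutate k \<epsilon> = (\<lambda>i j. if i = k \<or> j = k then - \<epsilon> i j
     else \<epsilon> i j + (\<bar>\<epsilon> i k\<bar> * \<epsilon> k j + \<epsilon> i k * \<bar>\<epsilon> k j\<bar>) / 2)"

definition permute_matrix :: "('i \<Rightarrow> 'i) \<Rightarrow> 'i matrix \<Rightarrow> 'i matrix" where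
  "permute_matrix \<sigma> \<epsilon> = (\<lambda>i j. \<epsilon> (Hilbert_Choice.inv \<sigma> i) (Hilbert_Choice.inv \<sigma> j))"

definition index_perms :: "'i set \<Rightarrow> 'i set \<Rightarrow> ('i \<Rightarrow> 'i) set" where
  "index_perms I I0 = {\<sigma>. \<sigma> permutes I \<and> \<sigma> ` I0 = I0}"

datatype 'i step = Mut 'i | Perm "'i \<Rightarrow> 'i"

fun step_act :: "'i step \<Rightarrow> 'i matrix \<Rightarrow> 'i matrix" where
  "step_act (Mut k) \<epsilon> = mutate k \<epsilon>"
| "step_act (Perm \<sigma>) \<epsilon> = permute_matrix \<sigma> \<epsilon>"

text \<open>As with composition of maps, the last entry of the list is applied first.\<close>

definition seq_act :: "'i step list \<Rightarrow> 'i matrix \<Rightarrow> 'i matrix" where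
  "seq_act w \<epsilon> = foldr step_act w \<epsilon>"

definition mutation_seqs :: "'i set \<Rightarrow> 'i set \<Rightarrow> 'i step list set" where
  "mutation_seqs I I0 = lists (Mut ` (I - I0) \<union> Perm ` index_perms I I0)"

definition mutation_loops :: "'i set \<Rightarrow> 'i set \<Rightarrow> 'i matrix \<Rightarrow> 'i step list set" where
  "mutation_loops I I0 \<epsilon> = {w \<in> mutation_seqs I I0. seq_act w \<epsilon> = \<epsilon>}"


section \<open>The saturated cluster modular group\<close>

definition standard_pair ::
    "'i set \<Rightarrow> 'i set \<Rightarrow> 'i matrix \<Rightarrow> nat \<Rightarrow> 'i \<Rightarrow> 'i \<Rightarrow> bool" where
  "standard_pair I I0 \<epsilon> h i j \<longleftrightarrow>
     i \<in> I - I0 \<and> j \<in> I - I0 \<and> i \<noteq> j \<and>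
     (\<exists>p :: nat. (p, h) \<in> {(0, 2), (1, 3), (2, 4), (3, 6)} \<and>
        \<epsilon> i j = - of_nat p * \<epsilon> j i \<and> - of_nat p * \<epsilon> j i = of_nat p)"

definition standard_seq :: "nat \<Rightarrow> 'i \<Rightarrow> 'i \<Rightarrow> 'i \<Rightarrow> 'i step list" where
  "standard_seq h i j k = concat (replicate (h + 2) [Perm (Transposition.transpose i j), Mut k])"

text \<open>The defining relations applicable at the current matrix \<open>\<epsilon>\<close>. The rules \<open>comp\<close> and \<open>ident\<close>
  say that permutations are composed as permutations.\<close>

inductive basic_rel ::
    "'i set \<Rightarrow> 'i set \<Rightarrow> 'i matrix \<Rightarrow> 'i step list \<Rightarrow> 'i step list \<Rightarrow> bool"
  for I I0 :: "'i set" and \<epsilon> :: "'i matrix" where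
  ident: "basic_rel I I0 \<epsilon> [Perm id] []"
| comp: "\<lbrakk>\<sigma> \<in> index_perms I I0; \<tau> \<in> index_perms I I0\<rbrakk>
    \<Longrightarrow> basic_rel I I0 \<epsilon> [Perm \<sigma>, Perm \<tau>] [Perm (\<sigma> \<circ> \<tau>)]"
| invol: "k \<in> I - I0 \<Longrightarrow> basic_rel I I0 \<epsilon> [Mut k, Mut k] []"
| conj: "\<lbrakk>\<sigma> \<in> index_perms I I0; k \<in> I - I0\<rbrakk>
    \<Longrightarrow> basic_rel I I0 \<epsilon> [Perm \<sigma>, Mut k, Perm (Hilbert_Choice.inv \<sigma>)] [Mut (\<sigma> k)]"
| standard: "\<lbrakk>standard_pair I I0 \<epsilon> h i j; k \<in> {i, j}\<rbrakk>
    \<Longrightarrow> basic_rel I I0 \<epsilon> (standard_seq h i j k) []"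

inductive elementary_move ::
    "'i set \<Rightarrow> 'i set \<Rightarrow> 'i matrix \<Rightarrow> 'i step list \<Rightarrow> 'i step list \<Rightarrow> bool"
  for I I0 :: "'i set" and \<epsilon> :: "'i matrix" where
  "\<lbrakk>u \<in> mutation_seqs I I0; w \<in> mutation_seqs I I0; basic_rel I I0 (seq_act w \<epsilon>) x y\<rbrakk>
    \<Longrightarrow> elementary_move I I0 \<epsilon> (u @ x @ w) (u @ y @ w)"

definition loop_equiv :: "'i set \<Rightarrow> 'i set \<Rightarrow> 'i matrix \<Rightarrow> 'i step list rel" where
  "loop_equiv I I0 \<epsilon> = {(x, y). x \<in> mutation_loops I I0 \<epsilon> \<and> y \<in> mutation_loops I I0 \<epsilon> \<and>
     equivclp (elementary_move I I0 \<epsilon>) x y}"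

definition saturated_group :: "'i set \<Rightarrow> 'i set \<Rightarrow> 'i matrix \<Rightarrow> 'i step list set monoid" where
  "saturated_group I I0 \<epsilon> =
     \<lparr>carrier = mutation_loops I I0 \<epsilon> // loop_equiv I I0 \<epsilon>,
      mult = (\<lambda>X Y. \<Union>x\<in>X. \<Union>y\<in>Y. loop_equiv I I0 \<epsilon> `` {x @ y}),
      one = loop_equiv I I0 \<epsilon> `` {[]}\<rparr>"


section \<open>The labelled regular tree\<close>

text \<open>Edges of graphs are oriented and come with a reversal; a geometric edge is a pair of
  mutually reverse oriented edges.\<close>

record ('v, 'e) graph =
  verts :: "'v set"
  edges :: "'e set"
  origin :: "'e \<Rightarrow> 'v"
  reversal :: "'e \<Rightarrow> 'e"

text \<open>The vertices of the tree are the reduced words in the labels. The base vertex is the empty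
  word, and a vertex is the list of labels on the edge path that leads to it from the base vertex,
  the last label coming first (so that it reads like a mutation sequence). The oriented edge
  \<open>(v, k)\<close> is the edge labelled \<open>k\<close> at \<open>v\<close>, oriented away from \<open>v\<close>.\<close>

definition tree_verts :: "'i set \<Rightarrow> 'i set \<Rightarrow> 'i list set" where
  "tree_verts I I0 = {v. set v \<subseteq> I - I0 \<and> distinct_adj v}"

fun neighbour :: "'i \<Rightarrow> 'i list \<Rightarrow> 'i list" where
  "neighbour k [] = [k]"
| "neighbour k (l # v) = (if k = l then v else k # l # v)"

definition labelled_tree :: "'i set \<Rightarrow> 'i set \<Rightarrow> ('i list, 'i list \<times> 'i) graph" where
  "labelled_tree I I0 =
     \<lparr>verts = tree_verts I I0,
      edges = tree_verts I I0 \<times> (I - I0),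
      origin = fst,
      reversal = (\<lambda>(v, k). (neighbour k v, k))\<rparr>"

definition matrix_at :: "'i matrix \<Rightarrow> 'i list \<Rightarrow> 'i matrix" where
  "matrix_at \<epsilon> v = foldr mutate v \<epsilon>"

definition tree_automorphisms ::
    "'i set \<Rightarrow> 'i set \<Rightarrow> 'i matrix \<Rightarrow> (('i list \<Rightarrow> 'i list) \<times> ('i \<Rightarrow> 'i)) set" where
  "tree_automorphisms I I0 \<epsilon> = {(\<gamma>, \<sigma>).
     \<gamma> permutes tree_verts I I0 \<and> \<sigma> \<in> index_perms I I0 \<and>
     (\<forall>v\<in>tree_verts I I0. \<forall>k\<in>I - I0. \<gamma> (neighbour k v) = neighbour (\<sigma> k) (\<gamma> v)) \<and>
     (\<forall>v\<in>tree_verts I I0. matrix_at \<epsilon> (\<gamma> v) = permute_matrix \<sigma> (matrix_at \<epsilon> v))}"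

definition tree_group ::
    "'i set \<Rightarrow> 'i set \<Rightarrow> 'i matrix \<Rightarrow> (('i list \<Rightarrow> 'i list) \<times> ('i \<Rightarrow> 'i)) monoid" where
  "tree_group I I0 \<epsilon> =
     \<lparr>carrier = tree_automorphisms I I0 \<epsilon>,
      mult = (\<lambda>(\<gamma>, \<sigma>) (\<gamma>', \<sigma>'). (\<gamma> \<circ> \<gamma>', \<sigma> \<circ> \<sigma>')),
      one = (id, id)\<rparr>"

text \<open>The vertex \<open>\<gamma>\<inverse>(v\<^sub>0)\<close>, read as a list, is the label sequence from \<open>v\<^sub>0 = []\<close> to it.\<close>

definition Phi ::
    "'i set \<Rightarrow> 'i set \<Rightarrow> 'i matrix \<Rightarrow> ('i list \<Rightarrow> 'i list) \<times> ('i \<Rightarrow> 'i) \<Rightarrow> 'i step list set" where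
  "Phi I I0 \<epsilon> = (\<lambda>(\<gamma>, \<sigma>).
     loop_equiv I I0 \<epsilon> `` {Perm \<sigma> # map Mut (Hilbert_Choice.inv \<gamma> [])})"

definition ker_Phi ::
    "'i set \<Rightarrow> 'i set \<Rightarrow> 'i matrix \<Rightarrow> (('i list \<Rightarrow> 'i list) \<times> ('i \<Rightarrow> 'i)) set" where
  "ker_Phi I I0 \<epsilon> = kernel (tree_group I I0 \<epsilon>) (saturated_group I I0 \<epsilon>) (Phi I I0 \<epsilon>)"


section \<open>The saturated exchange graph\<close>

definition vert_orbit ::
    "(('i list \<Rightarrow> 'i list) \<times> ('i \<Rightarrow> 'i)) set \<Rightarrow> 'i list \<Rightarrow> 'i list set" where
  "vert_orbit N v = (\<lambda>(\<gamma>, \<sigma>). \<gamma> v) ` N"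

definition edge_orbit ::
    "(('i list \<Rightarrow> 'i list) \<times> ('i \<Rightarrow> 'i)) set \<Rightarrow> 'i list \<times> 'i \<Rightarrow> ('i list \<times> 'i) set" where
  "edge_orbit N e = (\<lambda>(\<gamma>, \<sigma>). (\<gamma> (fst e), \<sigma> (snd e))) ` N"

text \<open>Origin and reversal commute with the action, hence map orbits to orbits.\<close>

definition saturated_exchange_graph ::
    "'i set \<Rightarrow> 'i set \<Rightarrow> 'i matrix \<Rightarrow> ('i list set, ('i list \<times> 'i) set) graph" where
  "saturated_exchange_graph I I0 \<epsilon> =
     (let T = labelled_tree I I0; N = ker_Phi I I0 \<epsilon> in
      \<lparr>verts = vert_orbit N ` verts T,
       edges = edge_orbit N ` edges T,
       origin = (\<lambda>E. origin T ` E),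
       reversal = (\<lambda>E. reversal T ` E)\<rparr>)"


section \<open>Two-dimensional cell complexes and their geometric realisation\<close>

text \<open>The boundary of a face is a closed edge walk, along which a disc is attached.\<close>

record ('v, 'e, 'f) two_complex = "('v, 'e) graph" +
  faces :: "'f set"
  boundary :: "'f \<Rightarrow> 'e list"

datatype ('v, 'e, 'f) cell = Vert 'v | Edge 'e | Face 'f

definition cells :: "('v, 'e, 'f) two_complex \<Rightarrow> ('v, 'e, 'f) cell set" where
  "cells K = Vert ` verts K \<union> Edge ` edges K \<union> Face ` faces K"

fun cell_model :: "('v, 'e, 'f) cell \<Rightarrow> complex topology" where
  "cell_model (Vert v) = top_of_set {0}"
| "cell_model (Edge e) = top_of_set (of_real ` {0..1})"
| "cell_model (Face f) = top_of_set (cball 0 1)"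

text \<open>The circle bounding the disc of a face with boundary walk of length \<open>L\<close> is cut into \<open>L\<close> arcs
  of equal length, starting at \<open>1\<close>; the arc number \<open>m\<close> is attached along the edge number \<open>m\<close>.\<close>

inductive glue :: "('v, 'e, 'f) two_complex \<Rightarrow>
    ('v, 'e, 'f) cell \<times> complex \<Rightarrow> ('v, 'e, 'f) cell \<times> complex \<Rightarrow> bool"
  for K :: "('v, 'e, 'f) two_complex" where
  glue_origin: "e \<in> edges K \<Longrightarrow> glue K (Edge e, 0) (Vert (origin K e), 0)"
| glue_reversal: "\<lbrakk>e \<in> edges K; t \<in> {0..1}\<rbrakk>
    \<Longrightarrow> glue K (Edge e, of_real t) (Edge (reversal K e), of_real (1 - t))"
| glue_face: "\<lbrakk>f \<in> faces K; m < length (boundary K f); t \<in> {0..1}\<rbrakk>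
    \<Longrightarrow> glue K (Face f, cis (2 * pi * (real m + t) / real (length (boundary K f))))
          (Edge (boundary K f ! m), of_real t)"

definition quotient_topology :: "'a topology \<Rightarrow> ('a \<Rightarrow> 'b) \<Rightarrow> 'b topology" where
  "quotient_topology X q =
     topology (\<lambda>U. U \<subseteq> q ` topspace X \<and> openin X {x \<in> topspace X. q x \<in> U})"

lemma openin_quotient_topology:
  "openin (quotient_topology X q) U \<longleftrightarrow>
     U \<subseteq> q ` topspace X \<and> openin X {x \<in> topspace X. q x \<in> U}"
proof -
  let ?P = "\<lambda>U. U \<subseteq> q ` topspace X \<and> openin X {x \<in> topspace X. q x \<in> U}"
  have "istopology ?P"
    unfolding istopology_def
  proof (intro conjI allI impI)
    fix S T assume S: "?P S" and T: "?P T"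
    then show "S \<inter> T \<subseteq> q ` topspace X" by blast
    have "{x \<in> topspace X. q x \<in> S \<inter> T} =
        {x \<in> topspace X. q x \<in> S} \<inter> {x \<in> topspace X. q x \<in> T}" by blast
    then show "openin X {x \<in> topspace X. q x \<in> S \<inter> T}"
      using openin_Int S T by (metis (no_types, lifting))
  next
    fix \<K> assume K: "\<forall>K\<in>\<K>. ?P K"
    then show "\<Union>\<K> \<subseteq> q ` topspace X" by blast
    have "{x \<in> topspace X. q x \<in> \<Union>\<K>} = \<Union>((\<lambda>K. {x \<in> topspace X. q x \<in> K}) ` \<K>)" by blast
    then show "openin X {x \<in> topspace X. q x \<in> \<Union>\<K>}" using K by auto
  qed
  then show ?thesis
    by (simp add: quotient_topology_def topology_inverse')
qed

lemma topspace_quotient_topology [simp]: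
  "topspace (quotient_topology X q) = q ` topspace X"
proof
  show "topspace (quotient_topology X q) \<subseteq> q ` topspace X"
    using openin_quotient_topology[of X q] openin_topspace by blast
  have "{x \<in> topspace X. q x \<in> q ` topspace X} = topspace X" by blast
  then show "q ` topspace X \<subseteq> topspace (quotient_topology X q)"
    by (intro openin_subset) (simp add: openin_quotient_topology)
qed

lemma quotient_map_quotient_topology: "quotient_map X (quotient_topology X q) q"
  by (auto simp: quotient_map_def openin_quotient_topology)

definition realisation ::
    "('v, 'e, 'f) two_complex \<Rightarrow> (('v, 'e, 'f) cell \<times> complex) set topology" where
  "realisation K =
     quotient_topology (sum_topology cell_model (cells K)) (\<lambda>x. {y. equivclp (glue K) x y})"


section \<open>The saturated modular complex\<close>

fun tree_walk :: "'i list \<Rightarrow> 'i list \<Rightarrow> ('i list \<times> 'i) list" where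
  "tree_walk v [] = []"
| "tree_walk v (k # ks) = (v, k) # tree_walk (neighbour k v) ks"

text \<open>Moving all permutations to the left in a standard sequence by means of
  \<open>\<sigma>\<mu>\<^sub>k\<sigma>\<inverse> = \<mu>\<^sub>\<sigma>\<^sub>(\<^sub>k\<^sub>)\<close>, one obtains
  \<open>((i j)\<mu>\<^sub>i)\<^bsup>h+2\<^esup> = (i j)\<^bsup>h+2\<^esup> \<cdots> \<mu>\<^sub>j\<mu>\<^sub>i\<mu>\<^sub>j\<mu>\<^sub>i\<close>. Thus
  the edges traversed by it are labelled \<open>i, j, i, j, \<dots>\<close>; for \<open>((i j)\<mu>\<^sub>j)\<^bsup>h+2\<^esup>\<close> they are
  labelled \<open>j, i, j, i, \<dots>\<close>.\<close>

definition standard_walks :: "'i set \<Rightarrow> 'i set \<Rightarrow> 'i matrix \<Rightarrow> ('i list \<times> 'i) list set" where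
  "standard_walks I I0 \<epsilon> =
     {tree_walk v (map (\<lambda>m. if even m then a else b) [0..<h + 2]) | v h i j a b.
        v \<in> tree_verts I I0 \<and> standard_pair I I0 (matrix_at \<epsilon> v) h i j \<and>
        (a, b) \<in> {(i, j), (j, i)}}"

text \<open>A cycle is a closed walk up to the choice of starting point and direction.\<close>

definition cycle_of :: "('v, 'e, 'x) graph_scheme \<Rightarrow> 'e list \<Rightarrow> 'e list set" where
  "cycle_of G w = {rotate m u | m u. u \<in> {w, rev (map (reversal G) w)}}"

text \<open>There is one face for each cycle; its disc is attached along an arbitrarily chosen closed
  walk representing the cycle.\<close>

definition modular_2_complex :: "'i set \<Rightarrow> 'i set \<Rightarrow> 'i matrix \<Rightarrow>
    ('i list set, ('i list \<times> 'i) set, ('i list \<times> 'i) set list set) two_complex" where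
  "modular_2_complex I I0 \<epsilon> =
     (let G = saturated_exchange_graph I I0 \<epsilon>; N = ker_Phi I I0 \<epsilon> in
      graph.extend G
       \<lparr>faces = (\<lambda>w. cycle_of G (map (edge_orbit N) w)) ` standard_walks I I0 \<epsilon>,
        boundary = (\<lambda>c. SOME w. w \<in> c)\<rparr>)"

definition saturated_modular_complex :: "'i set \<Rightarrow> 'i set \<Rightarrow> 'i matrix \<Rightarrow>
    (('i list set, ('i list \<times> 'i) set, ('i list \<times> 'i) set list set) cell \<times> complex) set topology"
  where
  "saturated_modular_complex I I0 \<epsilon> = realisation (modular_2_complex I I0 \<epsilon>)"


section \<open>Simply connected spaces\<close>

text \<open>The library has simple connectedness only for subsets of types of class
  \<open>topological_space\<close>; this is the version for abstract topologies.\<close>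

definition simply_connected_space :: "'a topology \<Rightarrow> bool" where
  "simply_connected_space X \<longleftrightarrow> path_connected_space X \<and>
     (\<forall>g. pathin X g \<and> g 1 = g 0 \<longrightarrow>
        homotopic_with (\<lambda>h. h 0 = g 0 \<and> h 1 = g 0) (top_of_set {0..1}) X g (\<lambda>_. g 0))"

end

theory Submission
  imports Defs
begin

text \<open>The complex arises from a tree by passing to the quotient under the kernel \<open>N\<close> of \<open>\<Phi>\<close> and
  attaching discs. It is simply connected because the relations that make an element of \<open>N\<close> trivial
  are, read as walks in the quotient graph, either backtracks or boundaries of discs.

  In detail, let a mutation sequence start at the base vertex \<open>v\<^sub>0\<close>. A mutation crosses an edge of
  the tree and a permutation only renames the labels, so the sequence leads to a state \<open>(v, \<tau>)\<close>
  consisting of a vertex and a permutation, and it traces a walk in the quotient graph. The relations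
  among permutations and \<open>\<sigma>\<mu>\<^sub>k\<sigma>\<inverse> = \<mu>\<^sub>\<sigma>\<^sub>(\<^sub>k\<^sub>)\<close> change neither the walk nor the state, \<open>\<mu>\<^sub>k\<mu>\<^sub>k = 1\<close>
  inserts a backtrack, and a standard relation inserts a circuit around a disc
  (\<open>trace_basic_rel\<close>). Hence equivalent sequences trace homotopic walks. An element \<open>\<gamma>\<close> of \<open>N\<close> is
  represented by a sequence that is equivalent to the empty one. Composing this sequence with the
  edge path from \<open>v\<^sub>0\<close> to \<open>v\<close> shows that the edge paths from \<open>v\<^sub>0\<close> to \<open>v\<close> and to \<open>\<gamma>(v)\<close> have
  homotopic images (\<open>vertex_walk_orbit\<close>). So every vertex of the quotient has a distinguished
  homotopy class of walks from the base vertex, and an edge leads from the class of its origin to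
  the class of its end. Therefore every loop is null-homotopic.

  The circuits must be closed: a standard sequence that starts at \<open>v\<close> must end in the \<open>N\<close>-orbit of
  \<open>v\<close>. The tree automorphism that takes its end back to \<open>v\<close> exists because standard sequences fix
  the matrix, and it lies in \<open>N\<close> by the standard relation (\<open>standard_kernel_element\<close>). That the
  matrix is fixed (\<open>funpow_F_standard\<close>) is a periodicity in rank two for the rows and columns of
  \<open>i\<close> and \<open>j\<close>. The other entries are recovered from these and from the Schur complement of the
  block of \<open>i\<close> and \<open>j\<close>, which is an invariant.

  The passage from walks to arbitrary loops in the realisation
  (\<open>simply_connected_realisation\<close>) uses the realisation only as a quotient space. The
  distinguished walks are extended to a path from the base point to every point of the space. A path
  \<open>g\<close> is called trivialised when the path chosen to \<open>g 0\<close>, followed by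
  \<open>g\<close>, is homotopic to the path chosen to \<open>g 1\<close>. By compactness of the
  interval it is enough that short paths are trivialised. The space is covered by open stars of
  vertices, open stars of midpoints of edges and open discs. Each of these contracts along tracks
  that stay in one cell, where everything is homotopic by convexity.\<close>


section \<open>Homotopy of paths in an abstract topological space\<close>

definition path_homotopic :: "'a topology \<Rightarrow> (real \<Rightarrow> 'a) \<Rightarrow> (real \<Rightarrow> 'a) \<Rightarrow> bool" where
  "path_homotopic X p q \<longleftrightarrow>
     homotopic_with (\<lambda>h. h 0 = p 0 \<and> h 1 = p 1) (top_of_set {0..1}) X p q"

definition join_path :: "(real \<Rightarrow> 'a) \<Rightarrow> (real \<Rightarrow> 'a) \<Rightarrow> real \<Rightarrow> 'a" where
  "join_path p q = (\<lambda>t. if t \<le> 1/2 then p (2 * t) else q (2 * t - 1))"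

definition reverse_path :: "(real \<Rightarrow> 'a) \<Rightarrow> real \<Rightarrow> 'a" where
  "reverse_path p = (\<lambda>t. p (1 - t))"

lemma join_path_ends [simp]: "join_path p q 0 = p 0" "join_path p q 1 = q 1"
  by (simp_all add: join_path_def)

lemma reverse_path_simps [simp]:
  "reverse_path p 0 = p 1" "reverse_path p 1 = p 0" "reverse_path (reverse_path p) = p"
  by (simp_all add: reverse_path_def)

lemma path_homotopic_imp:
  assumes "path_homotopic X p q"
  shows "pathin X p" "pathin X q" "q 0 = p 0" "q 1 = p 1"
  using homotopic_with_imp_continuous_maps[OF assms[unfolded path_homotopic_def]]
    homotopic_with_imp_property[OF assms[unfolded path_homotopic_def]]
  by (auto simp: pathin_def)

lemma path_homotopic_refl: "pathin X p \<Longrightarrow> path_homotopic X p p"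
  by (simp add: path_homotopic_def pathin_def)

lemma path_homotopic_sym:
  assumes "path_homotopic X p q"
  shows "path_homotopic X q p"
  using homotopic_with_symD[OF assms[unfolded path_homotopic_def]] path_homotopic_imp[OF assms]
  by (simp add: path_homotopic_def)

lemma path_homotopic_trans [trans]:
  assumes "path_homotopic X p q" "path_homotopic X q r"
  shows "path_homotopic X p r"
proof -
  have "homotopic_with (\<lambda>h. h 0 = p 0 \<and> h 1 = p 1) (top_of_set {0..1}) X q r"
    using assms(2) path_homotopic_imp[OF assms(1)] by (simp add: path_homotopic_def)
  then show ?thesis
    using assms(1) homotopic_with_trans unfolding path_homotopic_def by blast
qed

lemma path_homotopic_eq:
  assumes "pathin X p" "\<And>t. 0 \<le> t \<Longrightarrow> t \<le> 1 \<Longrightarrow> p t = q t"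
  shows "path_homotopic X p q"
  unfolding path_homotopic_def
proof (rule homotopic_with_equal)
  show "continuous_map (top_of_set {0..1}) X p" using assms(1) by (simp add: pathin_def)
qed (use assms(2) in auto)

text \<open>Every homotopy below comes from here: in a convex set any two paths with the same ends are
  homotopic, and this persists under a continuous map into \<open>X\<close>.\<close>

lemma path_homotopic_convex_image:
  fixes S :: "'b::real_normed_vector set"
  assumes f: "continuous_map (top_of_set S) X f" and S: "convex S"
    and p: "continuous_on {0..1} p" "p ` {0..1} \<subseteq> S"
    and q: "continuous_on {0..1} q" "q ` {0..1} \<subseteq> S"
    and ends: "q 0 = p 0" "q 1 = p 1"
  shows "path_homotopic X (f \<circ> p) (f \<circ> q)"
proof -
  have "homotopic_paths S p q"
  proof (rule homotopic_paths_linear)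
    show "closed_segment (p t) (q t) \<subseteq> S" if "t \<in> {0..1}" for t
      using that p(2) q(2) S by (intro closed_segment_subset) auto
  qed (use assms in \<open>auto simp: path_def pathstart_def pathfinish_def\<close>)
  then show ?thesis
    unfolding homotopic_paths_def path_homotopic_def
    by (rule homotopic_with_compose_continuous_map_left[OF _ f])
       (auto simp: pathstart_def pathfinish_def)
qed

lemma pathin_convex_image:
  assumes "continuous_map (top_of_set S) X f" "continuous_on {0..1} p" "p ` {0..1} \<subseteq> S"
  shows "pathin X (f \<circ> p)"
  unfolding pathin_def
  by (rule continuous_map_compose[OF _ assms(1)])
     (use assms(2,3) in \<open>auto simp: continuous_map_in_subtopology\<close>)

text \<open>All laws for the composition of paths below are changes of the parameter of one path \<open>g\<close>, and in
  the interval any two such changes with the same ends are homotopic.\<close>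

lemma path_homotopic_reparametrize:
  assumes "pathin X g"
    and "continuous_on {0..1} a" "\<And>t. 0 \<le> t \<Longrightarrow> t \<le> 1 \<Longrightarrow> 0 \<le> a t \<and> a t \<le> 1"
    and "continuous_on {0..1} b" "\<And>t. 0 \<le> t \<Longrightarrow> t \<le> 1 \<Longrightarrow> 0 \<le> b t \<and> b t \<le> 1"
    and "b 0 = a 0" "b 1 = a 1"
    and p: "\<And>t. 0 \<le> t \<Longrightarrow> t \<le> 1 \<Longrightarrow> p t = g (a t)"
    and q: "\<And>t. 0 \<le> t \<Longrightarrow> t \<le> 1 \<Longrightarrow> q t = g (b t)"
  shows "path_homotopic X p q"
proof -
  have h: "path_homotopic X (g \<circ> a) (g \<circ> b)"
    using assms by (intro path_homotopic_convex_image[of "{0..1}"]) (auto simp: pathin_def)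
  have a: "path_homotopic X (g \<circ> a) p" and b: "path_homotopic X (g \<circ> b) q"
    using path_homotopic_imp[OF h] p q by (auto intro: path_homotopic_eq)
  show ?thesis
    by (rule path_homotopic_trans[OF path_homotopic_trans[OF path_homotopic_sym[OF a] h] b])
qed

text \<open>The parameter space \<open>Z\<close> will be that of a homotopy, so that homotopies can be composed like paths.\<close>

lemma continuous_map_join:
  fixes h k :: "'b \<times> real \<Rightarrow> 'a"
  assumes h: "continuous_map (prod_topology Z (top_of_set {0..1})) X h"
    and k: "continuous_map (prod_topology Z (top_of_set {0..1})) X k"
    and hk: "\<And>s. s \<in> topspace Z \<Longrightarrow> h (s, 1) = k (s, 0)"
  shows "continuous_map (prod_topology Z (top_of_set {0..1})) X
    (\<lambda>z. if snd z \<le> 1/2 then h (fst z, 2 * snd z) else k (fst z, 2 * snd z - 1))"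
proof (rule continuous_map_cases_le)
  let ?Y = "prod_topology Z (top_of_set {0..1::real})"
  have snd: "continuous_map (subtopology ?Y A) euclideanreal snd" for A
    by (intro continuous_map_from_subtopology continuous_map_into_fulltopology[OF continuous_map_snd])
  have fst: "continuous_map (subtopology ?Y A) Z fst" for A
    by (intro continuous_map_from_subtopology continuous_map_fst)
  show "continuous_map ?Y euclideanreal snd"
    using snd[of UNIV] by simp
  show "continuous_map ?Y euclideanreal (\<lambda>z. 1/2)" by simp
  show "continuous_map (subtopology ?Y {x \<in> topspace ?Y. snd x \<le> 1/2}) X (\<lambda>z. h (fst z, 2 * snd z))"
    by (rule continuous_map_compose[of _ ?Y _ _ h, unfolded o_def, OF _ h])
       (auto simp: continuous_map_pairwise o_def continuous_map_in_subtopology fst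
         intro!: continuous_map_real_mult_left snd)
  show "continuous_map (subtopology ?Y {x \<in> topspace ?Y. 1/2 \<le> snd x}) X (\<lambda>z. k (fst z, 2 * snd z - 1))"
    by (rule continuous_map_compose[of _ ?Y _ _ k, unfolded o_def, OF _ k])
       (auto simp: continuous_map_pairwise o_def continuous_map_in_subtopology fst
         intro!: continuous_map_real_mult_left continuous_map_diff snd)
  show "h (fst z, 2 * snd z) = k (fst z, 2 * snd z - 1)"
    if "z \<in> topspace ?Y" "snd z = 1/2" for z
  proof -
    from that(2) have "2 * snd z = 1" by simp
    then show ?thesis using that(1) hk[of "fst z"] by auto
  qed
qed

lemma path_homotopic_join:
  assumes p: "path_homotopic X p p'" and q: "path_homotopic X q q'" and pq: "p 1 = q 0"
  shows "path_homotopic X (join_path p q) (join_path p' q')"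
proof -
  let ?I = "top_of_set {0..1::real}"
  obtain h where h: "continuous_map (prod_topology ?I ?I) X h"
    "\<And>t. h (0, t) = p t" "\<And>t. h (1, t) = p' t"
    "\<And>s. s \<in> {0..1} \<Longrightarrow> h (s, 0) = p 0" "\<And>s. s \<in> {0..1} \<Longrightarrow> h (s, 1) = p 1"
    using p unfolding path_homotopic_def homotopic_with_def by auto
  obtain k where k: "continuous_map (prod_topology ?I ?I) X k"
    "\<And>t. k (0, t) = q t" "\<And>t. k (1, t) = q' t"
    "\<And>s. s \<in> {0..1} \<Longrightarrow> k (s, 0) = q 0" "\<And>s. s \<in> {0..1} \<Longrightarrow> k (s, 1) = q 1"
    using q unfolding path_homotopic_def homotopic_with_def by auto
  have "continuous_map (prod_topology ?I ?I) X
    (\<lambda>z. if snd z \<le> 1/2 then h (fst z, 2 * snd z) else k (fst z, 2 * snd z - 1))"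
    using h k pq by (intro continuous_map_join) auto
  then show ?thesis
    unfolding path_homotopic_def homotopic_with_def
    by (intro exI[of _ "\<lambda>z. if snd z \<le> 1/2 then h (fst z, 2 * snd z) else k (fst z, 2 * snd z - 1)"])
       (use h k in \<open>auto simp: join_path_def\<close>)
qed

lemma pathin_join: "pathin X p \<Longrightarrow> pathin X q \<Longrightarrow> p 1 = q 0 \<Longrightarrow> pathin X (join_path p q)"
  using path_homotopic_join[OF path_homotopic_refl path_homotopic_refl] path_homotopic_imp(1) by blast

lemma pathin_reverse:
  assumes "pathin X p" shows "pathin X (reverse_path p)"
proof -
  have "pathin X (p \<circ> (\<lambda>t. 1 - t))"
    using assms by (intro pathin_convex_image[of "{0..1}"]) (auto simp: pathin_def intro!: continuous_intros)
  then show ?thesis by (simp add: reverse_path_def o_def)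
qed

lemma path_homotopic_assoc:
  assumes "pathin X p" "pathin X q" "pathin X r" "p 1 = q 0" "q 1 = r 0"
  shows "path_homotopic X (join_path (join_path p q) r) (join_path p (join_path q r))"
proof (rule path_homotopic_reparametrize)
  show "pathin X (join_path p (join_path q r))"
    using assms by (intro pathin_join) auto
  show "continuous_on {0..1} (\<lambda>t::real. min (2 * t) (min (t + 1/4) ((t + 1) / 2)))"
    by (intro continuous_intros) auto
  show "join_path (join_path p q) r t =
      join_path p (join_path q r) (min (2 * t) (min (t + 1/4) ((t + 1) / 2)))"
    if "0 \<le> t" "t \<le> 1" for t
  proof -
    consider "t \<le> 1/4" | "1/4 < t" "t \<le> 1/2" | "1/2 < t" by linarith
    then show ?thesis
    proof cases
      case 1
      then have "min (2 * t) (min (t + 1/4) ((t + 1) / 2)) = 2 * t" using that by (simp add: min_def)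
      then show ?thesis using 1 by (simp add: join_path_def)
    next
      case 2
      then have "min (2 * t) (min (t + 1/4) ((t + 1) / 2)) = t + 1/4" by (simp add: min_def)
      then show ?thesis using 2 by (simp add: join_path_def algebra_simps)
    next
      case 3
      then have "min (2 * t) (min (t + 1/4) ((t + 1) / 2)) = (t + 1) / 2" using that by (simp add: min_def)
      then show ?thesis using 3 by (simp add: join_path_def algebra_simps add_divide_distrib)
    qed
  qed
  show "0 \<le> min (2 * t) (min (t + 1/4) ((t + 1) / 2)) \<and> min (2 * t) (min (t + 1/4) ((t + 1) / 2)) \<le> 1"
    if "0 \<le> t" "t \<le> 1" for t :: real
    using that by (simp add: min_le_iff_disj)
  show "join_path p (join_path q r) t = join_path p (join_path q r) t" for t ..
qed (auto intro: continuous_intros)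

lemma path_homotopic_join_const:
  assumes "pathin X p" "p 1 = c"
  shows "path_homotopic X (join_path p (\<lambda>_. c)) p"
  by (rule path_homotopic_reparametrize[OF assms(1), of "\<lambda>t. min (2 * t) 1" "\<lambda>t. t"])
     (use assms(2) in \<open>auto simp: join_path_def min_absorb1 min_absorb2 intro!: continuous_intros\<close>)

lemma path_homotopic_const_join:
  assumes "pathin X p" "p 0 = c"
  shows "path_homotopic X (join_path (\<lambda>_. c) p) p"
  by (rule path_homotopic_reparametrize[OF assms(1), of "\<lambda>t. max (2 * t - 1) 0" "\<lambda>t. t"])
     (use assms(2) in \<open>auto simp: join_path_def max_absorb1 max_absorb2 intro!: continuous_intros\<close>)

lemma path_homotopic_join_reverse:
  assumes "pathin X p"
  shows "path_homotopic X (join_path p (reverse_path p)) (\<lambda>_. p 0)"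
  by (rule path_homotopic_reparametrize[OF assms, of "\<lambda>t. 1 - \<bar>2 * t - 1\<bar>" "\<lambda>t. 0"])
     (auto simp: join_path_def reverse_path_def intro!: continuous_intros arg_cong[of _ _ p])

lemma path_homotopic_reverse_join:
  assumes "pathin X p"
  shows "path_homotopic X (join_path (reverse_path p) p) (\<lambda>_. p 1)"
  using path_homotopic_join_reverse[OF pathin_reverse[OF assms]] by simp

lemma path_homotopic_cancel_left:
  assumes pq: "path_homotopic X (join_path p q) (join_path p r)"
    and p: "pathin X p" and q: "pathin X q" "q 0 = p 1" and r: "pathin X r" "r 0 = p 1"
  shows "path_homotopic X q r"
proof -
  have *: "path_homotopic X (join_path (reverse_path p) (join_path p s)) s"
    if s: "pathin X s" "s 0 = p 1" for s
  proof -
    have "path_homotopic X (join_path (reverse_path p) (join_path p s))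
        (join_path (join_path (reverse_path p) p) s)"
      using s p by (intro path_homotopic_sym[OF path_homotopic_assoc]) (auto intro: pathin_reverse)
    also have "path_homotopic X \<dots> (join_path (\<lambda>_. p 1) s)"
      using s p by (intro path_homotopic_join path_homotopic_reverse_join path_homotopic_refl) auto
    also have "path_homotopic X \<dots> s"
      using s by (intro path_homotopic_const_join)
    finally show ?thesis .
  qed
  have h: "path_homotopic X (join_path (reverse_path p) (join_path p q))
      (join_path (reverse_path p) (join_path p r))"
    by (rule path_homotopic_join[OF path_homotopic_refl[OF pathin_reverse[OF p]] pq]) simp
  show ?thesis
    using path_homotopic_trans[OF path_homotopic_trans[OF path_homotopic_sym[OF *[OF q]] h] *[OF r]] .
qed

lemma path_homotopic_cancel_right:
  assumes pq: "path_homotopic X (join_path q p) (join_path r p)"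
    and p: "pathin X p" and q: "pathin X q" "q 1 = p 0" and r: "pathin X r" "r 1 = p 0"
  shows "path_homotopic X q r"
proof -
  have *: "path_homotopic X (join_path (join_path s p) (reverse_path p)) s"
    if s: "pathin X s" "s 1 = p 0" for s
  proof -
    have "path_homotopic X (join_path (join_path s p) (reverse_path p))
        (join_path s (join_path p (reverse_path p)))"
      using s p by (intro path_homotopic_assoc) (auto intro: pathin_reverse)
    also have "path_homotopic X \<dots> (join_path s (\<lambda>_. p 0))"
      using s p by (intro path_homotopic_join path_homotopic_join_reverse path_homotopic_refl) auto
    also have "path_homotopic X \<dots> s"
      using s by (intro path_homotopic_join_const)
    finally show ?thesis .
  qed
  have h: "path_homotopic X (join_path (join_path q p) (reverse_path p))
      (join_path (join_path r p) (reverse_path p))"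
    by (rule path_homotopic_join[OF pq path_homotopic_refl[OF pathin_reverse[OF p]]]) simp
  show ?thesis
    using path_homotopic_trans[OF path_homotopic_trans[OF path_homotopic_sym[OF *[OF q]] h] *[OF r]] .
qed

text \<open>The two ways around a square have the same ends, and the square is convex.\<close>

lemma path_homotopic_square:
  fixes H :: "real \<times> real \<Rightarrow> 'a"
  assumes H: "continuous_map (prod_topology (top_of_set {0..1}) (top_of_set {0..1})) X H"
  shows "path_homotopic X (join_path (\<lambda>t. H (t, 0)) (\<lambda>t. H (1, t)))
    (join_path (\<lambda>t. H (0, t)) (\<lambda>t. H (t, 1)))"
proof -
  let ?a = "\<lambda>t::real. (min (2 * t) 1, max (2 * t - 1) 0)"
  let ?b = "\<lambda>t::real. (max (2 * t - 1) 0, min (2 * t) 1)"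
  have H': "continuous_map (top_of_set ({0..1} \<times> {0..1})) X H"
    using H unfolding subtopology_Times[symmetric] by simp
  have h: "path_homotopic X (H \<circ> ?a) (H \<circ> ?b)"
    by (rule path_homotopic_convex_image[OF H'])
       (auto intro!: continuous_intros convex_Times)
  have a: "path_homotopic X (H \<circ> ?a) (join_path (\<lambda>t. H (t, 0)) (\<lambda>t. H (1, t)))"
    using path_homotopic_imp(1)[OF h]
    by (rule path_homotopic_eq) (auto simp: join_path_def min_def max_def)
  have b: "path_homotopic X (H \<circ> ?b) (join_path (\<lambda>t. H (0, t)) (\<lambda>t. H (t, 1)))"
    using path_homotopic_imp(2)[OF h]
    by (rule path_homotopic_eq) (auto simp: join_path_def min_def max_def)
  show ?thesis
    by (rule path_homotopic_trans[OF path_homotopic_trans[OF path_homotopic_sym[OF a] h] b])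
qed

section \<open>From local to global\<close>

text \<open>A choice of a path \<open>P x\<close> from a base point to each point \<open>x\<close> trivialises a path \<open>g\<close> when
  running along \<open>P (g 0)\<close> and then along \<open>g\<close> is homotopic to \<open>P (g 1)\<close>. Nothing is assumed about
  the dependence of \<open>P x\<close> on \<open>x\<close>; in a simply connected space every choice trivialises all paths.\<close>

locale path_system =
  fixes X :: "'a topology" and x0 :: 'a and P :: "'a \<Rightarrow> real \<Rightarrow> 'a"
  assumes P: "x \<in> topspace X \<Longrightarrow> pathin X (P x)" "x \<in> topspace X \<Longrightarrow> P x 0 = x0"
    "x \<in> topspace X \<Longrightarrow> P x 1 = x"
begin

definition trivialised :: "(real \<Rightarrow> 'a) \<Rightarrow> bool" where
  "trivialised g \<longleftrightarrow> pathin X g \<and> path_homotopic X (join_path (P (g 0)) g) (P (g 1))"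

lemma pathin_ends: "pathin X g \<Longrightarrow> g 0 \<in> topspace X \<and> g 1 \<in> topspace X"
  using path_start_in_topspace path_finish_in_topspace by blast

lemma trivialised_homotopic:
  assumes "path_homotopic X g h" "trivialised g"
  shows "trivialised h"
proof -
  note gh = path_homotopic_imp[OF assms(1)]
  note ends = pathin_ends[OF gh(1)]
  have "path_homotopic X (join_path (P (g 0)) h) (join_path (P (g 0)) g)"
    by (rule path_homotopic_join[OF path_homotopic_refl path_homotopic_sym[OF assms(1)]])
       (use P ends gh in auto)
  also have "path_homotopic X \<dots> (P (g 1))"
    using assms(2) by (simp add: trivialised_def)
  finally show ?thesis using gh by (simp add: trivialised_def)
qed

lemma trivialised_join:
  assumes g: "trivialised g" and h: "trivialised h" and gh: "g 1 = h 0"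
  shows "trivialised (join_path g h)"
proof -
  have p: "pathin X g" "pathin X h" using g h by (simp_all add: trivialised_def)
  note ends = pathin_ends[OF p(1)] pathin_ends[OF p(2)]
  have "path_homotopic X (join_path (P (g 0)) (join_path g h)) (join_path (join_path (P (g 0)) g) h)"
    using p P ends gh by (intro path_homotopic_sym[OF path_homotopic_assoc]) auto
  also have "path_homotopic X \<dots> (join_path (P (g 1)) h)"
    using g gh p by (intro path_homotopic_join path_homotopic_refl) (auto simp: trivialised_def)
  also have "path_homotopic X \<dots> (P (h 1))"
    using h gh by (simp add: trivialised_def)
  finally show ?thesis using p gh by (simp add: trivialised_def pathin_join)
qed

text \<open>Concatenation preserves being trivialised, and by compactness of the interval every path is a
  concatenation of short ones.\<close>

lemma trivialised_if_locally:
  assumes loc: "\<And>x. x \<in> topspace X \<Longrightarrow>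
      \<exists>U. openin X U \<and> x \<in> U \<and> (\<forall>g. pathin X g \<longrightarrow> g ` {0..1} \<subseteq> U \<longrightarrow> trivialised g)"
    and g: "pathin X g"
  shows "trivialised g"
proof -
  let ?seg = "\<lambda>a b t. g (a + (b - a) * t)"
  have cont: "continuous_map (top_of_set {0..1}) X g" using g by (simp add: pathin_def)
  have bounds: "0 \<le> a + (b - a) * t \<and> a + (b - a) * t \<le> 1 \<and> a \<le> a + (b - a) * t \<and> a + (b - a) * t \<le> b"
    if "0 \<le> a" "a \<le> b" "b \<le> 1" "0 \<le> t" "t \<le> 1" for a b t :: real
  proof -
    have "0 \<le> (b - a) * t" "(b - a) * t \<le> b - a"
      by (rule mult_nonneg_nonneg, use that in linarith, rule that)
         (rule mult_left_le, rule that, use that in linarith)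
    then show ?thesis using that by (intro conjI) linarith+
  qed
  have path: "pathin X (?seg a b)" if "0 \<le> a" "a \<le> b" "b \<le> 1" for a b
  proof -
    have "continuous_on {0..1} (\<lambda>t. a + (b - a) * t)"
      by (intro continuous_intros)
    moreover have "(\<lambda>t. a + (b - a) * t) ` {0..1} \<subseteq> {0..1}"
    proof (rule image_subsetI)
      fix t :: real assume "t \<in> {0..1}"
      then show "a + (b - a) * t \<in> {0..1}"
        using bounds[of a b t] that unfolding atLeastAtMost_iff by blast
    qed
    ultimately have "pathin X (g \<circ> (\<lambda>t. a + (b - a) * t))"
      by (rule pathin_convex_image[OF cont])
    then show ?thesis unfolding o_def .
  qed
  (* Bolzano's induction principle on intervals is used in place of an explicit subdivision. *)
  define Q where "Q a b \<longleftrightarrow> (0 \<le> a \<longrightarrow> a \<le> b \<longrightarrow> b \<le> 1 \<longrightarrow> trivialised (?seg a b))" for a b :: real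
  have "(0::real) \<le> 1" by simp
  then have "Q 0 1"
  proof (induction rule: Bolzano)
    case (trans a b c)
    show ?case
      unfolding Q_def
    proof (intro impI)
      assume "0 \<le> a" "a \<le> c" "c \<le> 1"
      note abc = this trans
      have 1: "trivialised (join_path (?seg a b) (?seg b c))"
        using abc unfolding Q_def by (intro trivialised_join) simp_all
      have 2: "path_homotopic X (join_path (?seg a b) (?seg b c)) (?seg a c)"
      proof (rule path_homotopic_reparametrize[OF g])
        show "continuous_on {0..1} (\<lambda>t. a + (b - a) * min (2 * t) 1 + (c - b) * max (2 * t - 1) 0)"
          "continuous_on {0..1} (\<lambda>t. a + (c - a) * t)"
          by (intro continuous_intros)+
        show "0 \<le> a + (c - a) * t \<and> a + (c - a) * t \<le> 1" if "0 \<le> t" "t \<le> 1" for t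
          using bounds[of a c t] abc(1-3) that by simp
        show "0 \<le> a + (b - a) * min (2 * t) 1 + (c - b) * max (2 * t - 1) 0 \<and>
          a + (b - a) * min (2 * t) 1 + (c - b) * max (2 * t - 1) 0 \<le> 1" if "0 \<le> t" "t \<le> 1" for t
        proof (cases "t \<le> 1/2")
          case True
          then have "min (2 * t) 1 = 2 * t" "max (2 * t - 1) 0 = 0" by simp_all
          then show ?thesis using bounds[of a b "2 * t"] abc(1-3,6,7) that True by simp
        next
          case False
          then have "min (2 * t) 1 = 1" "max (2 * t - 1) 0 = 2 * t - 1" by simp_all
          then show ?thesis using bounds[of b c "2 * t - 1"] abc(1-3,6,7) that False by simp
        qed
        show "join_path (?seg a b) (?seg b c) t =
            g (a + (b - a) * min (2 * t) 1 + (c - b) * max (2 * t - 1) 0)" if "0 \<le> t" "t \<le> 1" for t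
        proof (cases "t \<le> 1/2")
          case True
          then have "min (2 * t) 1 = 2 * t" "max (2 * t - 1) 0 = 0" by simp_all
          then show ?thesis using True by (simp add: join_path_def)
        next
          case False
          then have "min (2 * t) 1 = 1" "max (2 * t - 1) 0 = 2 * t - 1" by simp_all
          then show ?thesis using False by (simp add: join_path_def)
        qed
      qed simp_all
      show "trivialised (?seg a c)" by (rule trivialised_homotopic[OF 2 1])
    qed
  next
    case (local x)
    then have "g x \<in> topspace X"
      using continuous_map_image_subset_topspace[OF cont] by (simp add: image_subset_iff)
    from loc[OF this] obtain U where U: "openin X U" "g x \<in> U"
      and triv: "\<forall>h. pathin X h \<longrightarrow> h ` {0..1} \<subseteq> U \<longrightarrow> trivialised h"
      by (elim exE conjE)
    have "openin (top_of_set {0..1}) {t \<in> topspace (top_of_set {0..1}). g t \<in> U}"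
      by (rule openin_continuous_map_preimage[OF cont U(1)])
    moreover have "x \<in> {t \<in> topspace (top_of_set {0..1}). g t \<in> U}"
      using U(2) local by simp
    ultimately obtain d where d: "d > 0"
      "ball x d \<inter> {0..1} \<subseteq> {t \<in> topspace (top_of_set {0..1}). g t \<in> U}"
      unfolding openin_contains_ball by (elim conjE) (drule (1) bspec, elim exE conjE, rule that)
    show ?case
    proof (intro exI[of _ d] conjI d(1) allI impI, unfold Q_def, intro impI)
      fix a b assume "a \<le> x \<and> x \<le> b \<and> b - a < d" "0 \<le> a" "a \<le> b" "b \<le> 1"
      note ab = this
      show "trivialised (?seg a b)"
      proof (rule triv[rule_format, OF path])
        show "?seg a b ` {0..1} \<subseteq> U"
        proof safe
          fix t :: real assume t: "t \<in> {0..1}"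
          have "0 \<le> a + (b - a) * t \<and> a + (b - a) * t \<le> 1 \<and> a \<le> a + (b - a) * t \<and> a + (b - a) * t \<le> b"
            using ab t by (intro bounds) auto
          with ab have "\<bar>a + (b - a) * t - x\<bar> < d" "a + (b - a) * t \<in> {0..1}"
            unfolding abs_less_iff atLeastAtMost_iff by linarith+
          then have "a + (b - a) * t \<in> ball x d \<inter> {0..1}"
            by (simp add: dist_real_def abs_minus_commute)
          then show "g (a + (b - a) * t) \<in> U"
            using d(2) by blast
        qed
      qed (use ab in auto)
    qed
  qed
  then show ?thesis by (simp add: Q_def)
qed

text \<open>A loop that is trivialised is null-homotopic, since the chosen path to its base point cancels.\<close>

lemma simply_connected_if_locally_trivialised:
  assumes loc: "\<And>x. x \<in> topspace X \<Longrightarrow>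
      \<exists>U. openin X U \<and> x \<in> U \<and> (\<forall>g. pathin X g \<longrightarrow> g ` {0..1} \<subseteq> U \<longrightarrow> trivialised g)"
  shows "simply_connected_space X"
  unfolding simply_connected_space_def
proof (intro conjI allI impI)
  show "path_connected_space X"
    unfolding path_connected_space_def
  proof (intro ballI)
    fix x y assume xy: "x \<in> topspace X" "y \<in> topspace X"
    then show "\<exists>g. pathin X g \<and> g 0 = x \<and> g 1 = y"
      using P by (intro exI[of _ "join_path (reverse_path (P x)) (P y)"])
        (auto intro!: pathin_join pathin_reverse)
  qed
next
  fix g assume g: "pathin X g \<and> g 1 = g 0"
  then have x: "g 0 \<in> topspace X" using pathin_ends by blast
  have c: "pathin X (\<lambda>_. g 0)" using x by (simp add: pathin_def)
  have "path_homotopic X (join_path (P (g 0)) g) (P (g 0))"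
    using trivialised_if_locally[OF loc, of g] g by (simp add: trivialised_def)
  also have "path_homotopic X \<dots> (join_path (P (g 0)) (\<lambda>_. g 0))"
    using P x by (intro path_homotopic_sym[OF path_homotopic_join_const]) auto
  finally have "path_homotopic X g (\<lambda>_. g 0)"
    by (rule path_homotopic_cancel_left) (use g P x c in auto)
  then show "homotopic_with (\<lambda>h. h 0 = g 0 \<and> h 1 = g 0) (top_of_set {0..1}) X g (\<lambda>_. g 0)"
    using g by (simp add: path_homotopic_def)
qed

text \<open>A homotopy \<open>H\<close> that moves \<open>U\<close> to a point inside \<open>X\<close> reduces the paths in \<open>U\<close> to the tracks of
  \<open>H\<close>: a path in \<open>U\<close> and the two tracks at its ends bound a triangle.\<close>

lemma trivialised_if_contracts:
  assumes H: "continuous_map (prod_topology (subtopology X U) (top_of_set {0..1})) X H"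
    and U: "U \<subseteq> topspace X"
    and H0: "\<And>x. x \<in> U \<Longrightarrow> H (x, 0) = x" and H1: "\<And>x. x \<in> U \<Longrightarrow> H (x, 1) = c"
    and tr: "\<And>x. x \<in> U \<Longrightarrow> trivialised (\<lambda>s. H (x, s))"
    and g: "pathin X g" "g ` {0..1} \<subseteq> U"
  shows "trivialised g"
proof -
  let ?I = "top_of_set {0..1::real}"
  have gU: "g t \<in> U" if "0 \<le> t" "t \<le> 1" for t using g(2) that by auto
  have "continuous_map (prod_topology ?I ?I) X (H \<circ> (\<lambda>z. (g (fst z), snd z)))"
  proof (rule continuous_map_compose[OF _ H])
    have "continuous_map (prod_topology ?I ?I) (subtopology X U) (g \<circ> fst)"
      using g by (intro continuous_map_compose[OF continuous_map_fst])
        (auto simp: pathin_def continuous_map_in_subtopology)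
    then show "continuous_map (prod_topology ?I ?I) (prod_topology (subtopology X U) ?I)
        (\<lambda>z. (g (fst z), snd z))"
      by (auto simp: continuous_map_pairwise o_def intro!: continuous_intros)
  qed
  then have sq: "path_homotopic X (join_path (\<lambda>t. H (g t, 0)) (\<lambda>s. H (g 1, s)))
      (join_path (\<lambda>s. H (g 0, s)) (\<lambda>t. H (g t, 1)))"
    using path_homotopic_square[of X "H \<circ> (\<lambda>z. (g (fst z), snd z))"] by simp
  let ?t = "\<lambda>x s. H (x, s)"
  have t: "pathin X (?t x)" if "x \<in> U" for x using tr[OF that] by (simp add: trivialised_def)
  have c: "c \<in> topspace X"
    using pathin_ends[OF t[OF gU[of 0]]] H1[OF gU[of 0]] by simp
  have a: "path_homotopic X g (\<lambda>t. H (g t, 0))"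
    using g(1) by (rule path_homotopic_eq) (use H0 gU in auto)
  have "path_homotopic X (join_path g (?t (g 1))) (join_path (\<lambda>t. H (g t, 0)) (?t (g 1)))"
    using a t gU H0 by (intro path_homotopic_join path_homotopic_refl) auto
  also note sq
  also have "path_homotopic X (join_path (?t (g 0)) (\<lambda>t. H (g t, 1))) (join_path (?t (g 0)) (\<lambda>_. c))"
  proof (rule path_homotopic_join)
    have "path_homotopic X (\<lambda>_. c) (\<lambda>t. H (g t, 1))"
      using c H1 gU by (intro path_homotopic_eq) (auto simp: pathin_def)
    then show "path_homotopic X (\<lambda>t. H (g t, 1)) (\<lambda>_. c)" by (rule path_homotopic_sym)
  qed (use t gU H1 in \<open>auto intro: path_homotopic_refl\<close>)
  also have "path_homotopic X \<dots> (?t (g 0))"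
    using t gU H1 by (intro path_homotopic_join_const) auto
  finally have "path_homotopic X (join_path g (?t (g 1))) (?t (g 0))" .
  then have "trivialised (join_path g (?t (g 1)))"
    using trivialised_homotopic[OF path_homotopic_sym] tr[OF gU[of 0]] by simp
  then have 1: "path_homotopic X (join_path (P (g 0)) (join_path g (?t (g 1)))) (P c)"
    using H1 gU by (simp add: trivialised_def)
  have 2: "path_homotopic X (join_path (P (g 1)) (?t (g 1))) (P c)"
    using tr[OF gU[of 1]] H0 H1 gU by (simp add: trivialised_def)
  note ends = pathin_ends[OF g(1)]
  have "path_homotopic X (join_path (join_path (P (g 0)) g) (?t (g 1)))
      (join_path (P (g 0)) (join_path g (?t (g 1))))"
    using ends P g t gU H0 by (intro path_homotopic_assoc) auto
  also note 1
  also note path_homotopic_sym[OF 2]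
  finally have "path_homotopic X (join_path (P (g 0)) g) (P (g 1))"
    by (rule path_homotopic_cancel_right) (use ends P g t gU H0 in \<open>auto intro!: pathin_join\<close>)
  then show ?thesis using g by (simp add: trivialised_def)
qed

end


section \<open>The realisation of a two-complex as a quotient of polar charts\<close>

definition glue_class :: "('v, 'e, 'f) two_complex \<Rightarrow> ('v, 'e, 'f) cell \<times> complex \<Rightarrow>
    (('v, 'e, 'f) cell \<times> complex) set" where
  "glue_class K x = {y. equivclp (glue K) x y}"

lemma glue_class_eq_iff: "glue_class K x = glue_class K y \<longleftrightarrow> equivclp (glue K) x y"
proof
  assume "glue_class K x = glue_class K y"
  moreover have "y \<in> glue_class K y" by (simp add: glue_class_def)
  ultimately show "equivclp (glue K) x y" unfolding glue_class_def by blast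
next
  assume xy: "equivclp (glue K) x y"
  show "glue_class K x = glue_class K y"
    unfolding glue_class_def
    by (intro Collect_cong iffI)
      (erule equivclp_trans[OF equivclp_sym[OF xy]], erule equivclp_trans[OF xy])
qed

lemma glue_class_eqI: "glue K x y \<Longrightarrow> glue_class K x = glue_class K y"
  by (simp add: glue_class_eq_iff r_into_equivclp)

text \<open>A relation that is an equivalence and holds along every gluing holds between identified points.\<close>

lemma glue_class_invariant:
  assumes "glue_class K x = glue_class K y"
    and "\<And>x. R x x" "\<And>x y. glue K x y \<Longrightarrow> R x y" "\<And>x y. R x y \<Longrightarrow> R y x"
    and "\<And>x y z. R x y \<Longrightarrow> R y z \<Longrightarrow> R x z"
  shows "R x y"
  using assms(1)[unfolded glue_class_eq_iff]
proof (induction rule: equivclp_induct)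
  case base show ?case by (rule assms(2))
next
  case (step y z)
  from step(2) have "R y z"
    by (elim disjE) (erule assms(3), rule assms(4), erule assms(3))
  with step(3) show ?case by (rule assms(5))
qed

lemma quotient_map_glue_class:
  "quotient_map (sum_topology cell_model (cells K)) (realisation K) (glue_class K)"
  using quotient_map_quotient_topology[of "sum_topology cell_model (cells K)" "glue_class K"]
  by (simp add: realisation_def glue_class_def[abs_def])

lemma continuous_map_glue_class:
  assumes "c \<in> cells K"
  shows "continuous_map (cell_model c) (realisation K) (\<lambda>z. glue_class K (c, z))"
  using continuous_map_compose[OF continuous_map_component_injection[OF assms]
      quotient_imp_continuous_map[OF quotient_map_glue_class]]
  by (simp add: o_def)

fun cell_set :: "('v, 'e, 'f) cell \<Rightarrow> complex set" where
  "cell_set (Vert v) = {0}"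
| "cell_set (Edge e) = of_real ` {0..1}"
| "cell_set (Face f) = cball 0 1"

lemma cell_model_eq: "cell_model c = top_of_set (cell_set c)"
  by (cases c) auto

lemma topspace_realisation:
  "topspace (realisation K) = glue_class K ` (SIGMA c:cells K. cell_set c)"
  using quotient_imp_surjective_map[OF quotient_map_glue_class, of K]
  by (simp add: o_def cell_model_eq)

text \<open>In polar coordinates, with the angle scaled so that the arcs of a face boundary have
  length one, gluing identifies each arc with an edge by a translation. Edges and vertices are
  placed on the unit circle as well, so that all cells are moved by the same formulas.\<close>

fun polar_set :: "('v, 'e, 'f) two_complex \<Rightarrow> ('v, 'e, 'f) cell \<Rightarrow> (real \<times> real) set" where
  "polar_set K (Vert v) = {1} \<times> {0}"
| "polar_set K (Edge e) = {1} \<times> {0..1}"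
| "polar_set K (Face f) = {0..1} \<times> {0..real (length (boundary K f))}"

fun polar :: "('v, 'e, 'f) two_complex \<Rightarrow> ('v, 'e, 'f) cell \<Rightarrow> real \<times> real \<Rightarrow> complex" where
  "polar K (Vert v) p = 0"
| "polar K (Edge e) p = of_real (snd p)"
| "polar K (Face f) p = of_real (fst p) * cis (2 * pi * snd p / real (length (boundary K f)))"

text \<open>A disjoint union of charts, written as a subspace of a product with a discrete space, so that
  maps into it are continuous as soon as their coordinates are.\<close>

definition polar_charts :: "('v, 'e, 'f) two_complex \<Rightarrow> (('v, 'e, 'f) cell \<times> real \<times> real) topology" where
  "polar_charts K = subtopology (prod_topology (discrete_topology (cells K)) euclidean)
     (SIGMA c:cells K. polar_set K c)"

definition polar_point :: "('v, 'e, 'f) two_complex \<Rightarrow> ('v, 'e, 'f) cell \<times> real \<times> real \<Rightarrow>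
    (('v, 'e, 'f) cell \<times> complex) set" where
  "polar_point K a = glue_class K (fst a, polar K (fst a) (snd a))"

lemma topspace_polar_charts: "topspace (polar_charts K) = (SIGMA c:cells K. polar_set K c)"
  by (auto simp: polar_charts_def)

lemma openin_polar_charts:
  "openin (polar_charts K) W \<longleftrightarrow> W \<subseteq> (SIGMA c:cells K. polar_set K c) \<and>
     (\<forall>c\<in>cells K. openin (top_of_set (polar_set K c)) {p. (c, p) \<in> W})"
proof safe
  fix c p assume "openin (polar_charts K) W" "(c, p) \<in> W"
  then show "c \<in> cells K" "p \<in> polar_set K c"
    using openin_subset topspace_polar_charts by blast+
next
  fix c assume W: "openin (polar_charts K) W" and c: "c \<in> cells K"
  have "continuous_map (top_of_set (polar_set K c)) (polar_charts K) (\<lambda>p. (c, p))"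
    unfolding polar_charts_def continuous_map_in_subtopology
    using c by (auto simp: continuous_map_paired)
  from openin_continuous_map_preimage[OF this W]
  have "openin (top_of_set (polar_set K c)) {p \<in> polar_set K c. (c, p) \<in> W}"
    by simp
  moreover have "{p \<in> polar_set K c. (c, p) \<in> W} = {p. (c, p) \<in> W}"
    using openin_subset[OF W] by (auto simp: topspace_polar_charts)
  ultimately show "openin (top_of_set (polar_set K c)) {p. (c, p) \<in> W}" by simp
next
  assume sub: "W \<subseteq> (SIGMA c:cells K. polar_set K c)"
    and "\<forall>c\<in>cells K. openin (top_of_set (polar_set K c)) {p. (c, p) \<in> W}"
  then have "\<forall>c\<in>cells K. \<exists>T. open T \<and> {p. (c, p) \<in> W} = polar_set K c \<inter> T"
    by (simp add: openin_open)
  then obtain T where T: "\<And>c. c \<in> cells K \<Longrightarrow> open (T c)"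
    "\<And>c. c \<in> cells K \<Longrightarrow> {p. (c, p) \<in> W} = polar_set K c \<inter> T c"
    by metis
  have "openin (prod_topology (discrete_topology (cells K)) euclidean) (\<Union>c\<in>cells K. {c} \<times> T c)"
    using T(1) by (intro openin_Union) (auto simp: openin_prod_Times_iff)
  moreover have "W = (\<Union>c\<in>cells K. {c} \<times> T c) \<inter> (SIGMA c:cells K. polar_set K c)"
    using sub T(2) by (auto simp: set_eq_iff)
  ultimately show "openin (polar_charts K) W"
    unfolding polar_charts_def openin_subtopology by blast
qed

lemma continuous_polar: "continuous_on S (polar K c)"
  by (cases c) (auto intro!: continuous_intros simp: divide_inverse)

lemma image_polar:
  assumes "\<And>f. c = Face f \<Longrightarrow> boundary K f \<noteq> []"
  shows "polar K c ` polar_set K c = cell_set c"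
proof (cases c)
  case (Edge e)
  then show ?thesis by (auto simp: image_iff)
next
  case (Face f)
  define L where "L = real (length (boundary K f))"
  have L: "L > 0" using assms[OF Face] by (simp add: L_def)
  have "z \<in> polar K c ` polar_set K c" if z: "cmod z \<le> 1" for z
  proof
    have *: "2 * pi * (L * Arg2pi z / (2 * pi)) / L = Arg2pi z" using L by simp
    show "z = polar K c (cmod z, L * Arg2pi z / (2 * pi))"
      using Arg2pi_eq[of z] unfolding Face polar.simps L_def[symmetric] fst_conv snd_conv *
      by (simp add: cis_conv_exp)
    have "L * Arg2pi z \<le> L * (2 * pi)"
      using L Arg2pi[of z] by (intro mult_left_mono) auto
    then show "(cmod z, L * Arg2pi z / (2 * pi)) \<in> polar_set K c"
      using z L Arg2pi[of z] by (simp add: Face L_def[symmetric] field_simps)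
  qed
  then show ?thesis using Face by (auto simp: norm_mult)
qed auto

locale reversible_graph =
  fixes K :: "('v, 'e, 'f) two_complex"
  assumes origin_in_verts: "e \<in> edges K \<Longrightarrow> origin K e \<in> verts K"
    and reversal_in_edges: "e \<in> edges K \<Longrightarrow> reversal K e \<in> edges K"
    and reversal_reversal: "e \<in> edges K \<Longrightarrow> reversal K (reversal K e) = e"

locale two_dim_complex = reversible_graph K for K :: "('v, 'e, 'f) two_complex" +
  assumes boundary_nonempty: "f \<in> faces K \<Longrightarrow> boundary K f \<noteq> []"
    and boundary_edges: "f \<in> faces K \<Longrightarrow> set (boundary K f) \<subseteq> edges K"
    and boundary_consecutive: "f \<in> faces K \<Longrightarrow> Suc m < length (boundary K f) \<Longrightarrow>
      origin K (boundary K f ! Suc m) = origin K (reversal K (boundary K f ! m))"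
    and boundary_closed: "f \<in> faces K \<Longrightarrow>
      origin K (reversal K (last (boundary K f))) = origin K (hd (boundary K f))"
begin

lemma Vert_cell [simp]: "Vert v \<in> cells K \<longleftrightarrow> v \<in> verts K"
  and Edge_cell [simp]: "Edge e \<in> cells K \<longleftrightarrow> e \<in> edges K"
  and Face_cell [simp]: "Face f \<in> cells K \<longleftrightarrow> f \<in> faces K"
  by (auto simp: cells_def)

lemma image_polar_cell: "c \<in> cells K \<Longrightarrow> polar K c ` polar_set K c = cell_set c"
  by (rule image_polar) (use boundary_nonempty in auto)

text \<open>On each cell, polar coordinates are a continuous map from a compact chart onto a Hausdorff space,
  hence a quotient map; so the realisation is also the quotient of the polar charts.\<close>

lemma quotient_map_polar_point: "quotient_map (polar_charts K) (realisation K) (polar_point K)"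
proof -
  let ?S = "sum_topology cell_model (cells K)" and ?f = "\<lambda>a. (fst a, polar K (fst a) (snd a))"
  have "quotient_map (polar_charts K) ?S ?f"
    unfolding quotient_map_def
  proof (intro conjI allI impI)
    show im: "?f ` topspace (polar_charts K) = topspace ?S"
      using image_polar_cell by (force simp: topspace_polar_charts cell_model_eq image_iff)
    fix U assume U: "U \<subseteq> topspace ?S"
    have "openin (polar_charts K) {a \<in> topspace (polar_charts K). ?f a \<in> U} \<longleftrightarrow>
        (\<forall>c\<in>cells K. openin (top_of_set (polar_set K c))
          {p. (c, p) \<in> {a \<in> (SIGMA c:cells K. polar_set K c). ?f a \<in> U}})"
      unfolding openin_polar_charts topspace_polar_charts by blast
    also have "\<dots> \<longleftrightarrow>
        (\<forall>c\<in>cells K. openin (top_of_set (polar_set K c)) {p \<in> polar_set K c. (c, polar K c p) \<in> U})"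
      by (intro ball_cong refl arg_cong[where f = "openin _"]) auto
    also have "\<dots> \<longleftrightarrow> (\<forall>c\<in>cells K. openin (top_of_set (cell_set c)) {z. (c, z) \<in> U})"
    proof (intro ball_cong refl)
      fix c assume c: "c \<in> cells K"
      have "compact (polar_set K c)"
        by (cases c) (auto intro!: compact_Times)
      moreover have "{z. (c, z) \<in> U} \<subseteq> cell_set c"
        using U by (auto simp: cell_model_eq)
      ultimately have "openin (top_of_set (polar_set K c)) (polar_set K c \<inter> polar K c -` {z. (c, z) \<in> U}) \<longleftrightarrow>
          openin (top_of_set (cell_set c)) {z. (c, z) \<in> U}"
        by (rule Abstract_Topology_2.continuous_imp_quotient_map[OF continuous_polar image_polar_cell[OF c]])
      moreover have "polar_set K c \<inter> polar K c -` {z. (c, z) \<in> U} = {p \<in> polar_set K c. (c, polar K c p) \<in> U}"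
        by auto
      ultimately show "openin (top_of_set (polar_set K c)) {p \<in> polar_set K c. (c, polar K c p) \<in> U} \<longleftrightarrow>
          openin (top_of_set (cell_set c)) {z. (c, z) \<in> U}"
        by simp
    qed
    also have "\<dots> \<longleftrightarrow> openin ?S U"
      using U by (simp add: openin_sum_topology cell_model_eq)
    finally show "openin (polar_charts K) {a \<in> topspace (polar_charts K). ?f a \<in> U} = openin ?S U" .
  qed
  then have "quotient_map (polar_charts K) (realisation K) (glue_class K \<circ> ?f)"
    using quotient_map_glue_class by (rule quotient_map_compose)
  then show ?thesis by (simp add: polar_point_def[abs_def] o_def)
qed

end

text \<open>Inside a cell any two paths with the same ends are homotopic; so the condition on cells compares
  the chosen paths to the points of one cell with each other.\<close>

locale trivialising_system = two_dim_complex K + path_system "realisation K" x0 P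
  for K :: "('v, 'e, 'f) two_complex" and x0 P +
  assumes trivialised_cell:
    "c \<in> cells K \<Longrightarrow> pathin (cell_model c) g \<Longrightarrow> trivialised (\<lambda>t. glue_class K (c, g t))"
begin

text \<open>A motion of the polar charts that respects the gluing descends to the realisation. When its final
  position is locally constant, the points that come to rest at a given point form an open set that
  is contracted by the motion. Every point moves within its own cell, so its track is trivialised.\<close>

lemma trivialised_near_motion:
  fixes k :: "('v, 'e, 'f) cell \<Rightarrow> real \<times> real \<Rightarrow> real \<Rightarrow> real \<times> real"
  defines "move \<equiv> \<lambda>a s. (fst a, k (fst a) (snd a) s)"
  assumes D: "D \<subseteq> topspace (polar_charts K)"
    and cont: "continuous_map (prod_topology (subtopology (polar_charts K) D) (top_of_set {0..1}))
      (polar_charts K) (\<lambda>z. move (fst z) (snd z))"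
    and start: "\<And>a. a \<in> D \<Longrightarrow> move a 0 = a"
    and glued: "\<And>a b. a \<in> D \<Longrightarrow> b \<in> topspace (polar_charts K) \<Longrightarrow> polar_point K a = polar_point K b \<Longrightarrow>
      b \<in> D \<and> (\<forall>s\<in>{0..1}. polar_point K (move a s) = polar_point K (move b s))"
    and rest: "\<And>y. openin (polar_charts K) {a \<in> D. polar_point K (move a 1) = y}"
    and a0: "a0 \<in> D"
  shows "\<exists>U. openin (realisation K) U \<and> polar_point K a0 \<in> U \<and>
    (\<forall>g. pathin (realisation K) g \<longrightarrow> g ` {0..1} \<subseteq> U \<longrightarrow> trivialised g)"
proof -
  let ?C = "polar_charts K" and ?X = "realisation K" and ?q = "polar_point K"
  define y where "y = ?q (move a0 1)"
  define E where "E = {a \<in> D. ?q (move a 1) = y}"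
  define U where "U = ?q ` E"
  (* A representative of each point of U. The motion of the realisation does not depend on this
     choice, which is what makes it continuous. *)
  define r where "r x = (SOME a. a \<in> E \<and> ?q a = x)" for x
  have ED: "E \<subseteq> topspace ?C" using D by (auto simp: E_def)
  have r: "r x \<in> E" "?q (r x) = x" if "x \<in> U" for x
    using someI_ex[of "\<lambda>a. a \<in> E \<and> ?q a = x"] that unfolding r_def U_def by blast+
  have sat: "b \<in> E" if "a \<in> E" "b \<in> topspace ?C" "?q a = ?q b" for a b
  proof -
    have "b \<in> D \<and> ?q (move a 1) = ?q (move b 1)"
      using glued[of a b] that by (auto simp: E_def)
    then show ?thesis using that by (auto simp: E_def)
  qed
  have pre: "{a \<in> topspace ?C. ?q a \<in> U} = E"
    using sat ED by (force simp: U_def)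
  have openE: "openin ?C E" unfolding E_def by (rule rest)
  have UX: "U \<subseteq> topspace ?X"
    using ED quotient_imp_surjective_map[OF quotient_map_polar_point] by (auto simp: U_def)
  have "\<forall>U\<subseteq>topspace ?X. openin ?C {a \<in> topspace ?C. ?q a \<in> U} = openin ?X U"
    using quotient_map_polar_point unfolding quotient_map_def by (rule conjunct2)
  from this[rule_format, OF UX] have openU: "openin ?X U"
    unfolding pre using openE by (rule iffD1)
  define H where "H z = ?q (move (r (fst z)) (snd z))" for z
  have H: "H (?q a, s) = ?q (move a s)" if "a \<in> E" "s \<in> {0..1}" for a s
  proof -
    have U: "?q a \<in> U" using that(1) unfolding U_def by (rule imageI)
    have D': "r (?q a) \<in> D" using r(1)[OF U] by (simp add: E_def)
    have a: "a \<in> topspace ?C" using ED that(1) by (rule subsetD)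
    have "\<forall>s\<in>{0..1}. ?q (move (r (?q a)) s) = ?q (move a s)"
      by (rule conjunct2[OF glued[OF D' a r(2)[OF U]]])
    then show ?thesis using that(2) unfolding H_def fst_conv snd_conv by (rule bspec)
  qed
  have Hcont: "continuous_map (prod_topology (subtopology ?X U) (top_of_set {0..1})) ?X H"
  proof -
    have "quotient_map (subtopology ?C E) (subtopology ?X U) ?q"
      using quotient_map_polar_point pre openU by (intro quotient_map_restriction) auto
    (* The product of a quotient map with the interval is a quotient map, as the interval is
       locally compact. *)
    then have q: "quotient_map (prod_topology (subtopology ?C E) (top_of_set {0..1}))
        (prod_topology (subtopology ?X U) (top_of_set {0..1::real})) (\<lambda>(a, s). (?q a, s))"
      by (intro quotient_map_prod_left)
        (auto intro!: compact_imp_locally_compact_space Hausdorff_space_subtopology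
          simp: compact_space_subtopology compactin_euclidean_iff)
    have "continuous_map (prod_topology (subtopology ?C E) (top_of_set {0..1})) ?C
        (\<lambda>z. move (fst z) (snd z))"
    proof -
      have "D \<inter> E = E" by (auto simp: E_def)
      then have "subtopology ?C E = subtopology (subtopology ?C D) E"
        by (simp add: subtopology_subtopology)
      then show ?thesis
        unfolding prod_topology_subtopology(1)[of "subtopology ?C D"]
        by (simp only: prod_topology_subtopology(1)[of "subtopology ?C D"]
            continuous_map_from_subtopology[OF cont])
    qed
    from continuous_map_compose[OF this quotient_imp_continuous_map[OF quotient_map_polar_point]]
    have "continuous_map (prod_topology (subtopology ?C E) (top_of_set {0..1})) ?X
        (H \<circ> (\<lambda>(a, s). (?q a, s)))"
      by (rule continuous_map_eq) (auto simp: H)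
    then show ?thesis
      using continuous_compose_quotient_map_eq[OF q] by blast
  qed
  have H01: "H (x, 0) = x" "H (x, 1) = y" if "x \<in> U" for x
    using r[OF that] start by (auto simp: H_def E_def)
  have Htriv: "trivialised (\<lambda>s. H (x, s))" if x: "x \<in> U" for x
  proof -
    let ?a = "r x"
    have a: "?a \<in> D" "fst ?a \<in> cells K"
      using r(1)[OF x] D by (auto simp: E_def topspace_polar_charts)
    have "pathin ?C (\<lambda>s. move ?a s)"
      unfolding pathin_def
    proof (rule continuous_map_compose[of _ "prod_topology (subtopology ?C D) (top_of_set {0..1})"
          "\<lambda>s. (?a, s)", OF _ cont, unfolded o_def fst_conv snd_conv])
      show "continuous_map (top_of_set {0..1}) (prod_topology (subtopology ?C D) (top_of_set {0..1}))
          (\<lambda>s. (?a, s))"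
        using a D by (auto simp: continuous_map_paired)
    qed
    then have m: "continuous_map (top_of_set {0..1}) ?C (\<lambda>s. move ?a s)"
      by (simp add: pathin_def)
    then have "continuous_map (top_of_set {0..1}) euclidean (\<lambda>s. snd (move ?a s))"
      unfolding polar_charts_def continuous_map_in_subtopology
      using continuous_map_snd_of[unfolded o_def] by blast
    then have c: "continuous_on {0..1} (\<lambda>s. k (fst ?a) (snd ?a) s)"
      by (simp add: move_def)
    have i: "k (fst ?a) (snd ?a) s \<in> polar_set K (fst ?a)" if "s \<in> {0..1}" for s
      using continuous_map_image_subset_topspace[OF m] that
      by (auto simp: move_def topspace_polar_charts image_subset_iff)
    have "pathin (cell_model (fst ?a)) (\<lambda>s. polar K (fst ?a) (k (fst ?a) (snd ?a) s))"
      unfolding pathin_def cell_model_eq continuous_map_in_subtopology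
    proof
      show "continuous_map (top_of_set {0..1}) euclidean (\<lambda>s. polar K (fst ?a) (k (fst ?a) (snd ?a) s))"
        using continuous_on_compose2[OF continuous_polar[of UNIV] c] by simp
      show "(\<lambda>s. polar K (fst ?a) (k (fst ?a) (snd ?a) s)) \<in> topspace (top_of_set {0..1}) \<rightarrow> cell_set (fst ?a)"
        using i image_polar_cell[OF a(2)] by auto
    qed
    from trivialised_cell[OF a(2) this]
    show ?thesis by (simp add: H_def polar_point_def move_def)
  qed
  have "?q a0 \<in> U" using a0 by (auto simp: U_def E_def y_def)
  then show ?thesis
    by (intro exI[of _ U] conjI openU allI impI trivialised_if_contracts[OF Hcont UX H01 Htriv])
qed

end


section \<open>Contracting the stars of a two-complex\<close>

text \<open>Cut the real line at the points \<open>n - a\<close> with \<open>n\<close> an integer, and move every other point to the middle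
  of its interval. In terms of the angular coordinate, \<open>a = 0\<close> moves towards the midpoints of edges,
  and \<open>a = 1/2\<close> moves towards vertices. In both cases the motion commutes with integer translations
  and with the reflection \<open>x \<mapsto> 1 - x\<close>, and these are all the coordinate changes that occur in the
  gluing.\<close>

definition stop :: "real \<Rightarrow> real \<Rightarrow> real" where
  "stop a x = of_int \<lfloor>x + a\<rfloor> + 1/2 - a"

lemma stop_add_int: "stop a (x + of_int n) = stop a x + of_int n"
proof -
  have "x + of_int n + a = (x + a) + of_int n" by simp
  then show ?thesis unfolding stop_def by (simp only: floor_add_int of_int_add) simp
qed

lemma not_Ints_add_int: "(x::real) + of_int n + a \<in> \<int> \<longleftrightarrow> x + a \<in> \<int>"
proof -
  have "x + of_int n + a = (x + a) + of_int n" by simp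
  then show ?thesis by (metis Ints_add Ints_of_int Ints_diff add_diff_cancel_right')
qed

lemma floor_not_Ints:
  assumes "(x::real) \<notin> \<int>"
  shows "of_int \<lfloor>x\<rfloor> < x" "x < of_int \<lfloor>x\<rfloor> + 1"
proof -
  have "of_int \<lfloor>x\<rfloor> \<noteq> x" using assms by (metis Ints_of_int)
  then show "of_int \<lfloor>x\<rfloor> < x" using of_int_floor_le[of x] by linarith
qed (rule floor_correct[THEN conjunct2, simplified])

lemma reflect_Ints:
  assumes "a \<in> {0, 1/2::real}"
  shows "(1 - x) + a \<in> \<int> \<longleftrightarrow> x + a \<in> \<int>"
proof -
  have "1 + 2 * a = 1 \<or> 1 + 2 * a = 2" using assms by auto
  then have "1 + 2 * a \<in> \<int>" by (elim disjE) (simp_all only: Ints_1 Ints_numeral)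
  moreover have "(1 - x) + a = (1 + 2 * a) - (x + a)" "x + a = (1 + 2 * a) - ((1 - x) + a)" by simp_all
  ultimately show ?thesis by (metis Ints_diff)
qed

lemma stop_reflect:
  assumes a: "a \<in> {0, 1/2}" and x: "x + a \<notin> \<int>"
  shows "stop a (1 - x) = 1 - stop a x"
proof -
  obtain n :: int where n: "2 * a = of_int n"
    using a by (metis Ints_cases Ints_0 Ints_1 insertE mult_zero_right nonzero_mult_div_cancel_left
        singletonD times_divide_eq_right zero_neq_numeral)
  have "\<lfloor>(1 - x) + a\<rfloor> = n - \<lfloor>x + a\<rfloor>"
    using floor_not_Ints[OF x] n by (intro floor_unique; simp only: of_int_diff; linarith)
  then show ?thesis using n by (simp add: stop_def)
qed

text \<open>The chart of an edge or a face lies between two integers, and it is not left by the motion.\<close>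

lemma stop_bounds:
  fixes m n :: int
  assumes a: "a \<in> {0, 1/2}" and x: "x + a \<notin> \<int>" and m: "of_int m \<le> x" and n: "x \<le> of_int n"
  shows "of_int m \<le> stop a x" "stop a x \<le> of_int n"
proof -
  note f = floor_not_Ints[OF x]
  have "m \<le> \<lfloor>x + a\<rfloor>" using m a by (auto simp: le_floor_iff)
  then show "of_int m \<le> stop a x" using a unfolding stop_def by auto
  show "stop a x \<le> of_int n"
  proof (cases "a = 0")
    case True
    have "of_int \<lfloor>x\<rfloor> < (of_int n :: real)" using f n True by simp
    then have "\<lfloor>x\<rfloor> \<le> n - 1" by linarith
    then show ?thesis using True unfolding stop_def by auto
  next
    case False
    then have "of_int \<lfloor>x + a\<rfloor> < (of_int n + 1 :: real)" using f n a by auto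
    then have "\<lfloor>x + a\<rfloor> \<le> n" by linarith
    then show ?thesis using False a unfolding stop_def by auto
  qed
qed

lemma open_stop_fibre: "open {x. x + a \<notin> \<int> \<and> stop a x = w}"
proof -
  have "{x. x + a \<notin> \<int> \<and> stop a x = w} =
      (\<Union>n\<in>{n. of_int n + 1/2 - a = w}. {of_int n - a <..< of_int n + 1 - a})" (is "?A = ?B")
  proof (intro equalityI subsetI)
    fix x assume x: "x \<in> ?A"
    then have "\<lfloor>x + a\<rfloor> \<in> {n. of_int n + 1/2 - a = w}" by (simp add: stop_def)
    moreover have "x \<in> {of_int \<lfloor>x + a\<rfloor> - a <..< of_int \<lfloor>x + a\<rfloor> + 1 - a}"
      using x floor_not_Ints[of "x + a"]
      unfolding greaterThanLessThan_iff mem_Collect_eq by (intro conjI; linarith)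
    ultimately show "x \<in> ?B" by blast
  next
    fix x assume "x \<in> ?B"
    then obtain n where n: "of_int n + 1/2 - a = w" "of_int n - a < x" "x < of_int n + 1 - a"
      by auto
    then have fl: "\<lfloor>x + a\<rfloor> = n" by (intro floor_unique) auto
    have "x + a \<notin> \<int>"
    proof
      assume "x + a \<in> \<int>"
      then have "of_int \<lfloor>x + a\<rfloor> = x + a" by (simp add: of_int_floor_cancel)
      then show False using n fl by simp
    qed
    then show "x \<in> ?A" using n fl by (simp add: stop_def)
  qed
  then show ?thesis by auto
qed

lemma continuous_on_stop: "continuous_on {x. x + a \<notin> \<int>} (stop a)"
proof (rule continuous_at_imp_continuous_on, rule ballI)
  fix x assume x: "x \<in> {x. x + a \<notin> \<int>}"
  have "eventually (\<lambda>y. y \<in> {y. y + a \<notin> \<int> \<and> stop a y = stop a x}) (nhds x)"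
    using x open_stop_fibre by (intro eventually_nhds_in_open) auto
  then have "eventually (\<lambda>y. stop a y = stop a x) (nhds x)"
    by (rule eventually_mono) simp
  then show "isCont (stop a) x" by (simp add: isCont_cong)
qed

lemma cis_int_periodic:
  assumes "L > 0"
  shows "cis (2 * pi * (x + of_int n * L) / L) = cis (2 * pi * x / L)"
proof -
  have "2 * pi * (x + of_int n * L) / L = 2 * pi * x / L + 2 * pi * of_int n"
    using assms by (simp add: field_simps)
  then show ?thesis by (simp add: cis_mult[symmetric] cis_multiple_2pi)
qed

lemma cis_scaled_eqD:
  assumes "L > 0" "cis (2 * pi * x / L) = cis (2 * pi * y / L)"
  shows "\<exists>n::int. x = y + of_int n * L"
proof -
  have "sin (2 * pi * x / L) = sin (2 * pi * y / L) \<and> cos (2 * pi * x / L) = cos (2 * pi * y / L)"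
    using assms(2) by (simp add: complex_eq_iff)
  then obtain n :: int where "2 * pi * x / L = 2 * pi * y / L + 2 * pi * n"
    using sin_cos_eq_iff by blast
  then have "2 * pi * x = 2 * pi * (y + of_int n * L)" using assms(1) by (simp add: field_simps)
  then show ?thesis by auto
qed

context two_dim_complex
begin

text \<open>Induction on the gluing, in polar coordinates. Besides the gluing rules, the identifications
  within a chart (the centre of a disc, and the two ends of the angular interval) have to be
  respected.\<close>

lemma polar_point_invariant:
  assumes "polar_point K a = polar_point K b"
    and ab: "a \<in> topspace (polar_charts K)" "b \<in> topspace (polar_charts K)"
    and sym: "\<And>a b. R a b \<Longrightarrow> R b a" and trans: "\<And>a b c. R a b \<Longrightarrow> R b c \<Longrightarrow> R a c"
    and same: "\<And>c p p'. c \<in> cells K \<Longrightarrow> p \<in> polar_set K c \<Longrightarrow> p' \<in> polar_set K c \<Longrightarrow>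
      polar K c p = polar K c p' \<Longrightarrow> R (c, p) (c, p')"
    and org: "\<And>e. e \<in> edges K \<Longrightarrow> R (Edge e, 1, 0) (Vert (origin K e), 1, 0)"
    and rev: "\<And>e t. e \<in> edges K \<Longrightarrow> t \<in> {0..1} \<Longrightarrow>
      R (Edge e, 1, t) (Edge (reversal K e), 1, 1 - t)"
    and face: "\<And>f m t. f \<in> faces K \<Longrightarrow> m < length (boundary K f) \<Longrightarrow> t \<in> {0..1} \<Longrightarrow>
      R (Face f, 1, real m + t) (Edge (boundary K f ! m), 1, t)"
  shows "R a b"
proof -
  let ?C = "topspace (polar_charts K)"
  define pos where "pos a = (fst a, polar K (fst a) (snd a))" for a
  (* The relation R, transported to pairs of a cell and a point of its model. The first conjunct
     keeps the induction within the charts. *)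
  define R' where "R' x y \<longleftrightarrow> (x \<in> pos ` ?C \<longleftrightarrow> y \<in> pos ` ?C) \<and>
    (\<forall>a\<in>?C. \<forall>b\<in>?C. pos a = x \<longrightarrow> pos b = y \<longrightarrow> R a b)" for x y
  have same': "R a b" if "a \<in> ?C" "b \<in> ?C" "pos a = pos b" for a b
    using same[of "fst a" "snd a" "snd b"] that
    by (cases a; cases b) (simp add: pos_def topspace_polar_charts)
  have R'I: "R' x y" if "a \<in> ?C" "b \<in> ?C" "pos a = x" "pos b = y" "R a b" for a b x y
    unfolding R'_def
  proof (intro conjI ballI impI)
    show "x \<in> pos ` ?C \<longleftrightarrow> y \<in> pos ` ?C" using that(1-4) by blast
    fix a' b' assume "a' \<in> ?C" "b' \<in> ?C" "pos a' = x" "pos b' = y"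
    then show "R a' b'"
      using that same'[of a' a] same'[of b b'] trans by metis
  qed
  have bd: "boundary K f ! m \<in> edges K" if "f \<in> faces K" "m < length (boundary K f)" for f m
    using boundary_edges that by (meson nth_mem subsetD)
  have "R' (pos a) (pos b)"
  proof (rule glue_class_invariant)
    show "glue_class K (pos a) = glue_class K (pos b)"
      using assms(1) by (simp add: polar_point_def pos_def)
    show "R' x x" for x using same' by (auto simp: R'_def)
    show "R' y x" if "R' x y" for x y
      using that sym unfolding R'_def by blast
    show "R' x z" if xy: "R' x y" and yz: "R' y z" for x y z
      unfolding R'_def
    proof (intro conjI ballI impI)
      show "x \<in> pos ` ?C \<longleftrightarrow> z \<in> pos ` ?C" using xy yz by (simp add: R'_def)
      fix a c assume ac: "a \<in> ?C" "c \<in> ?C" "pos a = x" "pos c = z"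
      then have "x \<in> pos ` ?C" by blast
      then have "y \<in> pos ` ?C" using xy by (simp add: R'_def)
      then obtain b where "b \<in> ?C" "pos b = y" by blast
      then have "R a b" "R b c" using xy yz ac unfolding R'_def by blast+
      then show "R a c" by (rule trans)
    qed
    show "R' x y" if "glue K x y" for x y
      using that
    proof cases
      case (glue_origin e)
      then show ?thesis
        using org[of e] origin_in_verts[of e]
        by (intro R'I[of "(Edge e, 1, 0)" "(Vert (origin K e), 1, 0)"])
          (auto simp: pos_def topspace_polar_charts)
    next
      case (glue_reversal e t)
      then show ?thesis
        using rev[of e t] reversal_in_edges[of e]
        by (intro R'I[of "(Edge e, 1, t)" "(Edge (reversal K e), 1, 1 - t)"])
          (auto simp: pos_def topspace_polar_charts)
    next
      case (glue_face f m t)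
      then have "real m + t \<le> real (length (boundary K f))"
        using nat_less_real_le[of m "length (boundary K f)"] by auto
      then show ?thesis
        using face[of f m t] bd[of f m] glue_face
        by (intro R'I[of "(Face f, 1, real m + t)" "(Edge (boundary K f ! m), 1, t)"])
          (auto simp: pos_def topspace_polar_charts)
    qed
  qed
  then show ?thesis using ab by (auto simp: R'_def)
qed

lemma polar_point_eqI:
  "e \<in> edges K \<Longrightarrow> polar_point K (Edge e, 1, 0) = polar_point K (Vert (origin K e), 1, 0)"
  "e \<in> edges K \<Longrightarrow> t \<in> {0..1} \<Longrightarrow>
    polar_point K (Edge e, 1, t) = polar_point K (Edge (reversal K e), 1, 1 - t)"
  "f \<in> faces K \<Longrightarrow> m < length (boundary K f) \<Longrightarrow> t \<in> {0..1} \<Longrightarrow>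
    polar_point K (Face f, 1, real m + t) = polar_point K (Edge (boundary K f ! m), 1, t)"
  using glue_class_eqI[OF glue_origin[of e K]] glue_class_eqI[OF glue_reversal[of e K t]]
    glue_class_eqI[OF glue_face[of f K m t]]
  by (simp_all add: polar_point_def)

end

context trivialising_system
begin

text \<open>All points apart from the centres of faces and from the radii at the cut points: for \<open>a = 1/2\<close> what
  lies over the open stars of the vertices, for \<open>a = 0\<close> what lies over the open stars of the midpoints
  of edges.\<close>

definition slide_domain :: "real \<Rightarrow> (('v, 'e, 'f) cell \<times> real \<times> real) set" where
  "slide_domain a = {x \<in> topspace (polar_charts K). 0 < fst (snd x) \<and> snd (snd x) + a \<notin> \<int>}"

definition slide :: "real \<Rightarrow> ('v, 'e, 'f) cell \<Rightarrow> real \<times> real \<Rightarrow> real \<Rightarrow> real \<times> real" where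
  "slide a c p s = ((1 - s) * fst p + s, (1 - s) * snd p + s * stop a (snd p))"

lemma slide_in_polar_set:
  assumes a: "a \<in> {0, 1/2}" and p: "p \<in> polar_set K c" "snd p + a \<notin> \<int>" and s: "s \<in> {0..1}"
  shows "slide a c p s \<in> polar_set K c"
proof -
  have conv: "(1 - s) * x + s * y \<in> {u..v}" if "x \<in> {u..v}" "y \<in> {u..v}" for x y u v :: real
    using convexD_alt[of "{u..v}" x y s] that s by auto
  have st: "stop a (snd p) \<in> {0..real n}" if "snd p \<in> {0..real n}" for n
    using stop_bounds[OF a p(2), of 0 "int n"] that by auto
  show ?thesis
  proof (cases c)
    case (Vert v)
    then show ?thesis using p st[of 0] by (auto simp: slide_def)
  next
    case (Edge e)
    then show ?thesis using p st[of 1] conv[of "snd p" 0 1 "stop a (snd p)"] by (auto simp: slide_def)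
  next
    case (Face f)
    let ?L = "length (boundary K f)"
    show ?thesis
      using p Face st[of ?L] conv[of "snd p" 0 "real ?L" "stop a (snd p)"] conv[of "fst p" 0 1 1]
      by (auto simp: slide_def mem_Times_iff)
  qed
qed

text \<open>Away from the centres of the discs, points are identified by integer translations and by the
  reflection of edges, and these commute with the motion.\<close>

lemma slide_respects_gluing:
  assumes a: "a \<in> {0, 1/2}" and x: "x \<in> slide_domain a" and y: "y \<in> topspace (polar_charts K)"
    and xy: "polar_point K x = polar_point K y"
  shows "y \<in> slide_domain a \<and> (\<forall>s\<in>{0..1}.
    polar_point K (fst x, slide a (fst x) (snd x) s) = polar_point K (fst y, slide a (fst y) (snd y) s))"
proof -
  let ?D = "\<lambda>x. 0 < fst (snd x) \<and> snd (snd x) + a \<notin> \<int>"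
  let ?m = "\<lambda>x s. (fst x, slide a (fst x) (snd x) s)"
  define R where "R x y \<longleftrightarrow> (?D x \<longleftrightarrow> ?D y) \<and>
    (?D x \<longrightarrow> (\<forall>s\<in>{0..1}. polar_point K (?m x s) = polar_point K (?m y s)))"
    for x y :: "('v, 'e, 'f) cell \<times> real \<times> real"
  have st: "(1 - s) * t + s * stop a t \<in> {0..1}" if "t \<in> {0..1}" "t + a \<notin> \<int>" "s \<in> {0..1}" for s t
    using convexD_alt[of "{0..1}" t "stop a t" s] stop_bounds[OF a that(2), of 0 1] that by auto
  have "R x y"
  proof (rule polar_point_invariant[OF xy])
    show "x \<in> topspace (polar_charts K)" using x by (simp add: slide_domain_def)
    show "y \<in> topspace (polar_charts K)" by (rule y)
    show "R b a" if "R a b" for a b using that unfolding R_def by simp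
    show "R a c" if "R a b" "R b c" for a b c using that unfolding R_def by simp
    show "R (c, p) (c, p')" if c: "c \<in> cells K" and p: "p \<in> polar_set K c" "p' \<in> polar_set K c"
      and eq: "polar K c p = polar K c p'" for c p p'
    proof (cases c)
      case (Face f)
      define L where "L = real (length (boundary K f))"
      have L: "L > 0" using c boundary_nonempty[of f] by (simp add: Face L_def)
      have pos: "0 \<le> fst p" "0 \<le> fst p'" using p by (auto simp: Face)
      have "cmod (polar K c p) = cmod (polar K c p')" using eq by simp
      then have r: "fst p = fst p'" using pos by (simp add: Face norm_mult)
      show ?thesis
      proof (cases "fst p = 0")
        case True then show ?thesis using r by (simp add: R_def)
      next
        case False
        then have "cis (2 * pi * snd p / L) = cis (2 * pi * snd p' / L)"
          using eq r by (simp add: Face L_def)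
        then obtain n :: int where n: "snd p = snd p' + of_int n * L"
          using cis_scaled_eqD[OF L] by blast
        have nL: "of_int n * L = of_int (n * int (length (boundary K f)))" by (simp add: L_def)
        have "snd p + a \<in> \<int> \<longleftrightarrow> snd p' + a \<in> \<int>"
          unfolding n nL by (rule not_Ints_add_int)
        moreover have "polar_point K (?m (c, p) s) = polar_point K (?m (c, p') s)" for s
        proof -
          have "stop a (snd p) = stop a (snd p') + of_int n * L"
            unfolding n nL by (rule stop_add_int)
          then have "(1 - s) * snd p + s * stop a (snd p) =
              ((1 - s) * snd p' + s * stop a (snd p')) + of_int n * L"
            unfolding n by (simp add: algebra_simps)
          then have "polar K c (slide a c p s) = polar K c (slide a c p' s)"
            using cis_int_periodic[OF L] r by (simp add: Face slide_def L_def)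
          then show ?thesis by (simp add: polar_point_def)
        qed
        ultimately show ?thesis using r by (simp add: R_def)
      qed
    next
      case (Edge e)
      then have "p = p'" using p eq by (auto simp: prod_eq_iff)
      then show ?thesis by (simp add: R_def)
    next
      case (Vert v)
      then have "p = p'" using p by auto
      then show ?thesis by (simp add: R_def)
    qed
    show "R (Edge e, 1, 0) (Vert (origin K e), 1, 0)" if "e \<in> edges K" for e
    proof -
      have "stop a 0 = 0" if "a \<notin> \<int>" using stop_bounds[OF a, of 0 0 0] that by auto
      then show ?thesis using that polar_point_eqI(1)[of e] by (simp add: R_def slide_def)
    qed
    show "R (Edge e, 1, t) (Edge (reversal K e), 1, 1 - t)" if e: "e \<in> edges K" and t: "t \<in> {0..1}" for e t
    proof -
      have "polar_point K (?m (Edge e, 1, t) s) = polar_point K (?m (Edge (reversal K e), 1, 1 - t) s)"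
        if "t + a \<notin> \<int>" "s \<in> {0..1}" for s
      proof -
        have "(1 - s) * (1 - t) + s * stop a (1 - t) = 1 - ((1 - s) * t + s * stop a t)"
          unfolding stop_reflect[OF a that(1)] by (simp add: algebra_simps)
        then show ?thesis
          using polar_point_eqI(2)[OF e st[OF t that]] by (simp add: slide_def)
      qed
      then show ?thesis using reflect_Ints[OF a, of t] by (simp add: R_def)
    qed
    show "R (Face f, 1, real m + t) (Edge (boundary K f ! m), 1, t)"
      if f: "f \<in> faces K" "m < length (boundary K f)" and t: "t \<in> {0..1}" for f m t
    proof -
      have mt: "real m + t = t + of_int (int m)" by simp
      have "polar_point K (?m (Face f, 1, real m + t) s) = polar_point K (?m (Edge (boundary K f ! m), 1, t) s)"
        if "t + a \<notin> \<int>" "s \<in> {0..1}" for s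
      proof -
        have "(1 - s) * (real m + t) + s * stop a (real m + t) = real m + ((1 - s) * t + s * stop a t)"
          unfolding mt stop_add_int by (simp add: algebra_simps)
        then show ?thesis
          using polar_point_eqI(3)[OF f st[OF t that]] by (simp add: slide_def)
      qed
      moreover have "real m + t + a \<in> \<int> \<longleftrightarrow> t + a \<in> \<int>"
        unfolding mt by (rule not_Ints_add_int)
      ultimately show ?thesis by (simp add: R_def)
    qed
  qed
  then show ?thesis using x y by (simp add: R_def slide_domain_def)
qed

lemma continuous_map_chart_coordinates:
  assumes D: "D \<subseteq> topspace (polar_charts K)"
  defines "Z \<equiv> prod_topology (subtopology (polar_charts K) D) (top_of_set {0..1::real})"
  shows "continuous_map Z (discrete_topology (cells K)) (\<lambda>z. fst (fst z))"
    "continuous_map Z euclideanreal (\<lambda>z. fst (snd (fst z)))"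
    "continuous_map Z euclideanreal (\<lambda>z. snd (snd (fst z)))"
    "continuous_map Z euclideanreal snd"
proof -
  have i: "continuous_map (subtopology (polar_charts K) D)
      (prod_topology (discrete_topology (cells K)) euclidean) (\<lambda>x. x)"
    unfolding polar_charts_def subtopology_subtopology by (rule continuous_map_from_subtopology) simp
  have f: "continuous_map Z (prod_topology (discrete_topology (cells K)) euclidean) fst"
    using continuous_map_compose[OF continuous_map_fst i] unfolding Z_def by (simp add: o_def)
  show "continuous_map Z (discrete_topology (cells K)) (\<lambda>z. fst (fst z))"
    using continuous_map_fst_of[OF f] by (simp add: o_def)
  have s: "continuous_map Z (prod_topology euclideanreal euclideanreal) (\<lambda>z. snd (fst z))"
    using continuous_map_snd_of[OF f] by (simp add: o_def)
  show "continuous_map Z euclideanreal (\<lambda>z. fst (snd (fst z)))"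
    using continuous_map_fst_of[OF s] by (simp add: o_def)
  show "continuous_map Z euclideanreal (\<lambda>z. snd (snd (fst z)))"
    using continuous_map_snd_of[OF s] by (simp add: o_def)
  show "continuous_map Z euclideanreal snd"
    unfolding Z_def by (rule continuous_map_into_fulltopology[OF continuous_map_snd])
qed

lemma continuous_map_into_polar_charts:
  assumes "continuous_map Z (discrete_topology (cells K)) f"
    and "continuous_map Z euclideanreal g" "continuous_map Z euclideanreal h"
    and "\<And>z. z \<in> topspace Z \<Longrightarrow> (g z, h z) \<in> polar_set K (f z)"
  shows "continuous_map Z (polar_charts K) (\<lambda>z. (f z, g z, h z))"
  unfolding polar_charts_def continuous_map_in_subtopology
proof
  have "continuous_map Z (prod_topology euclideanreal euclideanreal) (\<lambda>z. (g z, h z))"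
    using assms(2,3) by (rule continuous_map_pairedI)
  then show "continuous_map Z (prod_topology (discrete_topology (cells K)) euclidean) (\<lambda>z. (f z, g z, h z))"
    using assms(1) by (intro continuous_map_pairedI) simp_all
  show "(\<lambda>z. (f z, g z, h z)) \<in> topspace Z \<rightarrow> Sigma (cells K) (polar_set K)"
    using assms(4) continuous_map_image_subset_topspace[OF assms(1)] by auto
qed

text \<open>The motion ends at a vertex or at the midpoint of an edge, and this final position is constant on
  each sector between two cuts.\<close>

lemma trivialised_near_slide_domain:
  assumes a: "a \<in> {0, 1/2}" and x: "x \<in> slide_domain a"
  shows "\<exists>U. openin (realisation K) U \<and> polar_point K x \<in> U \<and>
    (\<forall>g. pathin (realisation K) g \<longrightarrow> g ` {0..1} \<subseteq> U \<longrightarrow> trivialised g)"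
proof (rule trivialised_near_motion[where k = "slide a" and D = "slide_domain a"])
  show D: "slide_domain a \<subseteq> topspace (polar_charts K)" by (auto simp: slide_domain_def)
  show "x \<in> slide_domain a" by (rule x)
  show "(fst x, slide a (fst x) (snd x) 0) = x" for x :: "('v, 'e, 'f) cell \<times> real \<times> real"
    by (simp add: slide_def)
  show "y \<in> slide_domain a \<and> (\<forall>s\<in>{0..1}. polar_point K (fst x, slide a (fst x) (snd x) s) =
      polar_point K (fst y, slide a (fst y) (snd y) s))"
    if "x \<in> slide_domain a" "y \<in> topspace (polar_charts K)" "polar_point K x = polar_point K y" for x y
    by (rule slide_respects_gluing[OF a that])
  let ?Z = "prod_topology (subtopology (polar_charts K) (slide_domain a)) (top_of_set {0..1::real})"
  note co = continuous_map_chart_coordinates[OF D]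
  have "continuous_map ?Z (top_of_set {x. x + a \<notin> \<int>}) (\<lambda>z. snd (snd (fst z)))"
    using co(3) by (auto simp: continuous_map_in_subtopology slide_domain_def)
  from continuous_map_compose[OF this, of euclideanreal "stop a"]
  have st: "continuous_map ?Z euclideanreal (\<lambda>z. stop a (snd (snd (fst z))))"
    using continuous_on_stop by (simp add: o_def)
  have "continuous_map ?Z (polar_charts K) (\<lambda>z. (fst (fst z), (1 - snd z) * fst (snd (fst z)) + snd z,
      (1 - snd z) * snd (snd (fst z)) + snd z * stop a (snd (snd (fst z)))))"
  proof (rule continuous_map_into_polar_charts)
    show "((1 - snd z) * fst (snd (fst z)) + snd z,
        (1 - snd z) * snd (snd (fst z)) + snd z * stop a (snd (snd (fst z)))) \<in> polar_set K (fst (fst z))"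
      if "z \<in> topspace ?Z" for z
      using slide_in_polar_set[OF a, of "snd (fst z)" "fst (fst z)" "snd z"] that
      by (auto simp: slide_def slide_domain_def topspace_polar_charts)
  qed (intro continuous_map_add continuous_map_real_mult continuous_map_diff co st; simp)+
  then show "continuous_map ?Z (polar_charts K)
      (\<lambda>z. (fst (fst z), slide a (fst (fst z)) (snd (fst z)) (snd z)))"
    by (simp add: slide_def)
  show "openin (polar_charts K) {x \<in> slide_domain a. polar_point K (fst x, slide a (fst x) (snd x) 1) = y}" for y
    unfolding openin_polar_charts
  proof (intro conjI ballI)
    show "{x \<in> slide_domain a. polar_point K (fst x, slide a (fst x) (snd x) 1) = y}
        \<subseteq> Sigma (cells K) (polar_set K)"
      using D by (auto simp: topspace_polar_charts)
    fix c assume c: "c \<in> cells K"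
    let ?W = "{w. polar_point K (c, 1, w) = y}"
    let ?T = "\<Union>w\<in>?W. ({0<..} :: real set) \<times> {x. x + a \<notin> \<int> \<and> stop a x = w}"
    have "{p. (c, p) \<in> {x \<in> slide_domain a. polar_point K (fst x, slide a (fst x) (snd x) 1) = y}} =
        polar_set K c \<inter> ?T"
      using c by (auto simp: slide_domain_def slide_def topspace_polar_charts)
    moreover have "open ?T"
      by (intro open_UN ballI open_Times open_stop_fibre) simp
    ultimately show "openin (top_of_set (polar_set K c))
        {p. (c, p) \<in> {x \<in> slide_domain a. polar_point K (fst x, slide a (fst x) (snd x) 1) = y}}"
      by (simp only: openin_open_Int)
  qed
qed

definition disc_domain :: "(('v, 'e, 'f) cell \<times> real \<times> real) set" where
  "disc_domain = {x \<in> topspace (polar_charts K). (\<exists>f. fst x = Face f) \<and> fst (snd x) < 1}"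

lemma polar_face_scale: "polar K (Face f) (r * s, t) = of_real r * polar K (Face f) (s, t)"
  by simp

text \<open>Gluing takes place on the boundary circle only; inside the disc, points are identified only when
  their polar coordinates describe the same complex number.\<close>

lemma disc_respects_gluing:
  assumes x: "x \<in> disc_domain" and y: "y \<in> topspace (polar_charts K)"
    and xy: "polar_point K x = polar_point K y"
  shows "fst y = fst x \<and> polar K (fst y) (snd y) = polar K (fst x) (snd x) \<and> y \<in> disc_domain"
proof -
  define pos where "pos x = (fst x, polar K (fst x) (snd x))" for x
  define D where "D z \<longleftrightarrow> (\<exists>f. fst z = Face f \<and> cmod (snd z) < 1)"
    for z :: "('v, 'e, 'f) cell \<times> complex"
  define R where "R x y \<longleftrightarrow> D (pos x) \<or> D (pos y) \<longrightarrow> pos x = pos y" for x y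
  have norm: "cmod (polar K (Face f) p) = fst p" if "p \<in> polar_set K (Face f)" for f p
    using that by (auto simp: norm_mult)
  have "R x y"
  proof (rule polar_point_invariant[OF xy _ y])
    show "x \<in> topspace (polar_charts K)" using x by (simp add: disc_domain_def)
    show "R b a" if "R a b" for a b using that unfolding R_def by metis
    show "R a c" if "R a b" "R b c" for a b c using that unfolding R_def by metis
  qed (simp_all add: R_def pos_def D_def norm_mult)
  moreover have "D (pos x)"
    using x norm unfolding D_def pos_def by (auto simp: disc_domain_def topspace_polar_charts)
  ultimately have "pos x = pos y" by (simp add: R_def)
  then have "pos y = pos x" by (rule sym)
  then have eq: "fst y = fst x \<and> polar K (fst y) (snd y) = polar K (fst x) (snd x)"
    unfolding pos_def prod.inject .
  obtain f where f: "fst x = Face f" using x by (auto simp: disc_domain_def)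
  have "snd x \<in> polar_set K (Face f)" "snd y \<in> polar_set K (Face f)"
    using x y eq f by (auto simp: disc_domain_def topspace_polar_charts mem_Sigma_iff split_beta)
  then have n: "cmod (polar K (Face f) (snd x)) = fst (snd x)" "cmod (polar K (Face f) (snd y)) = fst (snd y)"
    by (auto intro: norm simp del: polar.simps polar_set.simps)
  have fy: "fst y = Face f" using eq f by simp
  have "polar K (Face f) (snd y) = polar K (Face f) (snd x)"
    using conjunct2[OF eq] unfolding fy f .
  then have "fst (snd y) = fst (snd x)" unfolding n[symmetric] by simp
  then have "y \<in> disc_domain" using x y fy by (simp add: disc_domain_def)
  then show ?thesis by (intro conjI conjunct1[OF eq] conjunct2[OF eq])
qed

text \<open>An open disc contracts radially to its centre.\<close>

lemma trivialised_near_disc_domain: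
  assumes x: "x \<in> disc_domain"
  shows "\<exists>U. openin (realisation K) U \<and> polar_point K x \<in> U \<and>
    (\<forall>g. pathin (realisation K) g \<longrightarrow> g ` {0..1} \<subseteq> U \<longrightarrow> trivialised g)"
proof (rule trivialised_near_motion[where k = "\<lambda>c p s. ((1 - s) * fst p, snd p)" and D = disc_domain])
  show D: "disc_domain \<subseteq> topspace (polar_charts K)" by (auto simp: disc_domain_def)
  show "x \<in> disc_domain" by (rule x)
  show "(fst x, (1 - 0) * fst (snd x), snd (snd x)) = x" for x :: "('v, 'e, 'f) cell \<times> real \<times> real"
    by simp
  show "y \<in> disc_domain \<and> (\<forall>s\<in>{0..1}. polar_point K (fst x, (1 - s) * fst (snd x), snd (snd x)) =
      polar_point K (fst y, (1 - s) * fst (snd y), snd (snd y)))"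
    if xy: "x \<in> disc_domain" "y \<in> topspace (polar_charts K)" "polar_point K x = polar_point K y" for x y
  proof -
    obtain f where f: "fst x = Face f" using xy(1) by (auto simp: disc_domain_def)
    note r = disc_respects_gluing[OF xy]
    have fy: "fst y = Face f" using r f by simp
    have e: "polar K (Face f) (snd y) = polar K (Face f) (snd x)"
      using conjunct1[OF conjunct2[OF r]] unfolding fy f .
    have "polar K (Face f) ((1 - s) * fst (snd x), snd (snd x)) =
        polar K (Face f) ((1 - s) * fst (snd y), snd (snd y))" for s
      unfolding polar_face_scale prod.collapse e ..
    then show ?thesis
      using conjunct2[OF conjunct2[OF r]] by (simp add: polar_point_def f fy del: polar.simps)
  qed
  let ?Z = "prod_topology (subtopology (polar_charts K) disc_domain) (top_of_set {0..1::real})"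
  note co = continuous_map_chart_coordinates[OF D]
  show "continuous_map ?Z (polar_charts K)
      (\<lambda>z. (fst (fst z), (1 - snd z) * fst (snd (fst z)), snd (snd (fst z))))"
  proof (rule continuous_map_into_polar_charts)
    show "((1 - snd z) * fst (snd (fst z)), snd (snd (fst z))) \<in> polar_set K (fst (fst z))"
      if "z \<in> topspace ?Z" for z
      using that by (auto simp: disc_domain_def topspace_polar_charts mult_le_one)
  qed (intro continuous_map_real_mult continuous_map_diff co; simp)+
  show "openin (polar_charts K) {x \<in> disc_domain. polar_point K (fst x, (1 - 1) * fst (snd x), snd (snd x)) = y}" for y
    unfolding openin_polar_charts
  proof (intro conjI ballI)
    show "{x \<in> disc_domain. polar_point K (fst x, (1 - 1) * fst (snd x), snd (snd x)) = y}
        \<subseteq> Sigma (cells K) (polar_set K)"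
      using D by (auto simp: topspace_polar_charts)
    fix c assume c: "c \<in> cells K"
    let ?T = "if (\<exists>f. c = Face f) \<and> glue_class K (c, 0) = y then {..<1::real} \<times> (UNIV::real set) else {}"
    have "{p. (c, p) \<in> {x \<in> disc_domain. polar_point K (fst x, (1 - 1) * fst (snd x), snd (snd x)) = y}} =
        polar_set K c \<inter> ?T"
      using c by (auto simp: disc_domain_def topspace_polar_charts polar_point_def)
    moreover have "open ?T"
      by (auto intro: open_Times)
    ultimately show "openin (top_of_set (polar_set K c))
        {p. (c, p) \<in> {x \<in> disc_domain. polar_point K (fst x, (1 - 1) * fst (snd x), snd (snd x)) = y}}"
      by (simp only: openin_open_Int)
  qed
qed

text \<open>A point with positive radius has an angle that fails to be an integer or fails to be a half-integer,
  so it is contained in one of the two slide domains. Only the centres of discs remain.\<close>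

theorem simply_connected_realisation_if_trivialising:
  "simply_connected_space (realisation K)"
proof (rule simply_connected_if_locally_trivialised)
  fix y assume "y \<in> topspace (realisation K)"
  then obtain x where x: "x \<in> topspace (polar_charts K)" "y = polar_point K x"
    using quotient_imp_surjective_map[OF quotient_map_polar_point] by blast
  obtain c r t where c: "x = (c, r, t)" by (cases x)
  have rt: "c \<in> cells K" "(r, t) \<in> polar_set K c"
    using x(1) by (simp_all add: c topspace_polar_charts)
  have "x \<in> slide_domain (1/2) \<or> x \<in> slide_domain 0 \<or> x \<in> disc_domain"
  proof (cases "r = 0")
    case True
    with rt(2) have "\<exists>f. c = Face f" by (cases c) simp_all
    then show ?thesis using x(1) True by (simp add: disc_domain_def c)
  next
    case False
    with rt(2) have pos: "0 < fst (snd x)" unfolding c by (cases c) simp_all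
    have "snd (snd x) + 1/2 \<notin> \<int> \<or> snd (snd x) + 0 \<notin> \<int>"
    proof (rule ccontr)
      assume "\<not> ?thesis"
      then obtain m n :: int where "snd (snd x) = of_int m" "snd (snd x) + 1/2 = of_int n"
        by (auto elim!: Ints_cases)
      then have "of_int (2 * n - 2 * m) = (1::real)" by simp
      then have "2 * n - 2 * m = 1" by (simp only: of_int_eq_1_iff)
      then show False by presburger
    qed
    then show ?thesis using x(1) pos unfolding slide_domain_def mem_Collect_eq by blast
  qed
  then show "\<exists>U. openin (realisation K) U \<and> y \<in> U \<and>
      (\<forall>g. pathin (realisation K) g \<longrightarrow> g ` {0..1} \<subseteq> U \<longrightarrow> trivialised g)"
    unfolding x(2)
    by (elim disjE) (rule trivialised_near_slide_domain trivialised_near_disc_domain; simp)+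
qed

end


section \<open>Edge walks and their homotopies\<close>

fun edge_walk :: "('v, 'e, 'f) two_complex \<Rightarrow> 'v \<Rightarrow> 'e list \<Rightarrow> 'v \<Rightarrow> bool" where
  "edge_walk K v [] w \<longleftrightarrow> v = w \<and> v \<in> verts K"
| "edge_walk K v (e # es) w \<longleftrightarrow>
     e \<in> edges K \<and> origin K e = v \<and> edge_walk K (origin K (reversal K e)) es w"

text \<open>The combinatorial homotopy relation on edge walks that start at a given vertex, generated by removing
  backtracks and boundaries of faces.\<close>

inductive edge_homotopic :: "('v, 'e, 'f) two_complex \<Rightarrow> 'v \<Rightarrow> 'e list \<Rightarrow> 'e list \<Rightarrow> bool"
  for K :: "('v, 'e, 'f) two_complex" where
  eh_refl: "edge_walk K v p w \<Longrightarrow> edge_homotopic K v p p"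
| eh_sym: "edge_homotopic K v p q \<Longrightarrow> edge_homotopic K v q p"
| eh_trans: "edge_homotopic K v p q \<Longrightarrow> edge_homotopic K v q r \<Longrightarrow> edge_homotopic K v p r"
| eh_append: "edge_homotopic K v p p' \<Longrightarrow> edge_walk K v p w \<Longrightarrow> edge_homotopic K w q q' \<Longrightarrow>
    edge_homotopic K v (p @ q) (p' @ q')"
| eh_backtrack: "e \<in> edges K \<Longrightarrow> edge_homotopic K (origin K e) [e, reversal K e] []"
| eh_face: "f \<in> faces K \<Longrightarrow> edge_homotopic K (origin K (hd (boundary K f))) (boundary K f) []"

lemma edge_walk_append:
  "edge_walk K v p w \<Longrightarrow> edge_walk K w q u \<Longrightarrow> edge_walk K v (p @ q) u"
  by (induction p arbitrary: v) auto

lemma edge_walk_unique: "edge_walk K v p w \<Longrightarrow> edge_walk K v p w' \<Longrightarrow> w = w'"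
  by (induction p arbitrary: v) auto

definition edge_path :: "('v, 'e, 'f) two_complex \<Rightarrow> 'e \<Rightarrow> real \<Rightarrow>
    (('v, 'e, 'f) cell \<times> complex) set" where
  "edge_path K e = (\<lambda>t. glue_class K (Edge e, of_real t))"

fun walk_path :: "('v, 'e, 'f) two_complex \<Rightarrow> 'v \<Rightarrow> 'e list \<Rightarrow> real \<Rightarrow>
    (('v, 'e, 'f) cell \<times> complex) set" where
  "walk_path K v [] = (\<lambda>_. glue_class K (Vert v, 0))"
| "walk_path K v (e # es) = join_path (edge_path K e) (walk_path K (origin K (reversal K e)) es)"

lemma pathin_cell_model_iff:
  "pathin (cell_model c) g \<longleftrightarrow> continuous_on {0..1} g \<and> g ` {0..1} \<subseteq> cell_set c"
  by (auto simp: pathin_def cell_model_eq continuous_map_in_subtopology image_subset_iff_funcset)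

lemma convex_cell_set: "convex (cell_set c)"
proof (cases c)
  case (Edge e)
  have "convex (of_real ` {0..1::real} :: complex set)"
    by (intro convex_linear_image) (auto simp: linear_iff scaleR_conv_of_real)
  then show ?thesis using Edge by simp
qed auto

context two_dim_complex
begin

abbreviation "X \<equiv> realisation K"

lemma pathin_cell:
  assumes "c \<in> cells K" "pathin (cell_model c) g"
  shows "pathin X (\<lambda>t. glue_class K (c, g t))"
  using continuous_map_compose[OF assms(2)[unfolded pathin_def] continuous_map_glue_class[OF assms(1)]]
  by (simp add: pathin_def o_def)

text \<open>Every cell is modelled on a convex set.\<close>

lemma path_homotopic_cell:
  assumes c: "c \<in> cells K" and g: "pathin (cell_model c) g" and h: "pathin (cell_model c) h"
    and ends: "h 0 = g 0" "h 1 = g 1"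
  shows "path_homotopic X (\<lambda>t. glue_class K (c, g t)) (\<lambda>t. glue_class K (c, h t))"
  using path_homotopic_convex_image[OF continuous_map_glue_class[OF c, unfolded cell_model_eq]
      convex_cell_set, of g h] g h ends
  by (simp add: pathin_cell_model_iff o_def)

lemma glue_class_edge_ends:
  assumes "e \<in> edges K"
  shows "glue_class K (Edge e, 0) = glue_class K (Vert (origin K e), 0)"
    "glue_class K (Edge e, 1) = glue_class K (Vert (origin K (reversal K e)), 0)"
  using polar_point_eqI(1)[OF assms] polar_point_eqI(1)[OF reversal_in_edges[OF assms]]
    polar_point_eqI(2)[OF assms, of 1]
  by (simp_all add: polar_point_def)

lemma edge_path_ends:
  assumes "e \<in> edges K"
  shows "edge_path K e 0 = glue_class K (Vert (origin K e), 0)"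
    "edge_path K e 1 = glue_class K (Vert (origin K (reversal K e)), 0)"
  using glue_class_edge_ends[OF assms] by (simp_all add: edge_path_def)

lemma pathin_edge_path: "e \<in> edges K \<Longrightarrow> pathin X (edge_path K e)"
  unfolding edge_path_def
  by (rule pathin_cell, simp, unfold pathin_cell_model_iff) (auto intro!: continuous_intros)

lemma edge_path_reversal:
  "e \<in> edges K \<Longrightarrow> t \<in> {0..1} \<Longrightarrow> edge_path K (reversal K e) t = edge_path K e (1 - t)"
  using polar_point_eqI(2)[of e "1 - t"] by (simp add: edge_path_def polar_point_def)

lemma pathin_const_vert: "v \<in> verts K \<Longrightarrow> pathin X (\<lambda>_. glue_class K (Vert v, 0))"
  by (rule pathin_cell[of "Vert v" "\<lambda>_. 0"], simp, unfold pathin_cell_model_iff) auto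

lemma walk_path:
  assumes "edge_walk K v p w"
  shows "pathin X (walk_path K v p) \<and> walk_path K v p 0 = glue_class K (Vert v, 0) \<and>
    walk_path K v p 1 = glue_class K (Vert w, 0)"
  using assms
proof (induction p arbitrary: v)
  case Nil
  then show ?case using pathin_const_vert[of v] by auto
next
  case (Cons e p)
  then show ?case
    using edge_path_ends[of e] pathin_edge_path[of e] by (auto intro!: pathin_join)
qed

lemma walk_path_append:
  assumes "edge_walk K v p w" "edge_walk K w q u"
  shows "path_homotopic X (walk_path K v (p @ q)) (join_path (walk_path K v p) (walk_path K w q))"
  using assms(1)
proof (induction p arbitrary: v)
  case Nil
  then show ?case
    using walk_path[OF assms(2)] by (auto intro!: path_homotopic_sym[OF path_homotopic_const_join])
next
  case (Cons e p)
  let ?v = "origin K (reversal K e)"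
  have e: "e \<in> edges K" and p: "edge_walk K ?v p w" using Cons.prems by auto
  note wp = walk_path[OF p] and wq = walk_path[OF assms(2)]
    and ep = edge_path_ends[OF e] pathin_edge_path[OF e]
  have "path_homotopic X (walk_path K v ((e # p) @ q))
      (join_path (edge_path K e) (join_path (walk_path K ?v p) (walk_path K w q)))"
    using walk_path[OF edge_walk_append[OF p assms(2)]] ep
    by (auto intro!: path_homotopic_join path_homotopic_refl Cons.IH[OF p])
  also have "path_homotopic X \<dots> (join_path (join_path (edge_path K e) (walk_path K ?v p)) (walk_path K w q))"
    using wp wq ep by (intro path_homotopic_sym[OF path_homotopic_assoc]) auto
  finally show ?case by simp
qed

lemma boundary_walk_take:
  assumes f: "f \<in> faces K" and m: "m < length (boundary K f)"
  shows "edge_walk K (origin K (hd (boundary K f))) (take m (boundary K f)) (origin K (boundary K f ! m))"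
  using m
proof (induction m)
  case 0
  then have "boundary K f ! 0 \<in> edges K" using boundary_edges[OF f] by (meson nth_mem subsetD)
  then show ?case using boundary_nonempty[OF f] origin_in_verts by (simp add: hd_conv_nth)
next
  case (Suc m)
  have e: "boundary K f ! m \<in> edges K" "boundary K f ! Suc m \<in> edges K"
    using boundary_edges[OF f] Suc.prems by (meson Suc_lessD nth_mem subsetD)+
  have w: "edge_walk K (origin K (boundary K f ! m)) [boundary K f ! m] (origin K (boundary K f ! Suc m))"
    using e boundary_consecutive[OF f Suc.prems] origin_in_verts[OF e(2)] by simp
  have "edge_walk K (origin K (hd (boundary K f))) (take m (boundary K f)) (origin K (boundary K f ! m))"
    using Suc by simp
  from edge_walk_append[OF this w] show ?case
    using Suc.prems by (simp add: take_Suc_conv_app_nth)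
qed

lemma boundary_walk:
  assumes f: "f \<in> faces K"
  shows "edge_walk K (origin K (hd (boundary K f))) (boundary K f) (origin K (hd (boundary K f)))"
proof -
  let ?b = "boundary K f"
  let ?m = "length ?b - 1"
  have m: "?m < length ?b" using boundary_nonempty[OF f] by simp
  have e: "?b ! ?m \<in> edges K" "hd ?b \<in> edges K"
    using boundary_edges[OF f] m boundary_nonempty[OF f] by (meson nth_mem subsetD hd_in_set)+
  have l: "last ?b = ?b ! ?m" using boundary_nonempty[OF f] by (rule last_conv_nth)
  have "edge_walk K (origin K (?b ! ?m)) [?b ! ?m] (origin K (hd ?b))"
    using e boundary_closed[OF f] origin_in_verts[OF e(2)] unfolding l by simp
  from edge_walk_append[OF boundary_walk_take[OF f m] this]
  show ?thesis using m boundary_nonempty[OF f]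
    by (simp add: take_Suc_conv_app_nth[symmetric])
qed

text \<open>Inside the disc of a face the boundary is homotopic to a constant path.\<close>

lemma walk_path_boundary:
  assumes f: "f \<in> faces K"
  defines "v \<equiv> origin K (hd (boundary K f))"
  shows "path_homotopic X (walk_path K v (boundary K f)) (walk_path K v [])"
proof -
  let ?b = "boundary K f" and ?L = "length (boundary K f)"
  have L: "?L > 0" using boundary_nonempty[OF f] by simp
  have arc: "pathin (cell_model (Face f)) (\<lambda>s. cis (2 * pi * (x * s + y) / real ?L))" for x y :: real
    unfolding pathin_cell_model_iff using L by (auto intro!: continuous_intros)
  have edge: "edge_path K (?b ! m) t = glue_class K (Face f, cis (2 * pi * (1 * t + real m) / real ?L))"
    if "m < ?L" "t \<in> {0..1}" for m t
    using glue_class_eqI[OF glue_face[OF f that]] by (simp add: edge_path_def add.commute)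
  (* The first m edges of the boundary are homotopic to the arc of the circle that they cover. *)
  have "path_homotopic X (walk_path K v (take m ?b)) (\<lambda>s. glue_class K (Face f, cis (2 * pi * (real m * s + 0) / real ?L)))"
    if "m \<le> ?L" for m
    using that
  proof (induction m)
    case 0
    have "glue_class K (Vert v, 0) = glue_class K (Face f, 1)"
      using edge[of 0 0] L edge_path_ends(1)[of "hd ?b"] boundary_edges[OF f] boundary_nonempty[OF f]
      by (simp add: v_def hd_conv_nth subset_iff)
    moreover have "v \<in> verts K"
      using origin_in_verts boundary_edges[OF f] boundary_nonempty[OF f]
      by (auto simp: v_def subset_iff)
    ultimately show ?case using pathin_const_vert[of v] by (simp add: path_homotopic_refl)
  next
    case (Suc m)
    then have m: "m < ?L" by simp
    let ?e = "?b ! m"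
    have e: "?e \<in> edges K" using boundary_edges[OF f] m by (meson nth_mem subsetD)
    note w1 = boundary_walk_take[OF f m, folded v_def]
    have w2: "edge_walk K (origin K ?e) [?e] (origin K (reversal K ?e))"
      using e origin_in_verts reversal_in_edges by auto
    have "take (Suc m) ?b = take m ?b @ [?e]" using m by (simp add: take_Suc_conv_app_nth)
    then have "path_homotopic X (walk_path K v (take (Suc m) ?b))
        (join_path (walk_path K v (take m ?b)) (walk_path K (origin K ?e) [?e]))"
      using walk_path_append[OF w1 w2] by simp
    also have "path_homotopic X \<dots> (join_path
        (\<lambda>s. glue_class K (Face f, cis (2 * pi * (real m * s + 0) / real ?L)))
        (\<lambda>s. glue_class K (Face f, cis (2 * pi * (1 * s + real m) / real ?L))))"
    proof (rule path_homotopic_join)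
      show "path_homotopic X (walk_path K v (take m ?b))
          (\<lambda>s. glue_class K (Face f, cis (2 * pi * (real m * s + 0) / real ?L)))"
        using Suc by simp
      have "path_homotopic X (walk_path K (origin K ?e) [?e]) (edge_path K ?e)"
        using edge_path_ends[OF e] pathin_edge_path[OF e] by (simp add: path_homotopic_join_const)
      also have "path_homotopic X \<dots> (\<lambda>s. glue_class K (Face f, cis (2 * pi * (1 * s + real m) / real ?L)))"
        using edge[OF m] by (intro path_homotopic_eq pathin_edge_path e) auto
      finally show "path_homotopic X (walk_path K (origin K ?e) [?e])
          (\<lambda>s. glue_class K (Face f, cis (2 * pi * (1 * s + real m) / real ?L)))" .
      show "walk_path K v (take m ?b) 1 = walk_path K (origin K ?e) [?e] 0"
        using walk_path[OF w1] walk_path[OF w2] by simp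
    qed
    also have "path_homotopic X \<dots>
        (\<lambda>s. glue_class K (Face f, cis (2 * pi * (real (Suc m) * s + 0) / real ?L)))"
    proof -
      let ?j = "join_path (\<lambda>s. cis (2 * pi * (real m * s + 0) / real ?L))
        (\<lambda>s. cis (2 * pi * (1 * s + real m) / real ?L))"
      have "path_homotopic X (\<lambda>t. glue_class K (Face f, ?j t))
          (\<lambda>s. glue_class K (Face f, cis (2 * pi * (real (Suc m) * s + 0) / real ?L)))"
        using f arc[of "real m" 0] arc[of 1 "real m"] arc[of "real (Suc m)" 0]
        by (intro path_homotopic_cell pathin_join) (simp_all add: add.commute)
      moreover have "(\<lambda>t. glue_class K (Face f, ?j t)) = join_path
          (\<lambda>s. glue_class K (Face f, cis (2 * pi * (real m * s + 0) / real ?L)))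
          (\<lambda>s. glue_class K (Face f, cis (2 * pi * (1 * s + real m) / real ?L)))"
        by (auto simp: join_path_def fun_eq_iff)
      ultimately show ?thesis by simp
    qed
    finally show ?case .
  qed
  from this[of ?L] have 1: "path_homotopic X (walk_path K v ?b)
      (\<lambda>s. glue_class K (Face f, cis (2 * pi * (real ?L * s + 0) / real ?L)))" by simp
  have "path_homotopic X (\<lambda>s. glue_class K (Face f, cis (2 * pi * (real ?L * s + 0) / real ?L)))
      (\<lambda>s. glue_class K (Face f, cis (2 * pi * (0 * s + 0) / real ?L)))"
    using f arc[of "real ?L" 0] arc[of 0 0] L by (intro path_homotopic_cell) (simp_all add: cis_2pi)
  moreover have "glue_class K (Vert v, 0) = glue_class K (Face f, 1)"
    using edge[of 0 0] L edge_path_ends(1)[of "hd ?b"] boundary_edges[OF f] boundary_nonempty[OF f]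
    by (simp add: v_def hd_conv_nth subset_iff)
  ultimately show ?thesis using path_homotopic_trans[OF 1] by simp
qed

theorem path_homotopic_if_edge_homotopic:
  assumes "edge_homotopic K v p q"
  shows "\<exists>w. edge_walk K v p w \<and> edge_walk K v q w \<and>
    path_homotopic X (walk_path K v p) (walk_path K v q)"
  using assms
proof induction
  case (eh_refl v p w)
  then show ?case using walk_path by (auto intro!: exI[of _ w] path_homotopic_refl)
next
  case (eh_sym v p q)
  then show ?case using path_homotopic_sym by blast
next
  case (eh_trans v p q r)
  then show ?case using edge_walk_unique path_homotopic_trans by metis
next
  case (eh_append v p p' w q q')
  obtain u where u: "edge_walk K w q u" "edge_walk K w q' u"
    "path_homotopic X (walk_path K w q) (walk_path K w q')" using eh_append.IH(2) by blast
  have p: "edge_walk K v p w" "edge_walk K v p' w" "path_homotopic X (walk_path K v p) (walk_path K v p')"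
    using eh_append.IH(1) eh_append.hyps edge_walk_unique by metis+
  have "path_homotopic X (walk_path K v (p @ q)) (join_path (walk_path K v p) (walk_path K w q))"
    by (rule walk_path_append[OF p(1) u(1)])
  also have "path_homotopic X \<dots> (join_path (walk_path K v p') (walk_path K w q'))"
    using p u walk_path[OF p(1)] walk_path[OF u(1)] by (intro path_homotopic_join) auto
  also have "path_homotopic X \<dots> (walk_path K v (p' @ q'))"
    by (rule path_homotopic_sym[OF walk_path_append[OF p(2) u(2)]])
  finally show ?case using edge_walk_append[OF p(1) u(1)] edge_walk_append[OF p(2) u(2)] by blast
next
  case (eh_backtrack e)
  let ?r = "reversal K e"
  have r: "?r \<in> edges K" "reversal K ?r = e" using eh_backtrack reversal_in_edges reversal_reversal by auto
  have "path_homotopic X (walk_path K (origin K e) [e, ?r]) (join_path (edge_path K e) (edge_path K ?r))"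
    using edge_path_ends[OF eh_backtrack] edge_path_ends[OF r(1)] pathin_edge_path[OF eh_backtrack]
      pathin_edge_path[OF r(1)] r
    by (auto intro!: path_homotopic_join path_homotopic_refl path_homotopic_join_const)
  also have "path_homotopic X \<dots> (join_path (edge_path K e) (reverse_path (edge_path K e)))"
    using edge_path_ends[OF eh_backtrack] edge_path_ends[OF r(1)] pathin_edge_path[OF eh_backtrack]
      pathin_edge_path[OF r(1)] edge_path_reversal[OF eh_backtrack]
    by (intro path_homotopic_join path_homotopic_refl path_homotopic_eq) (auto simp: reverse_path_def)
  also have "path_homotopic X \<dots> (\<lambda>_. edge_path K e 0)"
    by (rule path_homotopic_join_reverse[OF pathin_edge_path[OF eh_backtrack]])
  finally have "path_homotopic X (walk_path K (origin K e) [e, ?r]) (walk_path K (origin K e) [])"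
    using edge_path_ends[OF eh_backtrack] by simp
  then show ?case using eh_backtrack r origin_in_verts by auto
next
  case (eh_face f)
  let ?v = "origin K (hd (boundary K f))"
  have "hd (boundary K f) \<in> edges K"
    using boundary_edges[OF eh_face] boundary_nonempty[OF eh_face] by (meson hd_in_set subsetD)
  then have "edge_walk K ?v [] ?v" using origin_in_verts by simp
  then show ?case using boundary_walk[OF eh_face] walk_path_boundary[OF eh_face] by blast
qed

text \<open>The path chosen to a point of a cell runs along a walk to the vertex at the base point of the
  cell and then straight across the cell.\<close>

fun cell_base :: "('v, 'e, 'f) cell \<Rightarrow> complex" where
  "cell_base (Vert v) = 0"
| "cell_base (Edge e) = 0"
| "cell_base (Face f) = 1"

fun cell_base_vertex :: "('v, 'e, 'f) cell \<Rightarrow> 'v" where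
  "cell_base_vertex (Vert v) = v"
| "cell_base_vertex (Edge e) = origin K e"
| "cell_base_vertex (Face f) = origin K (hd (boundary K f))"

definition cell_line :: "('v, 'e, 'f) cell \<Rightarrow> complex \<Rightarrow> real \<Rightarrow> complex" where
  "cell_line c z t = (1 - of_real t) * cell_base c + of_real t * z"

lemma cell_line:
  assumes "z \<in> cell_set c"
  shows "pathin (cell_model c) (cell_line c z)" "cell_line c z 0 = cell_base c" "cell_line c z 1 = z"
proof -
  have "cell_base c \<in> cell_set c" by (cases c) auto
  then have "(1 - t) *\<^sub>R cell_base c + t *\<^sub>R z \<in> cell_set c" if "0 \<le> t" "t \<le> 1" for t
    using convex_cell_set[of c] assms that by (intro convexD_alt) auto
  then have "cell_line c z ` {0..1} \<subseteq> cell_set c"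
    by (auto simp: cell_line_def scaleR_conv_of_real)
  moreover have "continuous_on {0..1} (cell_line c z)"
    unfolding cell_line_def by (intro continuous_intros)
  ultimately show "pathin (cell_model c) (cell_line c z)" unfolding pathin_cell_model_iff by blast
qed (simp_all add: cell_line_def)

lemma cell_base_vertex:
  assumes "c \<in> cells K"
  shows "cell_base_vertex c \<in> verts K"
    "glue_class K (c, cell_base c) = glue_class K (Vert (cell_base_vertex c), 0)"
proof -
  have "cell_base_vertex c \<in> verts K \<and>
    glue_class K (c, cell_base c) = glue_class K (Vert (cell_base_vertex c), 0)"
  proof (cases c)
    case (Face f)
    have f: "f \<in> faces K" using assms Face by simp
    have e: "hd (boundary K f) \<in> edges K" "hd (boundary K f) = boundary K f ! 0"
      using boundary_edges[OF f] boundary_nonempty[OF f] by (auto simp: hd_conv_nth)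
    have "glue_class K (Face f, 1) = glue_class K (Edge (boundary K f ! 0), 0)"
      using glue_class_eqI[OF glue_face[OF f, of 0 0]] boundary_nonempty[OF f] by simp
    then show ?thesis using Face e glue_class_edge_ends(1)[OF e(1)] origin_in_verts by simp
  qed (use assms glue_class_edge_ends(1) origin_in_verts in auto)
  then show "cell_base_vertex c \<in> verts K"
    "glue_class K (c, cell_base c) = glue_class K (Vert (cell_base_vertex c), 0)" by auto
qed

text \<open>The walks \<open>W v\<close> play the role of a maximal tree: the second hypothesis says that, relative to
  them, every edge represents the trivial element of the fundamental group. The chosen path to a point
  of the realisation depends on the cell in which the point is taken. Gluing replaces it by a homotopic
  one, so a choice of cells turns it into a system of paths that trivialises all paths in cells.\<close>

theorem simply_connected_realisation:
  assumes walk: "\<And>v. v \<in> verts K \<Longrightarrow> edge_walk K v0 (W v) v"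
    and consistent: "\<And>e. e \<in> edges K \<Longrightarrow>
      edge_homotopic K v0 (W (origin K e) @ [e]) (W (origin K (reversal K e)))"
  shows "simply_connected_space X"
proof -
  define V where "V v = walk_path K v0 (W v)" for v
  have V: "pathin X (V v)" "V v 0 = glue_class K (Vert v0, 0)" "V v 1 = glue_class K (Vert v, 0)"
    if "v \<in> verts K" for v
    using walk_path[OF walk[OF that]] by (simp_all add: V_def)
  have V_edge: "path_homotopic X (join_path (V (origin K e)) (edge_path K e)) (V (origin K (reversal K e)))"
    if e: "e \<in> edges K" for e
  proof -
    have w: "edge_walk K (origin K e) [e] (origin K (reversal K e))"
      using e origin_in_verts reversal_in_edges by simp
    have "path_homotopic X (join_path (V (origin K e)) (edge_path K e))
        (join_path (V (origin K e)) (walk_path K (origin K e) [e]))"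
    proof (rule path_homotopic_join)
      show "path_homotopic X (edge_path K e) (walk_path K (origin K e) [e])"
        using edge_path_ends[OF e] pathin_edge_path[OF e]
        by (simp add: path_homotopic_sym[OF path_homotopic_join_const])
    qed (use V origin_in_verts[OF e] edge_path_ends[OF e] in \<open>auto intro: path_homotopic_refl\<close>)
    also have "path_homotopic X \<dots> (walk_path K v0 (W (origin K e) @ [e]))"
      unfolding V_def
      by (rule path_homotopic_sym[OF walk_path_append[OF walk[OF origin_in_verts[OF e]] w]])
    also have "path_homotopic X \<dots> (V (origin K (reversal K e)))"
      using path_homotopic_if_edge_homotopic[OF consistent[OF e]] unfolding V_def by blast
    finally show ?thesis .
  qed
  (* The path through the chosen walk and then straight across the cell. *)
  define Q where "Q x = join_path (V (cell_base_vertex (fst x)))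
    (\<lambda>t. glue_class K (fst x, cell_line (fst x) (snd x) t))" for x
  let ?S = "SIGMA c:cells K. cell_set c"
  have line: "pathin X (\<lambda>t. glue_class K (c, cell_line c z t))"
    if "c \<in> cells K" "z \<in> cell_set c" for c z
    using that by (intro pathin_cell cell_line)
  have Q: "pathin X (Q (c, z))" "Q (c, z) 0 = glue_class K (Vert v0, 0)" "Q (c, z) 1 = glue_class K (c, z)"
    if cz: "c \<in> cells K" "z \<in> cell_set c" for c z
    using V[OF cell_base_vertex(1)[OF cz(1)]] line[OF cz] cell_line[OF cz(2)] cell_base_vertex(2)[OF cz(1)]
    by (simp_all add: Q_def pathin_join)
  (* By convexity of the cell, the system Q is compatible with paths in the cell. This is used three
     times: to compare Q along an edge and its reversal, along the arcs of a face, and at the end. *)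
  have transport: "path_homotopic X (join_path (Q (c, g 0)) (\<lambda>t. glue_class K (c, g t))) (Q (c, g 1))"
    if c: "c \<in> cells K" and g: "pathin (cell_model c) g" for c g
  proof -
    have gc: "g 0 \<in> cell_set c" "g 1 \<in> cell_set c"
      using g unfolding pathin_cell_model_iff by auto
    let ?v = "V (cell_base_vertex c)" and ?l = "\<lambda>z t. glue_class K (c, cell_line c z t)"
      and ?g = "\<lambda>t. glue_class K (c, g t)"
    note ends = V[OF cell_base_vertex(1)[OF c]] line[OF c gc(1)] line[OF c gc(2)]
      cell_line(2,3)[OF gc(1)] cell_line(2,3)[OF gc(2)] cell_base_vertex(2)[OF c] pathin_cell[OF c g]
    have "path_homotopic X (join_path (join_path ?v (?l (g 0))) ?g) (join_path ?v (join_path (?l (g 0)) ?g))"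
      using ends by (intro path_homotopic_assoc) simp_all
    also have "path_homotopic X \<dots> (join_path ?v (?l (g 1)))"
    proof (rule path_homotopic_join)
      have "path_homotopic X (\<lambda>t. glue_class K (c, join_path (cell_line c (g 0)) g t)) (?l (g 1))"
        using g cell_line[OF gc(1)] cell_line[OF gc(2)]
        by (intro path_homotopic_cell[OF c] pathin_join) simp_all
      moreover have "(\<lambda>t. glue_class K (c, join_path (cell_line c (g 0)) g t)) = join_path (?l (g 0)) ?g"
        by (auto simp: join_path_def fun_eq_iff)
      ultimately show "path_homotopic X (join_path (?l (g 0)) ?g) (?l (g 1))" by simp
      show "path_homotopic X ?v ?v" using ends by (simp add: path_homotopic_refl)
      show "?v 1 = join_path (?l (g 0)) ?g 0" using ends by simp
    qed
    finally show ?thesis by (simp add: Q_def)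
  qed
  have Q_vert: "path_homotopic X (Q (c, cell_base c)) (V (cell_base_vertex c))" if c: "c \<in> cells K" for c
  proof -
    have "cell_line c (cell_base c) = (\<lambda>_. cell_base c)"
      by (auto simp: cell_line_def algebra_simps)
    then have "Q (c, cell_base c) = join_path (V (cell_base_vertex c)) (\<lambda>_. glue_class K (Vert (cell_base_vertex c), 0))"
      by (simp add: Q_def cell_base_vertex(2)[OF c])
    then show ?thesis
      using V[OF cell_base_vertex(1)[OF c]] by (simp add: path_homotopic_join_const)
  qed
  have Q_edge: "path_homotopic X (Q (Edge e, of_real t)) (join_path (V (origin K e)) (\<lambda>s. edge_path K e (s * t)))"
    if "e \<in> edges K" "t \<in> {0..1}" for e t
    using Q(1)[of "Edge e" "of_real t"] that
    by (auto simp: Q_def edge_path_def cell_line_def intro: path_homotopic_refl)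
  have Q_edge_end: "path_homotopic X (Q (Edge e, 1)) (V (origin K (reversal K e)))" if e: "e \<in> edges K" for e
    using path_homotopic_trans[OF Q_edge[OF e, of 1] ] V_edge[OF e] by simp
  have Q_glue: "path_homotopic X (Q x) (Q y)" if "glue K x y" for x y
    using that
  proof cases
    case (glue_origin e)
    have "path_homotopic X (Q (Edge e, 0)) (V (origin K e))"
      using Q_vert[of "Edge e"] glue_origin by simp
    moreover have "path_homotopic X (Q (Vert (origin K e), 0)) (V (origin K e))"
      using Q_vert[of "Vert (origin K e)"] glue_origin origin_in_verts by simp
    ultimately show ?thesis
      unfolding glue_origin using path_homotopic_sym path_homotopic_trans by blast
  next
    case (glue_reversal e t)
    note e = glue_reversal(3)
    let ?r = "reversal K e"
    have r: "?r \<in> edges K" using e by (rule reversal_in_edges)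
    let ?g = "\<lambda>s. of_real (1 - s * (1 - t)) :: complex"
    have st: "0 \<le> s * (1 - t) \<and> s * (1 - t) \<le> 1" if "0 \<le> s" "s \<le> 1" for s
      using that glue_reversal(4) by (auto intro: mult_le_one)
    have g: "pathin (cell_model (Edge e)) ?g"
      unfolding pathin_cell_model_iff
    proof
      show "continuous_on {0..1} ?g" by (intro continuous_intros)
      show "?g ` {0..1} \<subseteq> cell_set (Edge e)"
        unfolding cell_set.simps
        by (intro image_subsetI imageI) (use st in \<open>simp add: algebra_simps\<close>)
    qed
    have t: "1 - t \<in> {0..1}" using glue_reversal(4) by simp
    have eq: "edge_path K ?r (s * (1 - t)) = glue_class K (Edge e, ?g s)" if "0 \<le> s" "s \<le> 1" for s
      using edge_path_reversal[OF e, of "s * (1 - t)"] st[OF that] by (simp add: edge_path_def)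
    have "path_homotopic X (Q (Edge ?r, of_real (1 - t)))
        (join_path (V (origin K ?r)) (\<lambda>s. edge_path K ?r (s * (1 - t))))"
      by (rule Q_edge[OF r t])
    also have "path_homotopic X \<dots> (join_path (Q (Edge e, 1)) (\<lambda>s. glue_class K (Edge e, ?g s)))"
    proof (rule path_homotopic_join)
      show "path_homotopic X (V (origin K ?r)) (Q (Edge e, 1))"
        by (rule path_homotopic_sym[OF Q_edge_end[OF e]])
      have "path_homotopic X (\<lambda>s. glue_class K (Edge e, ?g s)) (\<lambda>s. edge_path K ?r (s * (1 - t)))"
        using pathin_cell[of "Edge e" ?g] e g eq by (intro path_homotopic_eq) simp_all
      then show "path_homotopic X (\<lambda>s. edge_path K ?r (s * (1 - t))) (\<lambda>s. glue_class K (Edge e, ?g s))"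
        by (rule path_homotopic_sym)
      show "V (origin K ?r) 1 = edge_path K ?r (0 * (1 - t))"
        using V(3)[OF origin_in_verts[OF r]] edge_path_ends(1)[OF r] by simp
    qed
    also have "path_homotopic X \<dots> (Q (Edge e, of_real t))"
      using transport[of "Edge e" ?g] e g by simp
    finally show ?thesis unfolding glue_reversal(1,2) by (rule path_homotopic_sym)
  next
    case (glue_face f m t)
    let ?b = "boundary K f" and ?L = "length (boundary K f)"
    note f = glue_face(3)
    have b: "?b ! m \<in> edges K" if "m < ?L" for m using boundary_edges[OF f] that by (meson nth_mem subsetD)
    have L: "?L > 0" using boundary_nonempty[OF f] by simp
    have arc: "path_homotopic X (Q (Face f, cis (2 * pi * (real m + t) / real ?L))) (Q (Edge (?b ! m), of_real t))"
      if m: "m < ?L" and t: "t \<in> {0..1}"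
        and vert: "path_homotopic X (Q (Face f, cis (2 * pi * real m / real ?L))) (V (origin K (?b ! m)))" for m t
    proof -
      let ?g = "\<lambda>s. cis (2 * pi * (real m + s * t) / real ?L)"
      have g: "pathin (cell_model (Face f)) ?g"
        unfolding pathin_cell_model_iff using L by (auto intro!: continuous_intros)
      have eq: "glue_class K (Face f, ?g s) = edge_path K (?b ! m) (s * t)" if "0 \<le> s" "s \<le> 1" for s
        using glue_class_eqI[OF glue.glue_face[OF f m, of "s * t"]] that t
        by (simp add: edge_path_def mult_le_one)
      have "path_homotopic X (Q (Edge (?b ! m), of_real t))
          (join_path (V (origin K (?b ! m))) (\<lambda>s. edge_path K (?b ! m) (s * t)))"
        by (rule Q_edge[OF b[OF m] t])
      also have "path_homotopic X \<dots>
          (join_path (Q (Face f, cis (2 * pi * real m / real ?L))) (\<lambda>s. glue_class K (Face f, ?g s)))"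
      proof (rule path_homotopic_join)
        show "path_homotopic X (V (origin K (?b ! m))) (Q (Face f, cis (2 * pi * real m / real ?L)))"
          by (rule path_homotopic_sym[OF vert])
        have "path_homotopic X (\<lambda>s. glue_class K (Face f, ?g s)) (\<lambda>s. edge_path K (?b ! m) (s * t))"
          using pathin_cell[of "Face f" ?g] f g eq by (intro path_homotopic_eq) simp_all
        then show "path_homotopic X (\<lambda>s. edge_path K (?b ! m) (s * t)) (\<lambda>s. glue_class K (Face f, ?g s))"
          by (rule path_homotopic_sym)
        show "V (origin K (?b ! m)) 1 = edge_path K (?b ! m) (0 * t)"
          using V(3)[OF origin_in_verts[OF b[OF m]]] edge_path_ends(1)[OF b[OF m]] by simp
      qed
      also have "path_homotopic X \<dots> (Q (Face f, cis (2 * pi * (real m + t) / real ?L)))"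
        using transport[of "Face f" ?g] f g by simp
      finally show ?thesis by (rule path_homotopic_sym)
    qed
    (* Going around the boundary one arc at a time, starting from the base point 1 of the disc, where
       the claim holds by the definition of Q. *)
    have vert: "path_homotopic X (Q (Face f, cis (2 * pi * real m / real ?L))) (V (origin K (?b ! m)))"
      if "m < ?L" for m
      using that
    proof (induction m)
      case 0
      then show ?case using Q_vert[of "Face f"] f boundary_nonempty[OF f] by (simp add: hd_conv_nth)
    next
      case (Suc m)
      have "path_homotopic X (Q (Face f, cis (2 * pi * (real m + 1) / real ?L))) (Q (Edge (?b ! m), of_real 1))"
        using Suc by (intro arc) simp_all
      also have "path_homotopic X \<dots> (V (origin K (?b ! Suc m)))"
        using Q_edge_end[OF b[of m]] Suc.prems boundary_consecutive[OF f Suc.prems] by simp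
      finally show ?case by (simp add: add.commute)
    qed
    show ?thesis
      unfolding glue_face(1,2) by (rule arc[OF glue_face(4,5) vert[OF glue_face(4)]])
  qed
  have glue_S: "x \<in> ?S \<and> y \<in> ?S" if "glue K x y" for x y
    using that
  proof cases
    case (glue_face f m t)
    then show ?thesis using boundary_edges[OF glue_face(3)] by (auto intro!: imageI)
  next
    case (glue_reversal e t)
    then have "of_real (1 - t) \<in> (of_real ` {0..1} :: complex set)" by (intro imageI) auto
    then show ?thesis using glue_reversal reversal_in_edges[of e] by (auto simp del: of_real_diff)
  next
    case (glue_origin e)
    then show ?thesis using origin_in_verts[of e] by (auto intro: image_eqI[of _ of_real 0])
  qed
  have Q_class: "path_homotopic X (Q x) (Q y)" if "glue_class K x = glue_class K y" "x \<in> ?S" for x y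
  proof -
    define R where "R x y \<longleftrightarrow> (x \<in> ?S \<longleftrightarrow> y \<in> ?S) \<and> (x \<in> ?S \<longrightarrow> path_homotopic X (Q x) (Q y))" for x y
    have "R x y"
    proof (rule glue_class_invariant[OF that(1)])
      show "R x x" for x using Q(1) by (cases x) (auto simp: R_def intro: path_homotopic_refl)
      show "R x y" if "glue K x y" for x y using glue_S[OF that] Q_glue[OF that] by (simp add: R_def)
      show "R y x" if "R x y" for x y
        using that path_homotopic_sym[of X "Q x" "Q y"] unfolding R_def by iprover
      show "R x z" if "R x y" "R y z" for x y z
        using that path_homotopic_trans[of X "Q x" "Q y" "Q z"] unfolding R_def by iprover
    qed
    then show ?thesis using that(2) by (simp add: R_def)
  qed
  define P where "P y = Q (SOME x. x \<in> ?S \<and> glue_class K x = y)" for y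
  have PQ: "path_homotopic X (P (glue_class K x)) (Q x)" if "x \<in> ?S" for x
  proof -
    let ?x = "SOME z. z \<in> ?S \<and> glue_class K z = glue_class K x"
    have "?x \<in> ?S \<and> glue_class K ?x = glue_class K x"
      by (rule someI[of _ x]) (use that in simp)
    then show ?thesis using Q_class[of ?x x] by (simp add: P_def)
  qed
  interpret path_system X "glue_class K (Vert v0, 0)" P
  proof
    fix y assume "y \<in> topspace X"
    then obtain c z where y: "y = glue_class K (c, z)" "c \<in> cells K" "z \<in> cell_set c"
      by (auto simp: topspace_realisation)
    show "pathin X (P y)" "P y 0 = glue_class K (Vert v0, 0)" "P y 1 = y"
      using path_homotopic_imp[OF PQ[of "(c, z)"]] Q[OF y(2,3)] y by simp_all
  qed
  interpret trivialising_system K "glue_class K (Vert v0, 0)" P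
  proof
    fix c g assume c: "c \<in> cells K" and g: "pathin (cell_model c) g"
    have gc: "(c, g 0) \<in> ?S" "(c, g 1) \<in> ?S"
      using g c unfolding pathin_cell_model_iff by auto
    have "path_homotopic X (join_path (P (glue_class K (c, g 0))) (\<lambda>t. glue_class K (c, g t)))
        (join_path (Q (c, g 0)) (\<lambda>t. glue_class K (c, g t)))"
    proof (rule path_homotopic_join)
      show "path_homotopic X (P (glue_class K (c, g 0))) (Q (c, g 0))" by (rule PQ[OF gc(1)])
      show "path_homotopic X (\<lambda>t. glue_class K (c, g t)) (\<lambda>t. glue_class K (c, g t))"
        by (rule path_homotopic_refl[OF pathin_cell[OF c g]])
      show "P (glue_class K (c, g 0)) 1 = glue_class K (c, g 0)"
        using path_homotopic_imp(4)[OF PQ[OF gc(1)]] Q(3)[of c "g 0"] gc by simp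
    qed
    also have "path_homotopic X \<dots> (Q (c, g 1))" by (rule transport[OF c g])
    also have "path_homotopic X \<dots> (P (glue_class K (c, g 1)))" by (rule path_homotopic_sym[OF PQ[OF gc(2)]])
    finally show "trivialised (\<lambda>t. glue_class K (c, g t))"
      using pathin_cell[OF c g] by (simp add: trivialised_def)
  qed
  show ?thesis by (rule simply_connected_realisation_if_trivialising)
qed

end


section \<open>Rank two periodicity\<close>

text \<open>The effect on the entries \<open>(\<epsilon>\<^sub>i\<^sub>j, -\<epsilon>\<^sub>j\<^sub>i, \<epsilon>\<^sub>a\<^sub>i, \<epsilon>\<^sub>a\<^sub>j)\<close> of mutating at \<open>i\<close> and then exchanging \<open>i\<close> and
  \<open>j\<close>, when \<open>\<epsilon>\<^sub>j\<^sub>i \<le> 0 \<le> \<epsilon>\<^sub>i\<^sub>j\<close>.\<close>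

fun rank2_step :: "'a::linordered_field \<times> 'a \<times> 'a \<times> 'a \<Rightarrow> 'a \<times> 'a \<times> 'a \<times> 'a" where
  "rank2_step (a, b, x, y) = (b, a, y + a * max x 0, - x)"

text \<open>The types \<open>A\<^sub>1 \<times> A\<^sub>1\<close>, \<open>A\<^sub>2\<close>, \<open>B\<^sub>2\<close> and \<open>G\<^sub>2\<close>, with period two more than the Coxeter number.\<close>

definition rank2_period :: "'a::linordered_field \<Rightarrow> 'a \<Rightarrow> nat \<Rightarrow> bool" where
  "rank2_period a b n \<longleftrightarrow> (a, b, n) \<in>
     {(0, 0, 4), (1, 1, 5), (2, 1, 6), (1, 2, 6), (3, 1, 8), (1, 3, 8)}"

lemma rank2_periodE:
  assumes "rank2_period a b n"
  obtains "a = 0" "b = 0" "n = 4" | "a = 1" "b = 1" "n = 5"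
    | "a = 2" "b = 1" "n = 6" | "a = 1" "b = 2" "n = 6"
    | "a = 3" "b = 1" "n = 8" | "a = 1" "b = 3" "n = 8"
  using assms unfolding rank2_period_def prod.inject insert_iff empty_iff by metis

text \<open>The recursion \<open>x\<^sub>k\<^sub>+\<^sub>1 = c\<^sub>k max(x\<^sub>k, 0) - x\<^sub>k\<^sub>-\<^sub>1\<close>, with \<open>c\<^sub>k\<close> alternating between the two entries of the
  block, is the tropical form of the recursion for cluster variables in rank two. It is piecewise
  linear, so each periodicity is a finite case distinction in linear arithmetic.\<close>

lemma period_1_1:
  fixes x0 :: real
  assumes "x2 = max x1 0 - x0"  "x3 = max x2 0 - x1"  "x4 = max x3 0 - x2"
    "x5 = max x4 0 - x3"  "x6 = max x5 0 - x4"
  shows "x5 = x0 \<and> x6 = x1"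
  using assms unfolding max_def by (smt (verit))

lemma period_2_1:
  fixes x0 :: real
  assumes "x2 = 2 * max x1 0 - x0"  "x3 = max x2 0 - x1"  "x4 = 2 * max x3 0 - x2"
    "x5 = max x4 0 - x3"  "x6 = 2 * max x5 0 - x4"  "x7 = max x6 0 - x5"
  shows "x6 = x0 \<and> x7 = x1"
  using assms unfolding max_def by (smt (verit))

lemma period_1_2:
  fixes x0 :: real
  assumes "x2 = max x1 0 - x0"  "x3 = 2 * max x2 0 - x1"  "x4 = max x3 0 - x2"
    "x5 = 2 * max x4 0 - x3"  "x6 = max x5 0 - x4"  "x7 = 2 * max x6 0 - x5"
  shows "x6 = x0 \<and> x7 = x1"
  using assms unfolding max_def by (smt (verit))

lemma period_3_1:
  fixes x0 :: real
  assumes "x2 = 3 * max x1 0 - x0"  "x3 = max x2 0 - x1"  "x4 = 3 * max x3 0 - x2"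
    "x5 = max x4 0 - x3"  "x6 = 3 * max x5 0 - x4"  "x7 = max x6 0 - x5"
    "x8 = 3 * max x7 0 - x6"  "x9 = max x8 0 - x7"
  shows "x8 = x0 \<and> x9 = x1"
  using assms unfolding max_def by (smt (verit))

lemma period_1_3:
  fixes x0 :: real
  assumes "x2 = max x1 0 - x0"  "x3 = 3 * max x2 0 - x1"  "x4 = max x3 0 - x2"
    "x5 = 3 * max x4 0 - x3"  "x6 = max x5 0 - x4"  "x7 = 3 * max x6 0 - x5"
    "x8 = max x7 0 - x6"  "x9 = 3 * max x8 0 - x7"
  shows "x8 = x0 \<and> x9 = x1"
  using assms unfolding max_def by (smt (verit))

lemma funpow_rank2_step_real:
  fixes x y :: real
  assumes "rank2_period a b n"
  shows "(rank2_step ^^ n) (a, b, x, y) = (a, b, x, y)"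
proof -
  define p q where pq: "p k = fst (snd (snd ((rank2_step ^^ k) (a, b, x, y))))"
    "q k = snd (snd (snd ((rank2_step ^^ k) (a, b, x, y))))" for k
  have state: "(rank2_step ^^ k) (a, b, x, y) =
      (if even k then a else b, if even k then b else a, p k, q k)" for k
  proof -
    have "rank2_step s = (fst (snd s), fst s, snd (snd (snd s)) + fst s * max (fst (snd (snd s))) 0,
        - fst (snd (snd s)))" for s :: "real \<times> real \<times> real \<times> real"
      by (cases s) simp
    then have "fst ((rank2_step ^^ k) (a, b, x, y)) = (if even k then a else b) \<and>
        fst (snd ((rank2_step ^^ k) (a, b, x, y))) = (if even k then b else a)"
      by (induction k) simp_all
    then show ?thesis by (simp add: prod_eq_iff pq)
  qed
  have q: "q (Suc k) = - p k" for k
    using state[of k] state[of "Suc k"] by simp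
  have p: "p (Suc k) = q k + (if even k then a else b) * max (p k) 0" for k
    using state[of k] state[of "Suc k"] by (cases "even k") simp_all
  (* The third component alone satisfies a recursion of second order. *)
  have pp: "p (k + 2) = (if even k then b else a) * max (p (k + 1)) 0 - p k" for k
    using p[of "Suc k"] q[of k] by simp
  have p0: "p 0 = x" "q 0 = y"
    by (simp_all add: pq)
  have p1: "p 1 = a * max x 0 - - y"
    using p[of 0] unfolding p0 by simp
  have p2: "p 2 = b * max (p 1) 0 - x"
    using pp[of 0] unfolding p0 by (simp add: numeral_2_eq_2)
  have p3: "p 3 = a * max (p 2) 0 - p 1" using pp[of 1] by (simp add: numeral_2_eq_2 numeral_3_eq_3)
  have p4: "p 4 = b * max (p 3) 0 - p 2" using pp[of 2] by simp
  have p5: "p 5 = a * max (p 4) 0 - p 3" using pp[of 3] by simp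
  have p6: "p 6 = b * max (p 5) 0 - p 4" using pp[of 4] by simp
  have p7: "p 7 = a * max (p 6) 0 - p 5" using pp[of 5] by simp
  have p8: "p 8 = b * max (p 7) 0 - p 6" using pp[of 6] by simp
  note rec = p1 p2 p3 p4 p5 p6 p7 p8
  from assms have "p n = x \<and> p (n - 1) = - y"
  proof (cases rule: rank2_periodE)
    case 1
    have "p 4 = x \<and> p 3 = - y"
      using rec(1-4) by (simp add: 1)
    with 1 show ?thesis by simp
  next
    case 2
    have "p 4 = - y \<and> p 5 = x"
      by (rule period_1_1[OF rec(1-5)[unfolded 2 mult_1]])
    with 2 show ?thesis by simp
  next
    case 3
    have "p 5 = - y \<and> p 6 = x"
      by (rule period_2_1[OF rec(1-6)[unfolded 3 mult_1]])
    with 3 show ?thesis by simp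
  next
    case 4
    have "p 5 = - y \<and> p 6 = x"
      by (rule period_1_2[OF rec(1-6)[unfolded 4 mult_1]])
    with 4 show ?thesis by simp
  next
    case 5
    have "p 7 = - y \<and> p 8 = x"
      by (rule period_3_1[OF rec(1-8)[unfolded 5 mult_1]])
    with 5 show ?thesis by simp
  next
    case 6
    have "p 7 = - y \<and> p 8 = x"
      by (rule period_1_3[OF rec(1-8)[unfolded 6 mult_1]])
    with 6 show ?thesis by simp
  qed
  moreover have "q n = - p (n - 1)"
    using q[of "n - 1"] assms by (auto elim: rank2_periodE)
  moreover have "even n \<or> a = b"
    using assms by (auto elim: rank2_periodE)
  ultimately show ?thesis
    unfolding state[of n] by (elim conjE disjE) simp_all
qed

text \<open>The embedding of the rationals into the reals commutes with the step.\<close>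

lemma funpow_rank2_step:
  fixes x y :: rat
  assumes "rank2_period a b n"
  shows "(rank2_step ^^ n) (a, b, x, y) = (a, b, x, y)"
proof -
  define r :: "rat \<times> rat \<times> rat \<times> rat \<Rightarrow> real \<times> real \<times> real \<times> real" where
    "r = (\<lambda>(a, b, x, y). (of_rat a, of_rat b, of_rat x, of_rat y))"
  have "of_rat (max x 0) = max (of_rat x :: real) 0" for x :: rat
    by (auto simp: max_def)
  then have "r (rank2_step s) = rank2_step (r s)" for s
    by (cases s) (simp add: r_def of_rat_add of_rat_mult of_rat_minus)
  then have iter: "r ((rank2_step ^^ k) s) = (rank2_step ^^ k) (r s)" for k s
    by (induction k) simp_all
  have "rank2_period (of_rat a) (of_rat b :: real) n"
    using assms by (cases rule: rank2_periodE) (simp_all add: rank2_period_def)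
  then have "(rank2_step ^^ n) (r (a, b, x, y)) = r (a, b, x, y)"
    unfolding r_def case_prod_conv by (rule funpow_rank2_step_real)
  moreover have "inj r"
    by (auto simp: inj_def r_def)
  ultimately show ?thesis
    unfolding iter[symmetric] by (rule injD[rotated])
qed

context
  fixes i j :: 'i and F :: "'i matrix \<Rightarrow> 'i matrix"
  assumes ij: "i \<noteq> j"
  defines "F \<equiv> \<lambda>M. permute_matrix (Transposition.transpose i j) (mutate i M)"
begin

text \<open>The map \<open>F\<close> is one step \<open>(i j)\<mu>\<^sub>i\<close> of a standard sequence.\<close>

lemma F_apply: "F M a b = mutate i M (Transposition.transpose i j a) (Transposition.transpose i j b)"
  by (simp add: F_def permute_matrix_def)

lemma F_block:
  "F M i j = - M j i" "F M j i = - M i j" "F M j j = - M i i"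
  "F M i i = M j j + (\<bar>M j i\<bar> * M i j + M j i * \<bar>M i j\<bar>) / 2"
  using ij by (simp_all add: F_apply mutate_def)

lemma F_row:
  assumes "a \<noteq> i" "a \<noteq> j"
  shows "F M a i = M a j + (\<bar>M a i\<bar> * M i j + M a i * \<bar>M i j\<bar>) / 2" "F M a j = - M a i"
  using ij assms by (simp_all add: F_apply mutate_def transpose_apply_other)

lemma F_col:
  assumes "b \<noteq> i" "b \<noteq> j"
  shows "F M i b = M j b + (\<bar>M j i\<bar> * M i b + M j i * \<bar>M i b\<bar>) / 2" "F M j b = - M i b"
  using ij assms by (simp_all add: F_apply mutate_def transpose_apply_other)

lemma F_other:
  assumes "a \<noteq> i" "a \<noteq> j" "b \<noteq> i" "b \<noteq> j"
  shows "F M a b = M a b + (\<bar>M a i\<bar> * M i b + M a i * \<bar>M i b\<bar>) / 2"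
  using ij assms by (simp_all add: F_apply mutate_def transpose_apply_other)

text \<open>This sign condition makes the absolute values in the rows and columns of \<open>i\<close> and \<open>j\<close> collapse to
  \<open>max\<close>; it is preserved because mutation at \<open>i\<close> negates the block and the transposition restores the
  signs.\<close>

definition block_ok :: "'i matrix \<Rightarrow> bool" where
  "block_ok M \<longleftrightarrow> M i i = 0 \<and> M j j = 0 \<and> 0 \<le> M i j \<and> M j i \<le> 0"

lemma block_ok_F: "block_ok M \<Longrightarrow> block_ok (F M)"
  by (auto simp: block_ok_def F_block)

lemma block_ok_funpow_F: "block_ok M \<Longrightarrow> block_ok ((F ^^ n) M)"
  by (induction n) (auto simp: block_ok_F)

lemma row_F:
  assumes "block_ok M" "a \<noteq> i" "a \<noteq> j"
  shows "(F M i j, - F M j i, F M a i, F M a j) = rank2_step (M i j, - M j i, M a i, M a j)"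
  using assms by (auto simp: block_ok_def F_block F_row max_def field_simps)

lemma row_funpow_F:
  assumes "block_ok M" "a \<noteq> i" "a \<noteq> j"
  shows "((F ^^ n) M i j, - (F ^^ n) M j i, (F ^^ n) M a i, (F ^^ n) M a j) =
    (rank2_step ^^ n) (M i j, - M j i, M a i, M a j)"
  by (induction n) (simp_all add: row_F[OF block_ok_funpow_F] assms del: rank2_step.simps)

text \<open>Columns obey the same recursion as rows after a change of sign, with the two entries of the
  block interchanged.\<close>

lemma col_F:
  assumes "block_ok M" "b \<noteq> i" "b \<noteq> j"
  shows "(- F M j i, F M i j, - F M i b, - F M j b) = rank2_step (- M j i, M i j, - M i b, - M j b)"
  using assms by (auto simp: block_ok_def F_block F_col max_def field_simps)

lemma col_funpow_F:
  assumes "block_ok M" "b \<noteq> i" "b \<noteq> j"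
  shows "(- (F ^^ n) M j i, (F ^^ n) M i j, - (F ^^ n) M i b, - (F ^^ n) M j b) =
    (rank2_step ^^ n) (- M j i, M i j, - M i b, - M j b)"
  by (induction n) (simp_all add: col_F[OF block_ok_funpow_F] assms del: rank2_step.simps)

lemma block_funpow_F:
  "((F ^^ n) M i j, - (F ^^ n) M j i) = (if even n then (M i j, - M j i) else (- M j i, M i j))"
  by (induction n) (auto simp: F_block)

text \<open>The entries of the Schur complement of the block of \<open>i\<close> and \<open>j\<close>. Mutation at \<open>i\<close> multiplies the
  matrix on either side by a block triangular matrix that is the identity outside the block, and
  such multiplications do not change the Schur complement.\<close>

definition schur :: "'i \<Rightarrow> 'i \<Rightarrow> 'i matrix \<Rightarrow> rat" where
  "schur a b M = M a b - M a i * M j b / M j i - M a j * M i b / M i j"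

lemma schur_F:
  assumes "block_ok M" "M i j \<noteq> 0" "M j i \<noteq> 0" "a \<noteq> i" "a \<noteq> j" "b \<noteq> i" "b \<noteq> j"
  shows "schur a b (F M) = schur a b M"
proof -
  define A B where "A = M i j" "B = - M j i"
  note AB = A_B_def
  have pos: "A > 0" "B > 0" using assms by (auto simp: block_ok_def AB)
  have r: "M i j = A" "M j i = - B" by (simp_all add: AB)
  have 1: "F M a i * M i b / A = M a j * M i b / A + (\<bar>M a i\<bar> * M i b + M a i * M i b) / 2"
    using pos assms by (simp add: F_row r field_simps)
  have 2: "M a i * F M i b / B = M a i * M j b / B + (M a i * M i b - M a i * \<bar>M i b\<bar>) / 2"
    using pos assms by (simp add: F_col r field_simps)
  have "schur a b (F M) = F M a b - F M a i * M i b / A + M a i * F M i b / B"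
    using assms by (simp add: schur_def F_block F_row(2) F_col(2) r)
  also have "\<dots> = M a b + M a i * M j b / B - M a j * M i b / A"
    unfolding 1 2 using assms by (simp add: F_other add_divide_distrib diff_divide_distrib)
  also have "\<dots> = schur a b M"
    by (simp add: schur_def r)
  finally show ?thesis .
qed

lemma schur_funpow_F:
  assumes "block_ok M" "M i j \<noteq> 0" "M j i \<noteq> 0" "a \<noteq> i" "a \<noteq> j" "b \<noteq> i" "b \<noteq> j"
  shows "schur a b ((F ^^ n) M) = schur a b M"
proof (induction n)
  case (Suc n)
  have "(F ^^ n) M i j \<noteq> 0" "(F ^^ n) M j i \<noteq> 0"
    using block_funpow_F[of n M] assms(2,3) by (auto split: if_splits)
  then show ?case
    using schur_F[OF block_ok_funpow_F[OF assms(1)]] assms(4-) Suc by simp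
qed simp

text \<open>The rows and columns of \<open>i\<close> and \<open>j\<close> return by periodicity, and the other entries are determined by
  them and by the invariant Schur complement. When the block vanishes there is no Schur complement,
  but then the period is four and the steps can be expanded.\<close>

lemma funpow_F_standard:
  assumes ok: "block_ok M" and per: "rank2_period (M i j) (- M j i) n"
  shows "(F ^^ n) M = M"
proof (intro ext)
  fix a b
  let ?M = "(F ^^ n) M"
  have per': "rank2_period (- M j i) (M i j) n"
    using per unfolding rank2_period_def by (elim insertE emptyE; simp)
  have ij: "?M i j = M i j \<and> ?M j i = M j i"
    using block_funpow_F[of n M] per unfolding rank2_period_def by (elim insertE emptyE; simp)
  have row: "?M c i = M c i \<and> ?M c j = M c j" if "c \<noteq> i" "c \<noteq> j" for c
    using row_funpow_F[OF ok that, of n] funpow_rank2_step[OF per] by simp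
  have col: "?M i c = M i c \<and> ?M j c = M j c" if "c \<noteq> i" "c \<noteq> j" for c
    using col_funpow_F[OF ok that, of n] funpow_rank2_step[OF per'] by simp
  have diag: "?M i i = M i i \<and> ?M j j = M j j"
    using ok block_ok_funpow_F[OF ok, of n] unfolding block_ok_def by auto
  have other: "?M a b = M a b" if ab: "a \<noteq> i" "a \<noteq> j" "b \<noteq> i" "b \<noteq> j"
  proof (cases "M i j = 0 \<or> M j i = 0")
    case True
    with per have z: "M i j = 0 \<and> M j i = 0 \<and> n = 4"
      by (cases rule: rank2_periodE) simp_all
    then show ?thesis
      using ab by (simp add: eval_nat_numeral F_block F_row F_col F_other add_divide_distrib diff_divide_distrib)
  next
    case False
    have "schur a b ?M = schur a b M"
      using schur_funpow_F[OF ok _ _ ab] False by blast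
    then show ?thesis
      using ij row[OF ab(1,2)] col[OF ab(3,4)] by (simp add: schur_def)
  qed
  consider "a = i" | "a = j" | "a \<noteq> i" "a \<noteq> j" by blast
  then show "?M a b = M a b"
  proof cases
    case 1 then show ?thesis using ij diag col[of b] by (cases "b = i"; cases "b = j") auto
  next
    case 2 then show ?thesis using ij diag col[of b] by (cases "b = i"; cases "b = j") auto
  next
    case 3 then show ?thesis using row[of a] other by (cases "b = i"; cases "b = j") auto
  qed
qed

end


section \<open>Mutations and permutations of matrices\<close>

abbreviation pinv :: "('i \<Rightarrow> 'i) \<Rightarrow> 'i \<Rightarrow> 'i" where
  "pinv \<equiv> Hilbert_Choice.inv"

lemma mutate_mutate [simp]: "mutate k (mutate k M) = M"
  by (auto simp: mutate_def fun_eq_iff add_divide_distrib diff_divide_distrib)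

lemma permute_matrix_id [simp]: "permute_matrix id M = M"
  by (simp add: permute_matrix_def)

lemma permute_matrix_comp:
  "bij \<sigma> \<Longrightarrow> bij \<tau> \<Longrightarrow> permute_matrix \<sigma> (permute_matrix \<tau> M) = permute_matrix (\<sigma> \<circ> \<tau>) M"
  by (simp add: permute_matrix_def o_inv_distrib)

lemma mutate_permute_matrix:
  assumes "bij \<sigma>"
  shows "mutate k (permute_matrix \<sigma> M) = permute_matrix \<sigma> (mutate (pinv \<sigma> k) M)"
proof -
  have "pinv \<sigma> i = pinv \<sigma> k \<longleftrightarrow> i = k" for i
    using assms by (metis bij_inv_eq_iff)
  then show ?thesis by (auto simp: mutate_def permute_matrix_def fun_eq_iff)
qed

text \<open>The property of exchange matrices on which the periodicity rests: the block of \<open>i\<close> and \<open>j\<close> has zero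
  diagonal, and its other two entries vanish together. Mutation preserves it with the same multipliers.
  The multipliers are rational and stand on the other side of the equation, so that no division
  occurs.\<close>

definition skew_symmetrizable :: "'i set \<Rightarrow> 'i matrix \<Rightarrow> bool" where
  "skew_symmetrizable I M \<longleftrightarrow> (\<exists>d :: 'i \<Rightarrow> rat. (\<forall>j\<in>I. d j > 0) \<and>
     (\<forall>i\<in>I. \<forall>j\<in>I. M i j * d i = - (M j i * d j)))"

lemma skew_symmetrizableD:
  assumes "skew_symmetrizable I M" "i \<in> I" "j \<in> I"
  shows "M i i = 0" "M i j = 0 \<Longrightarrow> M j i = 0"
proof -
  obtain d :: "'a \<Rightarrow> rat" where d: "\<forall>j\<in>I. d j > 0" "\<forall>i\<in>I. \<forall>j\<in>I. M i j * d i = - (M j i * d j)"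
    using assms(1) unfolding skew_symmetrizable_def by (elim exE conjE)
  note d(2)[rule_format, OF assms(2,2)] d(2)[rule_format, OF assms(2,3)]
    d(1)[rule_format, OF assms(2)] d(1)[rule_format, OF assms(3)]
  then show "M i i = 0" "M i j = 0 \<Longrightarrow> M j i = 0" by auto
qed

lemma skew_symmetrizable_mutate:
  assumes "skew_symmetrizable I M" and k: "k \<in> I"
  shows "skew_symmetrizable I (mutate k M)"
proof -
  obtain d :: "'a \<Rightarrow> rat" where d: "\<forall>j\<in>I. d j > 0" "\<forall>i\<in>I. \<forall>j\<in>I. M i j * d i = - (M j i * d j)"
    using assms(1) unfolding skew_symmetrizable_def by (elim exE conjE)
  have "mutate k M i j * d i = - (mutate k M j i * d j)" if ij: "i \<in> I" "j \<in> I" for i j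
  proof (cases "i = k \<or> j = k")
    case True
    then show ?thesis using d(2)[rule_format, OF ij] by (elim disjE) (simp_all add: mutate_def)
  next
    case False
    note pos = d(1)[rule_format, OF ij(1)] d(1)[rule_format, OF ij(2)] d(1)[rule_format, OF k]
    note e = d(2)[rule_format, OF ij] d(2)[rule_format, OF ij(1) k] d(2)[rule_format, OF k ij(2)]
    (* With these, each of the two products in the mutation formula, times d i, is the negative of the
       other product with i and j exchanged, times d j. *)
    have a: "\<bar>M i k\<bar> * d i = \<bar>M k i\<bar> * d k" "\<bar>M k j\<bar> * d k = \<bar>M j k\<bar> * d j"
      using arg_cong[OF e(2), of abs] arg_cong[OF e(3), of abs] pos by (simp_all add: abs_mult)
    have "\<bar>M i k\<bar> * M k j * d i = (\<bar>M i k\<bar> * d i) * M k j" by simp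
    also have "\<dots> = \<bar>M k i\<bar> * (M k j * d k)" unfolding a(1) by simp
    also have "\<dots> = - (M j k * \<bar>M k i\<bar> * d j)" unfolding e(3) by simp
    finally have 1: "\<bar>M i k\<bar> * M k j * d i = - (M j k * \<bar>M k i\<bar> * d j)" .
    have "M i k * \<bar>M k j\<bar> * d i = (M i k * d i) * \<bar>M k j\<bar>" by simp
    also have "\<dots> = - (M k i * (\<bar>M k j\<bar> * d k))" unfolding e(2) by simp
    also have "\<dots> = - (\<bar>M j k\<bar> * M k i * d j)" unfolding a(2) by simp
    finally have 2: "M i k * \<bar>M k j\<bar> * d i = - (\<bar>M j k\<bar> * M k i * d j)" .
    show ?thesis
      using False e(1) 1 2 by (simp add: mutate_def ring_distribs add_divide_distrib)
  qed
  then show ?thesis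
    unfolding skew_symmetrizable_def by (intro exI[of _ d] conjI d(1) ballI)
qed

lemma exchange_matrix_skew_symmetrizable:
  assumes "exchange_matrix I I0 \<epsilon>"
  shows "skew_symmetrizable I \<epsilon>"
proof -
  obtain d :: "'a \<Rightarrow> nat" where d: "\<forall>j\<in>I. d j > 0"
    "\<forall>i\<in>I. \<forall>j\<in>I. \<epsilon> i j / of_nat (d j) = - (\<epsilon> j i / of_nat (d i))"
    using assms unfolding exchange_matrix_def by (elim exE conjE)
  show ?thesis
    unfolding skew_symmetrizable_def
  proof (intro exI conjI ballI)
    show "0 < (of_nat (d j) :: rat)" if "j \<in> I" for j
      using d(1)[rule_format, OF that] by simp
    show "\<epsilon> i j * of_nat (d i) = - (\<epsilon> j i * of_nat (d j))" if ij: "i \<in> I" "j \<in> I" for i j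
    proof -
      have nz: "of_nat (d i) \<noteq> (0::rat)" "of_nat (d j) \<noteq> (0::rat)"
        using d(1)[rule_format, OF ij(1)] d(1)[rule_format, OF ij(2)] by simp_all
      have "\<epsilon> i j = (\<epsilon> i j / of_nat (d j)) * of_nat (d j)" using nz by simp
      also have "\<dots> = - (\<epsilon> j i / of_nat (d i)) * of_nat (d j)"
        unfolding d(2)[rule_format, OF ij] ..
      finally have "\<epsilon> i j * of_nat (d i) = - (\<epsilon> j i / of_nat (d i)) * of_nat (d j) * of_nat (d i)"
        by (rule arg_cong)
      also have "\<dots> = - (\<epsilon> j i * of_nat (d j))" using nz by simp
      finally show ?thesis .
    qed
  qed
qed

lemma seq_act_append: "seq_act (u @ w) M = seq_act u (seq_act w M)"
  by (simp add: seq_act_def)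

lemma seq_act_simps [simp]:
  "seq_act [] M = M" "seq_act (s # w) M = step_act s (seq_act w M)"
  by (simp_all add: seq_act_def)

lemma seq_act_concat_replicate:
  "seq_act (concat (replicate n w)) M = (seq_act w ^^ n) M"
  by (induction n) (simp_all add: seq_act_append)

lemma permute_transpose_mutate:
  "permute_matrix (Transposition.transpose i j) (mutate j M) =
    mutate i (permute_matrix (Transposition.transpose i j) M)"
  using mutate_permute_matrix[of "Transposition.transpose i j" i M] by simp

lemma funpow_left_inverse:
  fixes f g :: "'a \<Rightarrow> 'a"
  assumes "\<And>a. g (f a) = a"
  shows "(g ^^ n) ((f ^^ n) a) = a"
  by (induction n) (simp_all add: funpow_swap1[of g] assms)

text \<open>The sequence with \<open>\<mu>\<^sub>j\<close> is the inverse of the one with \<open>\<mu>\<^sub>i\<close>, so only the latter has to be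
  computed.\<close>

lemma seq_act_standard_seq:
  assumes pair: "standard_pair I I0 M h i j" and skew: "skew_symmetrizable I M" and k: "k \<in> {i, j}"
  shows "seq_act (standard_seq h i j k) M = M"
proof -
  let ?t = "Transposition.transpose i j"
  let ?F = "\<lambda>M. permute_matrix ?t (mutate i M)" and ?G = "\<lambda>M. permute_matrix ?t (mutate j M)"
  have ij: "i \<in> I" "j \<in> I" "i \<noteq> j" using pair by (auto simp: standard_pair_def)
  obtain p :: nat where p: "(p, h) \<in> {(0, 2), (1, 3), (2, 4), (3, 6)}" "M i j = of_nat p"
    "- of_nat p * M j i = of_nat p"
    using pair unfolding standard_pair_def by (elim exE conjE) metis
  note skew_ij = skew_symmetrizableD[OF skew ij(1,2)] skew_symmetrizableD(1)[OF skew ij(2,1)]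
  have "rank2_period (M i j) (- M j i) (h + 2) \<and> block_ok i j M"
    using p skew_ij unfolding rank2_period_def block_ok_def[OF ij(3)]
    by (elim insertE emptyE) simp_all
  then have F: "(?F ^^ (h + 2)) M = M"
    by (intro funpow_F_standard[OF ij(3)]) (elim conjE, assumption)+
  have GF: "?G (?F A) = A" for A
    by (simp add: permute_transpose_mutate permute_matrix_comp)
  have "(?G ^^ (h + 2)) ((?F ^^ (h + 2)) M) = M" by (rule funpow_left_inverse) (rule GF)
  then have G: "(?G ^^ (h + 2)) M = M" unfolding F .
  have "seq_act (standard_seq h i j k) M = (seq_act [Perm ?t, Mut k] ^^ (h + 2)) M"
    unfolding standard_seq_def by (rule seq_act_concat_replicate)
  moreover have "seq_act [Perm ?t, Mut i] = ?F" "seq_act [Perm ?t, Mut j] = ?G"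
    by (auto simp: fun_eq_iff)
  ultimately show ?thesis using F G k by (elim insertE emptyE) (simp_all only:)
qed

section \<open>The tree of reduced words\<close>

lemma distinct_adj_neighbour: "distinct_adj v \<Longrightarrow> distinct_adj (neighbour k v)"
  by (cases v) (auto simp: distinct_adj_Cons)

lemma neighbour_neighbour [simp]: "distinct_adj v \<Longrightarrow> neighbour k (neighbour k v) = v"
  by (cases v; cases "tl v") auto

lemma neighbour_Cons: "distinct_adj (k # v) \<Longrightarrow> neighbour k v = k # v"
  by (cases v) auto

lemma set_neighbour: "set (neighbour k v) \<subseteq> insert k (set v)"
  by (cases v) auto

lemma matrix_at_neighbour: "matrix_at \<epsilon> (neighbour k v) = mutate k (matrix_at \<epsilon> v)"
  by (cases v) (auto simp: matrix_at_def)

text \<open>The tree is the Cayley graph of the free product of groups of order two generated by the labels;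
  this is the action of words on its vertices from the left.\<close>

definition act :: "'i list \<Rightarrow> 'i list \<Rightarrow> 'i list" where
  "act u v = foldr neighbour u v"

lemma act_simps [simp]: "act [] v = v" "act (k # u) v = neighbour k (act u v)"
  by (simp_all add: act_def)

lemma act_append: "act (u @ u') v = act u (act u' v)"
  by (simp add: act_def)

lemma distinct_adj_act: "distinct_adj v \<Longrightarrow> distinct_adj (act u v)"
  by (induction u) (auto simp: distinct_adj_neighbour)

lemma act_rev_act [simp]: "distinct_adj v \<Longrightarrow> act (rev u) (act u v) = v"
  by (induction u) (simp_all add: act_append distinct_adj_act)

lemma act_act_rev [simp]: "distinct_adj v \<Longrightarrow> act u (act (rev u) v) = v"
  using act_rev_act[of v "rev u"] by simp

lemma act_Nil [simp]: "distinct_adj v \<Longrightarrow> act v [] = v"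
proof (induction v)
  case (Cons k v)
  have "act v [] = v" by (rule Cons.IH[OF distinct_adj_ConsD[OF Cons.prems]])
  then show ?case using neighbour_Cons[OF Cons.prems] by simp
qed simp

locale exchange =
  fixes I I0 :: "'i set" and \<epsilon> :: "'i matrix"
  assumes exchange_matrix: "exchange_matrix I I0 \<epsilon>"
begin

abbreviation "J \<equiv> I - I0"
abbreviation "tv \<equiv> tree_verts I I0"
abbreviation "perms \<equiv> index_perms I I0"
abbreviation "seqs \<equiv> mutation_seqs I I0"
abbreviation "M v \<equiv> matrix_at \<epsilon> v"

lemma tree_vertD: "v \<in> tv \<Longrightarrow> distinct_adj v" "v \<in> tv \<Longrightarrow> set v \<subseteq> J"
  by (auto simp: tree_verts_def)

lemma Nil_tree_vert [simp]: "[] \<in> tv" by (simp add: tree_verts_def)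

lemma neighbour_tree_vert [simp]: "v \<in> tv \<Longrightarrow> k \<in> J \<Longrightarrow> neighbour k v \<in> tv"
  using set_neighbour[of k v] by (auto simp: tree_verts_def distinct_adj_neighbour)

lemma act_tree_vert [simp]: "v \<in> tv \<Longrightarrow> set u \<subseteq> J \<Longrightarrow> act u v \<in> tv"
  by (induction u) auto

lemma perm_bij: "\<sigma> \<in> perms \<Longrightarrow> bij \<sigma>"
  by (auto simp: index_perms_def permutes_bij)

lemma perm_inv_apply [simp]:
  "\<sigma> \<in> perms \<Longrightarrow> \<sigma> (pinv \<sigma> k) = k" "\<sigma> \<in> perms \<Longrightarrow> pinv \<sigma> (\<sigma> k) = k"
  using perm_bij by (auto simp: bij_is_surj surj_f_inv_f bij_is_inj)

lemma perm_comp_inv [simp]: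
  "\<sigma> \<in> perms \<Longrightarrow> \<sigma> \<circ> pinv \<sigma> = id" "\<sigma> \<in> perms \<Longrightarrow> pinv \<sigma> \<circ> \<sigma> = id"
  by (auto simp: fun_eq_iff)

lemma perm_id [simp]: "id \<in> perms" by (simp add: index_perms_def permutes_id)

lemma perm_comp [simp]: "\<sigma> \<in> perms \<Longrightarrow> \<tau> \<in> perms \<Longrightarrow> \<sigma> \<circ> \<tau> \<in> perms"
  using permutes_compose[of \<tau> I \<sigma>] image_comp[of \<sigma> \<tau> I0] unfolding index_perms_def by simp

lemma perm_inv [simp]: "\<sigma> \<in> perms \<Longrightarrow> pinv \<sigma> \<in> perms"
proof -
  assume s: "\<sigma> \<in> perms"
  then have "pinv \<sigma> ` I0 = pinv \<sigma> ` (\<sigma> ` I0)" by (simp add: index_perms_def)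
  also have "\<dots> = I0" using s by (simp add: image_image)
  finally show ?thesis using s by (simp add: index_perms_def permutes_inv)
qed

lemma perm_I [simp]: "\<sigma> \<in> perms \<Longrightarrow> \<sigma> k \<in> I \<longleftrightarrow> k \<in> I"
  using permutes_in_image[of \<sigma> I k] by (simp add: index_perms_def)

lemma perm_I0 [simp]: "\<sigma> \<in> perms \<Longrightarrow> \<sigma> k \<in> I0 \<longleftrightarrow> k \<in> I0"
proof -
  assume s: "\<sigma> \<in> perms"
  have "\<sigma> k \<in> \<sigma> ` I0 \<longleftrightarrow> k \<in> I0" using perm_bij[OF s] by (simp add: bij_is_inj inj_image_mem_iff)
  then show ?thesis using s by (simp add: index_perms_def)
qed

lemma perm_inv_inv [simp]: "\<sigma> \<in> perms \<Longrightarrow> pinv (pinv \<sigma>) = \<sigma>"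
  by (simp add: perm_bij inv_inv_eq)

lemma transpose_perm: "i \<in> J \<Longrightarrow> j \<in> J \<Longrightarrow> Transposition.transpose i j \<in> perms"
  unfolding index_perms_def
  by (auto simp: permutes_swap_id transpose_def image_iff)

lemma seqs_simps [simp]:
  "[] \<in> seqs" "Mut k # w \<in> seqs \<longleftrightarrow> k \<in> J \<and> w \<in> seqs"
  "Perm \<sigma> # w \<in> seqs \<longleftrightarrow> \<sigma> \<in> perms \<and> w \<in> seqs"
  "u @ w \<in> seqs \<longleftrightarrow> u \<in> seqs \<and> w \<in> seqs"
  by (auto simp: mutation_seqs_def)

lemma map_Mut_seqs [simp]: "map Mut u \<in> seqs \<longleftrightarrow> set u \<subseteq> J"
  by (induction u) auto

lemma skew_matrix_at: "set v \<subseteq> I \<Longrightarrow> skew_symmetrizable I (M v)"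
  by (induction v)
    (auto simp: matrix_at_def skew_symmetrizable_mutate
      exchange_matrix_skew_symmetrizable[OF exchange_matrix])

section \<open>The tree vertex and permutation reached by a mutation sequence\<close>

text \<open>The state of a mutation sequence that starts at the base vertex is the tree vertex \<open>v\<close> reached,
  together with the product \<open>\<tau>\<close> of the permutations applied so far. The current matrix is the matrix at
  \<open>v\<close> permuted by \<open>\<tau>\<close>, so a mutation at \<open>k\<close> crosses the edge of the tree labelled \<open>\<tau>\<inverse>(k)\<close>.\<close>

fun state_step :: "'i step \<Rightarrow> 'i list \<times> ('i \<Rightarrow> 'i) \<Rightarrow> 'i list \<times> ('i \<Rightarrow> 'i)" where
  "state_step (Mut k) (v, \<tau>) = (neighbour (pinv \<tau> k) v, \<tau>)"
| "state_step (Perm \<sigma>) (v, \<tau>) = (v, \<sigma> \<circ> \<tau>)"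

definition end_state :: "'i step list \<Rightarrow> 'i list \<times> ('i \<Rightarrow> 'i) \<Rightarrow> 'i list \<times> ('i \<Rightarrow> 'i)" where
  "end_state w s = foldr state_step w s"

definition states :: "('i list \<times> ('i \<Rightarrow> 'i)) set" where
  "states = tv \<times> perms"

definition normal_form :: "'i list \<times> ('i \<Rightarrow> 'i) \<Rightarrow> 'i step list" where
  "normal_form s = Perm (snd s) # map Mut (fst s)"

lemma end_state_simps [simp]:
  "end_state [] s = s" "end_state (x # w) s = state_step x (end_state w s)"
  "end_state (u @ w) s = end_state u (end_state w s)"
  by (simp_all add: end_state_def)

lemma states_simps [simp]: "(v, \<tau>) \<in> states \<longleftrightarrow> v \<in> tv \<and> \<tau> \<in> perms"
  by (simp add: states_def)

lemma state_step_states: "s \<in> states \<Longrightarrow> [x] \<in> seqs \<Longrightarrow> state_step x s \<in> states"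
  by (cases s; cases x) auto

lemma end_state_states: "s \<in> states \<Longrightarrow> w \<in> seqs \<Longrightarrow> end_state w s \<in> states"
proof (induction w)
  case (Cons x w)
  then have "[x] \<in> seqs" "w \<in> seqs" by (cases x; simp)+
  then show ?case using Cons state_step_states by simp
qed simp

lemma end_state_map_Mut:
  "\<tau> \<in> perms \<Longrightarrow> end_state (map Mut u) (v, \<tau>) = (act (map (pinv \<tau>) u) v, \<tau>)"
  by (induction u) auto

lemma end_state_normal_form:
  "\<tau> \<in> perms \<Longrightarrow> end_state (normal_form (y, \<sigma>)) (v, \<tau>) = (act (map (pinv \<tau>) y) v, \<sigma> \<circ> \<tau>)"
  by (simp add: normal_form_def end_state_map_Mut)

lemma seq_act_end_state:
  assumes "s \<in> states" "w \<in> seqs"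
  shows "seq_act w (permute_matrix (snd s) (M (fst s))) =
    permute_matrix (snd (end_state w s)) (M (fst (end_state w s)))"
  using assms(2)
proof (induction w)
  case (Cons x w)
  then have x: "[x] \<in> seqs" "w \<in> seqs" by (cases x; simp)+
  obtain v \<tau> where s: "end_state w s = (v, \<tau>)" by (cases "end_state w s")
  have "(v, \<tau>) \<in> states" using end_state_states[OF assms(1) x(2)] s by simp
  then show ?case
    using Cons.IH[OF x(2)] s x(1) perm_bij[of \<tau>]
    by (cases x) (simp_all add: mutate_permute_matrix matrix_at_neighbour permute_matrix_comp perm_bij comp_def)
qed simp

lemma seq_act_start:
  "w \<in> seqs \<Longrightarrow> end_state w ([], id) = (v, \<tau>) \<Longrightarrow> seq_act w \<epsilon> = permute_matrix \<tau> (M v)"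
  using seq_act_end_state[of "([], id)" w] by (simp add: matrix_at_def)

abbreviation "word_equiv \<equiv> equivclp (elementary_move I I0 \<epsilon>)"

lemma standard_seq_seqs: "i \<in> J \<Longrightarrow> j \<in> J \<Longrightarrow> k \<in> {i, j} \<Longrightarrow> standard_seq h i j k \<in> seqs"
proof -
  assume ij: "i \<in> J" "j \<in> J" and k: "k \<in> {i, j}"
  have "k \<in> J" using ij k by blast
  with transpose_perm[OF ij] have "concat (replicate n [Perm (Transposition.transpose i j), Mut k]) \<in> seqs" for n
    by (induction n) simp_all
  then show ?thesis unfolding standard_seq_def .
qed

lemma basic_rel_seqs: "basic_rel I I0 A x y \<Longrightarrow> x \<in> seqs \<and> y \<in> seqs"
proof (induction rule: basic_rel.induct)
  case (standard h i j k)
  then show ?case using standard_seq_seqs[of i j k h] by (simp add: standard_pair_def)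
qed simp_all

lemma word_equiv_basic:
  assumes "u \<in> seqs" "w \<in> seqs" "basic_rel I I0 (seq_act w \<epsilon>) x y"
  shows "word_equiv (u @ x @ w) (u @ y @ w)"
  using elementary_move.intros[OF assms] by (rule r_into_equivclp)

lemma word_equiv_left:
  assumes "word_equiv x y" and u: "u \<in> seqs"
  shows "word_equiv (u @ x) (u @ y)"
  using assms(1)
proof (induction rule: equivclp_induct)
  case (step y z)
  have move: "elementary_move I I0 \<epsilon> (u @ a) (u @ b)" if "elementary_move I I0 \<epsilon> a b" for a b
    using that
  proof cases
    case (1 u' w x y)
    then show ?thesis
      using elementary_move.intros[of "u @ u'" I I0 w \<epsilon> x y] u by simp
  qed
  then have "word_equiv (u @ y) (u @ z)"
    using step(2) by (metis r_into_equivclp equivclp_sym)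
  with step(3) show ?case by (rule equivclp_trans)
qed simp

text \<open>Reduced words are reached by means of \<open>\<mu>\<^sub>k\<mu>\<^sub>k = 1\<close>.\<close>

lemma word_equiv_Mut_neighbour:
  assumes "k \<in> J" "v \<in> tv" "u \<in> seqs"
  shows "word_equiv (u @ Mut k # map Mut v) (u @ map Mut (neighbour k v))"
proof (cases "\<exists>v'. v = k # v'")
  case True
  then obtain v' where v: "v = k # v'" by blast
  then have "word_equiv (u @ [Mut k, Mut k] @ map Mut v') (u @ [] @ map Mut v')"
    using assms tree_vertD(2)[OF assms(2)] by (intro word_equiv_basic basic_rel.invol) auto
  then show ?thesis using v by simp
next
  case False
  then have "neighbour k v = k # v" by (cases v) auto
  then show ?thesis by simp
qed

lemma word_equiv_Mut_Perm:
  assumes k: "k \<in> J" and \<tau>: "\<tau> \<in> perms" and w: "w \<in> seqs"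
  shows "word_equiv (Mut k # Perm \<tau> # w) (Perm \<tau> # Mut (pinv \<tau> k) # w)"
proof -
  have k': "pinv \<tau> k \<in> J" using k \<tau> by simp
  have "word_equiv ([] @ [Perm \<tau>, Mut (pinv \<tau> k), Perm (pinv \<tau>)] @ (Perm \<tau> # w))
      ([] @ [Mut (\<tau> (pinv \<tau> k))] @ (Perm \<tau> # w))"
    using \<tau> w k' by (intro word_equiv_basic basic_rel.conj) auto
  then have 1: "word_equiv (Perm \<tau> # Mut (pinv \<tau> k) # Perm (pinv \<tau>) # Perm \<tau> # w) (Mut k # Perm \<tau> # w)"
    using \<tau> by simp
  have "word_equiv ([Perm \<tau>, Mut (pinv \<tau> k)] @ [Perm (pinv \<tau>), Perm \<tau>] @ w)
      ([Perm \<tau>, Mut (pinv \<tau> k)] @ [Perm (pinv \<tau> \<circ> \<tau>)] @ w)"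
    using \<tau> w k' by (intro word_equiv_basic basic_rel.comp) auto
  moreover have "word_equiv ([Perm \<tau>, Mut (pinv \<tau> k)] @ [Perm id] @ w) ([Perm \<tau>, Mut (pinv \<tau> k)] @ [] @ w)"
    using \<tau> w k' by (intro word_equiv_basic basic_rel.ident) auto
  ultimately have "word_equiv ([Perm \<tau>, Mut (pinv \<tau> k)] @ [Perm (pinv \<tau>), Perm \<tau>] @ w)
      ([Perm \<tau>, Mut (pinv \<tau> k)] @ [] @ w)"
    unfolding perm_comp_inv(2)[OF \<tau>] by (rule equivclp_trans)
  then have 2: "word_equiv (Perm \<tau> # Mut (pinv \<tau> k) # Perm (pinv \<tau>) # Perm \<tau> # w)
      (Perm \<tau> # Mut (pinv \<tau> k) # w)"
    by simp
  show ?thesis using equivclp_trans[OF equivclp_sym[OF 1] 2] .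
qed

text \<open>All permutations can be moved to the left, and the remaining word in the mutations can be reduced. The
  standard relations are not involved, so a word is determined by its final state up to the other
  relations.\<close>

lemma word_equiv_normal_form:
  assumes "w \<in> seqs"
  shows "word_equiv w (normal_form (end_state w ([], id)))"
  using assms
proof (induction w)
  case Nil
  have "word_equiv ([] @ [Perm id] @ []) ([] @ [] @ [])"
    by (intro word_equiv_basic basic_rel.ident) auto
  then have "word_equiv [Perm id] []" by simp
  then show ?case
    unfolding normal_form_def end_state_simps fst_conv snd_conv list.map by (rule equivclp_sym)
next
  case (Cons x w)
  then have x: "[x] \<in> seqs" "w \<in> seqs" by (cases x; simp)+
  obtain v \<tau> where s: "end_state w ([], id) = (v, \<tau>)" by (cases "end_state w ([], id)")
  have v: "v \<in> tv" "\<tau> \<in> perms" using end_state_states[of "([], id)" w] s x(2) by auto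
  have "word_equiv ([x] @ w) ([x] @ normal_form (v, \<tau>))"
    using word_equiv_left[OF Cons.IH[OF x(2)] x(1)] unfolding s .
  then have 1: "word_equiv (x # w) (x # Perm \<tau> # map Mut v)" by (simp add: normal_form_def)
  show ?case
  proof (cases x)
    case (Mut k)
    then have k: "k \<in> J" "pinv \<tau> k \<in> J" using x v by auto
    have "word_equiv (x # Perm \<tau> # map Mut v) (Perm \<tau> # Mut (pinv \<tau> k) # map Mut v)"
      unfolding Mut using k v tree_vertD by (intro word_equiv_Mut_Perm) auto
    also have "word_equiv \<dots> (Perm \<tau> # map Mut (neighbour (pinv \<tau> k) v))"
      using word_equiv_Mut_neighbour[OF k(2) v(1), of "[Perm \<tau>]"] v by simp
    finally have "word_equiv (x # w) (Perm \<tau> # map Mut (neighbour (pinv \<tau> k) v))"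
      by (rule equivclp_trans[OF 1])
    moreover have "end_state (x # w) ([], id) = (neighbour (pinv \<tau> k) v, \<tau>)" using s Mut by simp
    ultimately show ?thesis unfolding normal_form_def by (simp only: fst_conv snd_conv)
  next
    case (Perm \<sigma>)
    then have "word_equiv ([] @ [Perm \<sigma>, Perm \<tau>] @ map Mut v) ([] @ [Perm (\<sigma> \<circ> \<tau>)] @ map Mut v)"
      using x v tree_vertD by (intro word_equiv_basic basic_rel.comp) auto
    then have "word_equiv (x # Perm \<tau> # map Mut v) (Perm (\<sigma> \<circ> \<tau>) # map Mut v)"
      unfolding Perm by simp
    then have "word_equiv (x # w) (Perm (\<sigma> \<circ> \<tau>) # map Mut v)"
      by (rule equivclp_trans[OF 1])
    moreover have "end_state (x # w) ([], id) = (v, \<sigma> \<circ> \<tau>)" using s Perm by simp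
    ultimately show ?thesis unfolding normal_form_def by (simp only: fst_conv snd_conv)
  qed
qed

lemma word_equiv_if_same_end_state:
  assumes "x \<in> seqs" "y \<in> seqs" "end_state x ([], id) = end_state y ([], id)"
  shows "word_equiv x y"
  by (rule equivclp_trans[OF word_equiv_normal_form[OF assms(1), unfolded assms(3)]
        equivclp_sym[OF word_equiv_normal_form[OF assms(2)]]])

section \<open>Tree automorphisms and the kernel\<close>

abbreviation "autos \<equiv> tree_automorphisms I I0 \<epsilon>"
abbreviation "N \<equiv> ker_Phi I I0 \<epsilon>"

lemma autosD:
  assumes "(\<gamma>, \<sigma>) \<in> autos"
  shows "\<gamma> permutes tv" "\<sigma> \<in> perms"
    "\<And>v k. v \<in> tv \<Longrightarrow> k \<in> J \<Longrightarrow> \<gamma> (neighbour k v) = neighbour (\<sigma> k) (\<gamma> v)"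
    "\<And>v. v \<in> tv \<Longrightarrow> M (\<gamma> v) = permute_matrix \<sigma> (M v)"
  using assms unfolding tree_automorphisms_def by simp_all

lemma auto_tv: "(\<gamma>, \<sigma>) \<in> autos \<Longrightarrow> \<gamma> v \<in> tv \<longleftrightarrow> v \<in> tv"
  using autosD(1) permutes_in_image by metis

lemma auto_inverses:
  assumes "(\<gamma>, \<sigma>) \<in> autos"
  shows "\<gamma> (pinv \<gamma> v) = v" "pinv \<gamma> (\<gamma> v) = v"
  using permutes_inverses[OF autosD(1)[OF assms]] by auto

lemma auto_act:
  assumes g: "(\<gamma>, \<sigma>) \<in> autos" and v: "v \<in> tv" and u: "set u \<subseteq> J"
  shows "\<gamma> (act u v) = act (map \<sigma> u) (\<gamma> v)"
  using u by (induction u) (simp_all add: autosD(3)[OF g] v)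

lemma auto_comp:
  assumes g: "(\<gamma>, \<sigma>) \<in> autos" and h: "(\<delta>, \<tau>) \<in> autos"
  shows "(\<gamma> \<circ> \<delta>, \<sigma> \<circ> \<tau>) \<in> autos"
  unfolding tree_automorphisms_def mem_Collect_eq case_prod_conv
proof (intro conjI ballI)
  show "\<gamma> \<circ> \<delta> permutes tv" using autosD(1)[OF h] autosD(1)[OF g] by (rule permutes_compose)
  show "\<sigma> \<circ> \<tau> \<in> perms" using autosD(2)[OF g] autosD(2)[OF h] by (rule perm_comp)
  fix v assume v: "v \<in> tv"
  then have d: "\<delta> v \<in> tv" using auto_tv[OF h] by simp
  show "(\<gamma> \<circ> \<delta>) (neighbour k v) = neighbour ((\<sigma> \<circ> \<tau>) k) ((\<gamma> \<circ> \<delta>) v)" if k: "k \<in> J" for k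
  proof -
    have "\<tau> k \<in> J" using k autosD(2)[OF h] by simp
    then show ?thesis using autosD(3)[OF g d] by (simp add: autosD(3)[OF h v k])
  qed
  show "M ((\<gamma> \<circ> \<delta>) v) = permute_matrix (\<sigma> \<circ> \<tau>) (M v)"
    using permute_matrix_comp[OF perm_bij[OF autosD(2)[OF g]] perm_bij[OF autosD(2)[OF h]], of "M v"]
    by (simp add: autosD(4)[OF g d] autosD(4)[OF h v])
qed

lemma auto_id: "(id, id) \<in> autos"
  unfolding tree_automorphisms_def mem_Collect_eq case_prod_conv
  by (intro conjI ballI permutes_id perm_id) simp_all

lemma auto_inv:
  assumes g: "(\<gamma>, \<sigma>) \<in> autos"
  shows "(pinv \<gamma>, pinv \<sigma>) \<in> autos"
  unfolding tree_automorphisms_def mem_Collect_eq case_prod_conv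
proof (intro conjI ballI)
  note s = autosD(2)[OF g]
  show "pinv \<gamma> permutes tv" using autosD(1)[OF g] by (rule permutes_inv)
  show "pinv \<sigma> \<in> perms" using s by (rule perm_inv)
  fix v assume v: "v \<in> tv"
  define v' where "v' = pinv \<gamma> v"
  have v': "\<gamma> v' = v" unfolding v'_def by (rule auto_inverses(1)[OF g])
  then have v'tv: "v' \<in> tv" using v auto_tv[OF g] by metis
  show "pinv \<gamma> (neighbour k v) = neighbour (pinv \<sigma> k) (pinv \<gamma> v)" if k: "k \<in> J" for k
  proof -
    have "pinv \<sigma> k \<in> J" using k s by simp
    from autosD(3)[OF g v'tv this] have "\<gamma> (neighbour (pinv \<sigma> k) v') = neighbour k v"
      unfolding v' perm_inv_apply(1)[OF s] .
    then show ?thesis using auto_inverses(2)[OF g] unfolding v'_def by metis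
  qed
  have "permute_matrix (pinv \<sigma>) (M v) = permute_matrix (pinv \<sigma> \<circ> \<sigma>) (M v')"
    unfolding v'[symmetric] autosD(4)[OF g v'tv]
    by (rule permute_matrix_comp[OF perm_bij[OF perm_inv[OF s]] perm_bij[OF s]])
  then show "M (pinv \<gamma> v) = permute_matrix (pinv \<sigma>) (M v)"
    unfolding perm_comp_inv(2)[OF s] permute_matrix_id v'_def by (rule sym)
qed

text \<open>The word that leads back from \<open>y\<close> to the base vertex and on to \<open>z\<close>.\<close>

lemma act_path:
  assumes "y \<in> tv" "z \<in> tv"
  shows "act (z @ rev y) y = z"
proof -
  have "act (rev y) y = act (rev y) (act y [])" using tree_vertD(1)[OF assms(1)] by simp
  also have "\<dots> = []" by simp
  finally show ?thesis using tree_vertD(1)[OF assms(2)] by (simp add: act_append)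
qed

text \<open>The tree is the Cayley graph of a free product of groups of order two, so an automorphism
  twisted by a permutation of the labels is determined by one value.\<close>

lemma equivariant_eq_id:
  assumes tv: "\<And>v. v \<in> tv \<Longrightarrow> h v \<in> tv"
    and eqv: "\<And>v k. v \<in> tv \<Longrightarrow> k \<in> J \<Longrightarrow> h (neighbour k v) = neighbour k (h v)"
    and y: "y \<in> tv" "h y = y" and z: "z \<in> tv"
  shows "h z = z"
proof -
  have act: "h (act u v) = act u (h v)" if "set u \<subseteq> J" "v \<in> tv" for u v
    using that by (induction u) (simp_all add: eqv)
  have u: "set (z @ rev y) \<subseteq> J" using y(1) z tree_vertD(2) by simp
  show ?thesis using act[OF u y(1)] unfolding y(2) act_path[OF y(1) z] .
qed

text \<open>The automorphism relabels the edge paths from the base vertex by \<open>\<tau>\<close>. Matrices need to be compared at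
  one vertex only, since both sides mutate in the same way along the edges.\<close>

lemma auto_exists:
  assumes y: "y \<in> tv" and \<tau>: "\<tau> \<in> perms" and M: "permute_matrix \<tau> (M y) = \<epsilon>"
  shows "\<exists>\<gamma>. (\<gamma>, \<tau>) \<in> autos \<and> \<gamma> y = []"
proof -
  (* The map that twists labels by the permutation and takes the base vertex to b. *)
  define f where "f \<sigma> b z = act (map \<sigma> z) b" for \<sigma> :: "'i \<Rightarrow> 'i" and b z
  have f_tv: "f \<sigma> b z \<in> tv" if "\<sigma> \<in> perms" "b \<in> tv" "z \<in> tv" for \<sigma> b z
    unfolding f_def using that tree_vertD(2)[OF that(3)] by (intro act_tree_vert) (auto simp: subset_iff)
  have f_nbr: "f \<sigma> b (neighbour k z) = neighbour (\<sigma> k) (f \<sigma> b z)"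
    if "\<sigma> \<in> perms" "b \<in> tv" "z \<in> tv" "k \<in> J" for \<sigma> b z k
  proof (cases "\<exists>z'. z = k # z'")
    case True
    then obtain z' where z': "z = k # z'" by blast
    have "distinct_adj (act (map \<sigma> z') b)" by (rule distinct_adj_act[OF tree_vertD(1)[OF that(2)]])
    then show ?thesis unfolding z' f_def by simp
  next
    case False
    then have "neighbour k z = k # z" by (cases z) auto
    then show ?thesis unfolding f_def by simp
  qed
  (* This choice of b makes the image of y the base vertex. *)
  define b where "b = act (rev (map \<tau> y)) []"
  have ys: "set y \<subseteq> J" by (rule tree_vertD(2)[OF y])
  have b: "b \<in> tv" unfolding b_def using \<tau> ys by (intro act_tree_vert) (auto simp: subset_iff)
  have \<tau>': "pinv \<tau> \<in> perms" using \<tau> by (rule perm_inv)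
  have fby: "f \<tau> b y = []" unfolding f_def b_def by (rule act_act_rev) simp
  have gf: "f (pinv \<tau>) y (f \<tau> b z) = z" if z: "z \<in> tv" for z
  proof (rule equivariant_eq_id[OF _ _ y _ z])
    show "f (pinv \<tau>) y (f \<tau> b y) = y" unfolding fby by (simp add: f_def)
    show "f (pinv \<tau>) y (f \<tau> b v) \<in> tv" if "v \<in> tv" for v
      by (intro f_tv \<tau> \<tau>' b y that)
    show "f (pinv \<tau>) y (f \<tau> b (neighbour k v)) = neighbour k (f (pinv \<tau>) y (f \<tau> b v))"
      if "v \<in> tv" "k \<in> J" for v k
    proof -
      have "\<tau> k \<in> J" using that(2) \<tau> by simp
      then show ?thesis
        using f_nbr[OF \<tau>' y f_tv[OF \<tau> b that(1)], of "\<tau> k"] f_nbr[OF \<tau> b that] \<tau>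
        by simp
    qed
  qed
  have fg: "f \<tau> b (f (pinv \<tau>) y z) = z" if z: "z \<in> tv" for z
  proof (rule equivariant_eq_id[OF _ _ Nil_tree_vert _ z])
    show "f \<tau> b (f (pinv \<tau>) y []) = []" using fby by (simp add: f_def)
    show "f \<tau> b (f (pinv \<tau>) y v) \<in> tv" if "v \<in> tv" for v
      by (intro f_tv \<tau> \<tau>' b y that)
    show "f \<tau> b (f (pinv \<tau>) y (neighbour k v)) = neighbour k (f \<tau> b (f (pinv \<tau>) y v))"
      if "v \<in> tv" "k \<in> J" for v k
    proof -
      have "pinv \<tau> k \<in> J" using that(2) \<tau>' by simp
      then show ?thesis
        using f_nbr[OF \<tau> b f_tv[OF \<tau>' y that(1)], of "pinv \<tau> k"] f_nbr[OF \<tau>' y that] \<tau>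
        by simp
    qed
  qed
  define \<gamma> where "\<gamma> z = (if z \<in> tv then f \<tau> b z else z)" for z
  have bij: "bij_betw \<gamma> tv tv"
    by (rule bij_betw_byWitness[where f' = "f (pinv \<tau>) y"])
      (use gf fg f_tv[OF \<tau> b] f_tv[OF \<tau>' y] in \<open>auto simp: \<gamma>_def\<close>)
  have M': "M (f \<tau> b z) = permute_matrix \<tau> (M z)" if z: "z \<in> tv" for z
  proof -
    have "M (f \<tau> b (act u y)) = permute_matrix \<tau> (M (act u y))" if "set u \<subseteq> J" for u
      using that
    proof (induction u)
      case Nil
      show ?case unfolding act_simps fby M by (simp add: matrix_at_def)
    next
      case (Cons k u)
      then have k: "k \<in> J" and u: "set u \<subseteq> J" by simp_all
      note uy = act_tree_vert[OF y u]
      show ?case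
        unfolding act_simps f_nbr[OF \<tau> b uy k] matrix_at_neighbour Cons.IH[OF u]
          mutate_permute_matrix[OF perm_bij[OF \<tau>]] perm_inv_apply(2)[OF \<tau>] ..
    qed
    note acts = this
    have u: "set (z @ rev y) \<subseteq> J" using ys tree_vertD(2)[OF z] by simp
    show ?thesis using acts[OF u] unfolding act_path[OF y z] .
  qed
  have "(\<gamma>, \<tau>) \<in> autos"
    unfolding tree_automorphisms_def mem_Collect_eq case_prod_conv
  proof (intro conjI ballI)
    show "\<gamma> permutes tv" using bij by (rule bij_imp_permutes) (simp add: \<gamma>_def)
    show "\<tau> \<in> perms" by (rule \<tau>)
    show "\<gamma> (neighbour k v) = neighbour (\<tau> k) (\<gamma> v)" if "v \<in> tv" "k \<in> J" for v k
      using f_nbr[OF \<tau> b that] neighbour_tree_vert[OF that] that(1) by (simp add: \<gamma>_def)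
    show "M (\<gamma> v) = permute_matrix \<tau> (M v)" if "v \<in> tv" for v
      using M'[OF that] that by (simp add: \<gamma>_def)
  qed
  moreover have "\<gamma> y = []" using fby y by (simp add: \<gamma>_def)
  ultimately show ?thesis by blast
qed

lemma end_state_normal_form_start:
  assumes "y \<in> tv"
  shows "end_state (normal_form (y, \<sigma>)) ([], id) = (y, \<sigma>)"
proof -
  have "map (pinv id) y = y" by (simp add: inv_id)
  then show ?thesis
    using end_state_normal_form[OF perm_id, of y \<sigma> "[]"] act_Nil[OF tree_vertD(1)[OF assms]] by simp
qed

lemma normal_form_seqs: "y \<in> tv \<Longrightarrow> \<sigma> \<in> perms \<Longrightarrow> normal_form (y, \<sigma>) \<in> seqs"
  using tree_vertD(2) by (simp add: normal_form_def)

lemma auto_normal_form: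
  assumes g: "(\<gamma>, \<sigma>) \<in> autos"
  shows "pinv \<gamma> [] \<in> tv" "normal_form (pinv \<gamma> [], \<sigma>) \<in> seqs"
    "seq_act (normal_form (pinv \<gamma> [], \<sigma>)) \<epsilon> = \<epsilon>"
proof -
  show y: "pinv \<gamma> [] \<in> tv" using auto_tv[OF auto_inv[OF g]] by simp
  show w: "normal_form (pinv \<gamma> [], \<sigma>) \<in> seqs" by (rule normal_form_seqs[OF y autosD(2)[OF g]])
  have "seq_act (normal_form (pinv \<gamma> [], \<sigma>)) \<epsilon> = permute_matrix \<sigma> (M (pinv \<gamma> []))"
    by (rule seq_act_start[OF w end_state_normal_form_start[OF y]])
  also have "\<dots> = M (\<gamma> (pinv \<gamma> []))" by (rule autosD(4)[OF g y, symmetric])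
  also have "\<dots> = \<epsilon>" unfolding auto_inverses(1)[OF g] by (simp add: matrix_at_def)
  finally show "seq_act (normal_form (pinv \<gamma> [], \<sigma>)) \<epsilon> = \<epsilon>" .
qed

lemma loop_equiv_image_eq_iff:
  assumes "x \<in> mutation_loops I I0 \<epsilon>" "y \<in> mutation_loops I I0 \<epsilon>"
  shows "loop_equiv I I0 \<epsilon> `` {x} = loop_equiv I I0 \<epsilon> `` {y} \<longleftrightarrow> word_equiv x y"
proof
  assume "loop_equiv I I0 \<epsilon> `` {x} = loop_equiv I I0 \<epsilon> `` {y}"
  moreover have "y \<in> loop_equiv I I0 \<epsilon> `` {y}" using assms(2) by (simp add: loop_equiv_def)
  ultimately show "word_equiv x y" unfolding loop_equiv_def by blast
next
  assume xy: "word_equiv x y"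
  have "word_equiv x z \<longleftrightarrow> word_equiv y z" for z
    by (rule iffI; erule equivclp_trans[OF equivclp_sym[OF xy]] equivclp_trans[OF xy])
  then show "loop_equiv I I0 \<epsilon> `` {x} = loop_equiv I I0 \<epsilon> `` {y}"
    using assms unfolding loop_equiv_def by (simp add: Image_def)
qed

text \<open>For a loop, equality of classes in the saturated group is equivalence of words.\<close>

lemma ker_Phi_iff:
  "(\<gamma>, \<sigma>) \<in> N \<longleftrightarrow> (\<gamma>, \<sigma>) \<in> autos \<and> word_equiv (normal_form (pinv \<gamma> [], \<sigma>)) []"
proof -
  have "(\<gamma>, \<sigma>) \<in> N \<longleftrightarrow> (\<gamma>, \<sigma>) \<in> autos \<and>
      loop_equiv I I0 \<epsilon> `` {normal_form (pinv \<gamma> [], \<sigma>)} = loop_equiv I I0 \<epsilon> `` {[]}"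
    by (simp add: ker_Phi_def kernel_def tree_group_def saturated_group_def Phi_def normal_form_def)
  also have "\<dots> \<longleftrightarrow> (\<gamma>, \<sigma>) \<in> autos \<and> word_equiv (normal_form (pinv \<gamma> [], \<sigma>)) []"
  proof (intro conj_cong refl loop_equiv_image_eq_iff)
    assume g: "(\<gamma>, \<sigma>) \<in> autos"
    show "normal_form (pinv \<gamma> [], \<sigma>) \<in> mutation_loops I I0 \<epsilon>"
      using auto_normal_form(2,3)[OF g] by (simp add: mutation_loops_def)
    show "[] \<in> mutation_loops I I0 \<epsilon>" by (simp add: mutation_loops_def)
  qed
  finally show ?thesis .
qed

lemma N_autos: "(\<gamma>, \<sigma>) \<in> N \<Longrightarrow> (\<gamma>, \<sigma>) \<in> autos"
  by (simp add: ker_Phi_iff)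

lemma N_id: "(id, id) \<in> N"
proof -
  have "word_equiv (normal_form ([], id)) []"
    by (rule word_equiv_if_same_end_state)
      (simp_all only: end_state_normal_form_start[OF Nil_tree_vert] end_state_simps
        normal_form_seqs[OF Nil_tree_vert perm_id] seqs_simps)
  then show ?thesis unfolding ker_Phi_iff inv_id using auto_id by simp
qed

text \<open>The word of a product of automorphisms has the same final state as the concatenation of their words,
  so it is equivalent to that concatenation.\<close>

lemma N_comp:
  assumes g: "(\<gamma>, \<sigma>) \<in> N" and h: "(\<delta>, \<tau>) \<in> N"
  shows "(\<gamma> \<circ> \<delta>, \<sigma> \<circ> \<tau>) \<in> N"
proof -
  note ga = N_autos[OF g] and ha = N_autos[OF h]
  note gh = auto_comp[OF ga ha]
  let ?y = "pinv \<gamma> []" and ?z = "pinv \<delta> []"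
  note y = auto_normal_form[OF ga] and z = auto_normal_form[OF ha]
  let ?w = "normal_form (?y, \<sigma>) @ normal_form (?z, \<tau>)"
  have "pinv (\<gamma> \<circ> \<delta>) [] = pinv \<delta> (act ?y [])"
    using o_inv_distrib[OF permutes_bij[OF autosD(1)[OF ga]] permutes_bij[OF autosD(1)[OF ha]]]
      act_Nil[OF tree_vertD(1)[OF y(1)]] by simp
  also have "\<dots> = act (map (pinv \<tau>) ?y) ?z"
    by (rule auto_act[OF auto_inv[OF ha] Nil_tree_vert tree_vertD(2)[OF y(1)]])
  finally have e: "end_state ?w ([], id) = (pinv (\<gamma> \<circ> \<delta>) [], \<sigma> \<circ> \<tau>)"
    unfolding end_state_simps end_state_normal_form_start[OF z(1)]
      end_state_normal_form[OF autosD(2)[OF ha]] by simp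
  have w: "?w \<in> seqs" using y(2) z(2) by simp
  have "word_equiv ?w (normal_form (?y, \<sigma>) @ [])"
    by (rule word_equiv_left[OF _ y(2)]) (use h in \<open>simp add: ker_Phi_iff\<close>)
  also have "word_equiv \<dots> []" using g by (simp add: ker_Phi_iff)
  finally have 1: "word_equiv ?w []" .
  have 2: "word_equiv ?w (normal_form (pinv (\<gamma> \<circ> \<delta>) [], \<sigma> \<circ> \<tau>))"
    using word_equiv_normal_form[OF w] unfolding e .
  show ?thesis
    unfolding ker_Phi_iff by (rule conjI[OF gh equivclp_trans[OF equivclp_sym[OF 2] 1]])
qed

lemma N_inv:
  assumes g: "(\<gamma>, \<sigma>) \<in> N"
  shows "(pinv \<gamma>, pinv \<sigma>) \<in> N"
proof -
  note ga = N_autos[OF g]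
  note gi = auto_inv[OF ga]
  let ?y = "pinv \<gamma> []"
  note y = auto_normal_form[OF ga] and z = auto_normal_form[OF gi]
  have pp: "pinv (pinv \<gamma>) = \<gamma>" by (rule inv_inv_eq[OF permutes_bij[OF autosD(1)[OF ga]]])
  let ?w = "normal_form (\<gamma> [], pinv \<sigma>) @ normal_form (?y, \<sigma>)"
  have gtv: "\<gamma> [] \<in> tv" using auto_tv[OF ga] by simp
  have "act (map (pinv \<sigma>) (\<gamma> [])) ?y = pinv \<gamma> (act (\<gamma> []) [])"
    by (rule auto_act[OF gi Nil_tree_vert tree_vertD(2)[OF gtv], symmetric])
  also have "\<dots> = []" unfolding act_Nil[OF tree_vertD(1)[OF gtv]] by (rule auto_inverses(2)[OF ga])
  finally have a: "act (map (pinv \<sigma>) (\<gamma> [])) ?y = []" .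
  have "end_state ?w ([], id) =
      end_state (normal_form (\<gamma> [], pinv \<sigma>)) (end_state (normal_form (?y, \<sigma>)) ([], id))"
    by (rule end_state_simps(3))
  also have "\<dots> = end_state (normal_form (\<gamma> [], pinv \<sigma>)) (?y, \<sigma>)"
    by (simp only: end_state_normal_form_start[OF y(1)])
  also have "\<dots> = (act (map (pinv \<sigma>) (\<gamma> [])) ?y, pinv \<sigma> \<circ> \<sigma>)"
    by (rule end_state_normal_form[OF autosD(2)[OF ga]])
  also have "\<dots> = ([], id)" by (simp only: a perm_comp_inv(2)[OF autosD(2)[OF ga]])
  finally have e: "end_state ?w ([], id) = ([], id)" .
  have w: "?w \<in> seqs" using y(2) z(2) unfolding pp by simp
  have 1: "word_equiv ?w []"
  proof (rule word_equiv_if_same_end_state[OF w])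
    show "end_state ?w ([], id) = end_state [] ([], id)" unfolding e end_state_simps(1) ..
  qed simp
  have 2: "word_equiv ?w (normal_form (\<gamma> [], pinv \<sigma>) @ [])"
    by (rule word_equiv_left) (use g z(2) pp in \<open>simp_all add: ker_Phi_iff\<close>)
  have "word_equiv (normal_form (\<gamma> [], pinv \<sigma>)) []"
    using equivclp_trans[OF equivclp_sym[OF 2] 1] by simp
  then show ?thesis using gi unfolding ker_Phi_iff pp by simp
qed

section \<open>Orbits\<close>

abbreviation "vorb \<equiv> vert_orbit N"
abbreviation "eorb \<equiv> edge_orbit N"

lemma vorb_eq:
  assumes g: "(\<gamma>, \<sigma>) \<in> N"
  shows "vorb (\<gamma> v) = vorb v"
proof (intro equalityI subsetI)
  fix x assume "x \<in> vorb (\<gamma> v)"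
  then obtain \<delta> \<tau> where d: "(\<delta>, \<tau>) \<in> N" "x = (\<delta> \<circ> \<gamma>) v" unfolding vert_orbit_def by auto
  show "x \<in> vorb v" unfolding vert_orbit_def d(2) using N_comp[OF d(1) g] by (rule rev_image_eqI) simp
next
  fix x assume "x \<in> vorb v"
  then obtain \<delta> \<tau> where d: "(\<delta>, \<tau>) \<in> N" "x = \<delta> v" unfolding vert_orbit_def by auto
  have "x = (\<delta> \<circ> pinv \<gamma>) (\<gamma> v)" using d(2) auto_inverses(2)[OF N_autos[OF g]] by simp
  then show "x \<in> vorb (\<gamma> v)"
    unfolding vert_orbit_def by (intro rev_image_eqI[OF N_comp[OF d(1) N_inv[OF g]]]) (simp only: case_prod_conv)
qed

lemma eorb_eq:
  assumes g: "(\<gamma>, \<sigma>) \<in> N"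
  shows "eorb (\<gamma> v, \<sigma> k) = eorb (v, k)"
proof (intro equalityI subsetI)
  fix x assume "x \<in> eorb (\<gamma> v, \<sigma> k)"
  then obtain \<delta> \<tau> where d: "(\<delta>, \<tau>) \<in> N" "x = ((\<delta> \<circ> \<gamma>) v, (\<tau> \<circ> \<sigma>) k)" unfolding edge_orbit_def by auto
  show "x \<in> eorb (v, k)" unfolding edge_orbit_def d(2) using N_comp[OF d(1) g] by (rule rev_image_eqI) simp
next
  fix x assume "x \<in> eorb (v, k)"
  then obtain \<delta> \<tau> where d: "(\<delta>, \<tau>) \<in> N" "x = (\<delta> v, \<tau> k)" unfolding edge_orbit_def by auto
  have "x = ((\<delta> \<circ> pinv \<gamma>) (\<gamma> v), (\<tau> \<circ> pinv \<sigma>) (\<sigma> k))"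
    using d(2) auto_inverses(2)[OF N_autos[OF g]] autosD(2)[OF N_autos[OF g]] by simp
  then show "x \<in> eorb (\<gamma> v, \<sigma> k)"
    unfolding edge_orbit_def
    by (intro rev_image_eqI[OF N_comp[OF d(1) N_inv[OF g]]]) (simp only: case_prod_conv fst_conv snd_conv)
qed

lemma vorb_self: "v \<in> vorb v"
  unfolding vert_orbit_def using N_id by (rule rev_image_eqI) simp

lemma vorb_eqD:
  assumes "vorb v = vorb w"
  shows "\<exists>\<gamma> \<sigma>. (\<gamma>, \<sigma>) \<in> N \<and> w = \<gamma> v"
proof -
  have "w \<in> vorb v" unfolding assms by (rule vorb_self)
  then show ?thesis unfolding vert_orbit_def by auto
qed

abbreviation "K \<equiv> modular_2_complex I I0 \<epsilon>"

lemma K_simps: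
  "verts K = vorb ` tv" "edges K = eorb ` (tv \<times> J)" "origin K E = fst ` E"
  "reversal K E = (\<lambda>(v, k). (neighbour k v, k)) ` E"
  "boundary K c = (SOME w. w \<in> c)"
  "faces K = (\<lambda>w. {rotate m u | m u. u \<in> {map eorb w, rev (map (reversal K) (map eorb w))}}) `
    standard_walks I I0 \<epsilon>"
  by (simp_all add: modular_2_complex_def saturated_exchange_graph_def Let_def labelled_tree_def
      graph.defs cycle_of_def)

lemma origin_eorb: "origin K (eorb (v, k)) = vorb v"
  unfolding K_simps edge_orbit_def vert_orbit_def image_image by (rule image_cong) auto

lemma reversal_eorb:
  assumes "v \<in> tv" "k \<in> J"
  shows "reversal K (eorb (v, k)) = eorb (neighbour k v, k)"
  unfolding K_simps edge_orbit_def image_image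
proof (rule image_cong[OF refl])
  fix g assume g: "g \<in> N"
  obtain \<gamma> \<sigma> where gs: "g = (\<gamma>, \<sigma>)" by (cases g)
  show "(case case g of (\<gamma>, \<sigma>) \<Rightarrow> (\<gamma> (fst (v, k)), \<sigma> (snd (v, k))) of (v, k) \<Rightarrow> (neighbour k v, k)) =
      (case g of (\<gamma>, \<sigma>) \<Rightarrow> (\<gamma> (fst (neighbour k v, k)), \<sigma> (snd (neighbour k v, k))))"
    using autosD(3)[OF N_autos[OF g[unfolded gs]] assms] unfolding gs by simp
qed

lemma eorb_edge [simp]: "v \<in> tv \<Longrightarrow> k \<in> J \<Longrightarrow> eorb (v, k) \<in> edges K"
  by (simp add: K_simps)

lemma vorb_vert [simp]: "v \<in> tv \<Longrightarrow> vorb v \<in> verts K"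
  by (simp add: K_simps)

lemma edgeE:
  assumes "e \<in> edges K"
  obtains v k where "v \<in> tv" "k \<in> J" "e = eorb (v, k)" "origin K e = vorb v"
    "reversal K e = eorb (neighbour k v, k)" "origin K (reversal K e) = vorb (neighbour k v)"
proof -
  obtain x where x: "x \<in> tv \<times> J" "e = eorb x" using assms unfolding K_simps by (rule imageE)
  obtain v k where vk: "x = (v, k)" by (cases x)
  have "v \<in> tv" "k \<in> J" using x(1) unfolding vk by simp_all
  then show thesis using that[of v k] reversal_eorb[of v k] origin_eorb unfolding x(2) vk by simp
qed

section \<open>The walk traced by a mutation sequence in the exchange graph\<close>

text \<open>Permutations traverse no edge.\<close>

fun trace :: "'i step list \<Rightarrow> 'i list \<times> ('i \<Rightarrow> 'i) \<Rightarrow> ('i list \<times> 'i) set list" where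
  "trace [] s = []"
| "trace (Mut k # w) s = trace w s @ [eorb (fst (end_state w s), pinv (snd (end_state w s)) k)]"
| "trace (Perm \<sigma> # w) s = trace w s"

lemma trace_append: "trace (u @ w) s = trace w s @ trace u (end_state w s)"
proof (induction u)
  case (Cons x u)
  then show ?case by (cases x) simp_all
qed simp

lemma trace_walk:
  assumes "s \<in> states" "w \<in> seqs"
  shows "edge_walk K (vorb (fst s)) (trace w s) (vorb (fst (end_state w s)))"
  using assms(2)
proof (induction w)
  case Nil
  then show ?case using assms(1) by (cases s) simp
next
  case (Cons x w)
  then have x: "[x] \<in> seqs" "w \<in> seqs" by (cases x; simp)+
  obtain v \<tau> where s: "end_state w s = (v, \<tau>)" by (cases "end_state w s")
  have v: "v \<in> tv" "\<tau> \<in> perms" using end_state_states[OF assms(1) x(2)] s by auto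
  note IH = Cons.IH[OF x(2)]
  show ?case
  proof (cases x)
    case (Mut k)
    then have k: "pinv \<tau> k \<in> J" using x v by simp
    have w: "edge_walk K (vorb v) [eorb (v, pinv \<tau> k)] (vorb (neighbour (pinv \<tau> k) v))"
      using v k reversal_eorb[OF v(1) k] origin_eorb by simp
    show ?thesis using edge_walk_append[OF IH[unfolded s fst_conv] w] s Mut by simp
  next
    case (Perm \<sigma>)
    then show ?thesis using IH s by simp
  qed
qed

text \<open>An element of the kernel moves the tree vertex and renames the labels of the tree; the permutation of
  the state compensates for the renaming.\<close>

definition state_equiv :: "'i list \<times> ('i \<Rightarrow> 'i) \<Rightarrow> 'i list \<times> ('i \<Rightarrow> 'i) \<Rightarrow> bool" where
  "state_equiv s s' \<longleftrightarrow> (\<exists>\<gamma> \<rho>. (\<gamma>, \<rho>) \<in> N \<and> \<gamma> (fst s) = fst s' \<and> snd s = snd s' \<circ> \<rho>)"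

text \<open>From equivalent states, a mutation sequence crosses edges of the tree that correspond under the
  same element of the kernel, and these have the same image in the quotient.\<close>

lemma trace_cong:
  assumes st: "s \<in> states" "s' \<in> states" and eq: "state_equiv s s'" and u: "u \<in> seqs"
  shows "trace u s = trace u s'"
proof -
  obtain \<gamma> \<rho> where g: "(\<gamma>, \<rho>) \<in> N" "\<gamma> (fst s) = fst s'" "snd s = snd s' \<circ> \<rho>"
    using eq unfolding state_equiv_def by (elim exE conjE)
  have "trace u s = trace u s' \<and> \<gamma> (fst (end_state u s)) = fst (end_state u s') \<and>
    snd (end_state u s) = snd (end_state u s') \<circ> \<rho>"
    using u
  proof (induction u)
    case Nil
    show ?case using g by simp
  next
    case (Cons x u)
    then have x: "[x] \<in> seqs" "u \<in> seqs" by (cases x; simp)+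
    obtain v \<tau> where s: "end_state u s = (v, \<tau>)" by (cases "end_state u s")
    obtain v' \<tau>' where s': "end_state u s' = (v', \<tau>')" by (cases "end_state u s'")
    have v: "v \<in> tv" "\<tau> \<in> perms" "v' \<in> tv" "\<tau>' \<in> perms"
      using end_state_states[OF st(1) x(2)] end_state_states[OF st(2) x(2)] s s' by auto
    note IH' = Cons.IH[OF x(2), unfolded s s' fst_conv snd_conv]
    note IH = IH'[THEN conjunct1] IH'[THEN conjunct2, THEN conjunct1] IH'[THEN conjunct2, THEN conjunct2]
    show ?case
    proof (cases x)
      case (Mut k)
      then have k: "k \<in> J" "pinv \<tau> k \<in> J" using x v by auto
      have "\<tau>' (\<rho> (pinv \<tau> k)) = k"
        using perm_inv_apply(1)[OF v(2), of k] IH(3) by simp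
      then have r: "\<rho> (pinv \<tau> k) = pinv \<tau>' k" using perm_inv_apply(2)[OF v(4)] by metis
      have "\<gamma> (neighbour (pinv \<tau> k) v) = neighbour (pinv \<tau>' k) v'"
        using autosD(3)[OF N_autos[OF g(1)] v(1) k(2)] unfolding r IH(2) .
      moreover have "eorb (v, pinv \<tau> k) = eorb (v', pinv \<tau>' k)"
        using eorb_eq[OF g(1), of v "pinv \<tau> k"] unfolding r IH(2) by (rule sym)
      ultimately show ?thesis using IH(1,3) unfolding Mut by (simp add: s s')
    next
      case (Perm \<sigma>)
      then show ?thesis using IH by (simp add: s s' comp_assoc)
    qed
  qed
  then show ?thesis by (rule conjunct1)
qed


section \<open>Standard sequences close up in the exchange graph\<close>

fun alternate :: "'i \<Rightarrow> 'i \<Rightarrow> nat \<Rightarrow> 'i list" where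
  "alternate a b 0 = []"
| "alternate a b (Suc n) = a # alternate b a n"

lemma alternate_eq: "map (\<lambda>m. if even m then a else b) [0..<n] = alternate a b n"
proof (induction n arbitrary: a b)
  case (Suc n)
  have f: "map (\<lambda>i. if even (Suc i) then a else b) [0..<n] = map (\<lambda>i. if even i then b else a) [0..<n]"
    by (rule map_cong) auto
  show ?case unfolding map_upt_Suc f Suc by simp
qed simp

definition swap_word :: "'i \<Rightarrow> 'i \<Rightarrow> 'i \<Rightarrow> nat \<Rightarrow> 'i step list" where
  "swap_word i j k n = concat (replicate n [Perm (Transposition.transpose i j), Mut k])"

lemma standard_seq_eq: "standard_seq h i j k = swap_word i j k (h + 2)"
  unfolding standard_seq_def swap_word_def ..

text \<open>The accumulated transpositions turn mutations at the same label \<open>k\<close> into crossings of edges of the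
  tree with alternating labels.\<close>

lemma swap_word_state:
  assumes \<tau>: "\<tau> \<in> perms" and ij: "i \<in> J" "j \<in> J"
  defines "t \<equiv> Transposition.transpose i j"
  shows "trace (swap_word i j k n) (v, \<tau>) =
      map eorb (tree_walk v (alternate (pinv \<tau> k) (pinv \<tau> (t k)) n))"
    and "end_state (swap_word i j k n) (v, \<tau>) =
      (fold neighbour (alternate (pinv \<tau> k) (pinv \<tau> (t k)) n) v, (t ^^ n) \<circ> \<tau>)"
proof -
  have t: "t \<in> perms" unfolding t_def by (rule transpose_perm[OF ij])
  have tt: "t (t x) = x" for x by (simp add: t_def)
  have w_Suc: "swap_word i j k (Suc n) = swap_word i j k n @ [Perm t, Mut k]" for n
    unfolding swap_word_def t_def replicate_Suc replicate_append_same[symmetric] by simp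
  have "trace (swap_word i j k n) (v, \<tau>) = map eorb (tree_walk v (alternate (pinv \<tau> k) (pinv \<tau> (t k)) n)) \<and>
    end_state (swap_word i j k n) (v, \<tau>) =
      (fold neighbour (alternate (pinv \<tau> k) (pinv \<tau> (t k)) n) v, (t ^^ n) \<circ> \<tau>)"
    using \<tau>
  proof (induction n arbitrary: v \<tau>)
    case 0
    show ?case by (simp add: swap_word_def)
  next
    case (Suc n)
    have p: "pinv (t \<circ> \<tau>) x = pinv \<tau> (t x)" for x
    proof -
      have "pinv t = t" unfolding t_def by simp
      then show ?thesis
        using o_inv_distrib[OF perm_bij[OF t] perm_bij[OF Suc.prems]] by simp
    qed
    have e: "end_state [Perm t, Mut k] (v, \<tau>) = (neighbour (pinv \<tau> k) v, t \<circ> \<tau>)" by simp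
    have f: "(t ^^ n) \<circ> (t \<circ> \<tau>) = (t ^^ Suc n) \<circ> \<tau>"
      unfolding funpow_Suc_right comp_assoc ..
    have "trace (swap_word i j k (Suc n)) (v, \<tau>) = eorb (v, pinv \<tau> k) # trace (swap_word i j k n) (neighbour (pinv \<tau> k) v, t \<circ> \<tau>)"
      unfolding w_Suc trace_append e by simp
    moreover have "end_state (swap_word i j k (Suc n)) (v, \<tau>) = end_state (swap_word i j k n) (neighbour (pinv \<tau> k) v, t \<circ> \<tau>)"
      unfolding w_Suc end_state_simps(3) e ..
    ultimately show ?case
      using Suc.IH[OF perm_comp[OF t Suc.prems], of "neighbour (pinv \<tau> k) v"]
      unfolding p tt f by (simp del: funpow.simps)
  qed
  then show "trace (swap_word i j k n) (v, \<tau>) = map eorb (tree_walk v (alternate (pinv \<tau> k) (pinv \<tau> (t k)) n))"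
    "end_state (swap_word i j k n) (v, \<tau>) =
      (fold neighbour (alternate (pinv \<tau> k) (pinv \<tau> (t k)) n) v, (t ^^ n) \<circ> \<tau>)"
    by (rule conjunct1, rule conjunct2)
qed

lemma seq_act_map_Mut: "seq_act (map Mut u) A = foldr mutate u A"
  by (induction u) simp_all

lemma foldr_mutate_rev: "foldr mutate (rev u) (foldr mutate u A) = A"
  by (induction u) simp_all

lemma pinv_id: "pinv id x = x"
  by (simp add: inv_id)

text \<open>Conjugated by the edge path from the base vertex to \<open>v\<close>, the standard sequence becomes a mutation loop at
  \<open>\<epsilon>\<close>, and the standard relation makes its class trivial. The corresponding tree automorphism therefore
  lies in the kernel, and it takes the end of the alternating walk back to \<open>v\<close>.\<close>

lemma standard_kernel_element:
  assumes v: "v \<in> tv" and pair: "standard_pair I I0 (M v) h i j" and k: "k \<in> {i, j}"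
  defines "t \<equiv> Transposition.transpose i j"
  shows "\<exists>\<gamma>. (\<gamma>, t ^^ (h + 2)) \<in> N \<and> \<gamma> (fold neighbour (alternate k (t k) (h + 2)) v) = v"
proof -
  have ij: "i \<in> J" "j \<in> J" using pair unfolding standard_pair_def by simp_all
  have kJ: "k \<in> J" "t k \<in> J" using ij k by (auto simp: t_def)
  have vs: "set v \<subseteq> J" by (rule tree_vertD(2)[OF v])
  let ?s = "standard_seq h i j k"
  define v' where "v' = fold neighbour (alternate k (t k) (h + 2)) v"
  define \<sigma> where "\<sigma> = t ^^ (h + 2)"
  let ?w = "map Mut (rev v) @ ?s @ map Mut v"
  have s: "?s \<in> seqs" by (rule standard_seq_seqs[OF ij k])
  have w: "?w \<in> seqs" using s vs by simp
  have e1: "end_state (map Mut v) ([], id) = (v, id)"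
    using end_state_map_Mut[OF perm_id, of v "[]"] act_Nil[OF tree_vertD(1)[OF v]] by (simp add: pinv_id)
  have e2: "end_state ?s (v, id) = (v', \<sigma>)"
    using swap_word_state(2)[OF perm_id ij, of k "h + 2" v]
    unfolding standard_seq_eq v'_def \<sigma>_def t_def pinv_id comp_id .
  have \<sigma>: "\<sigma> \<in> perms" and v': "v' \<in> tv"
    using end_state_states[of "(v, id)" ?s] s v perm_id unfolding e2 by simp_all
  define y where "y = act (map (pinv \<sigma>) (rev v)) v'"
  have e: "end_state ?w ([], id) = (y, \<sigma>)"
    unfolding end_state_simps(3) e1 e2 end_state_map_Mut[OF \<sigma>] y_def ..
  have Mv: "seq_act (map Mut v) \<epsilon> = M v" by (simp add: seq_act_map_Mut matrix_at_def)
  have skew: "skew_symmetrizable I (M v)" by (rule skew_matrix_at) (use vs in blast)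
  have "seq_act ?w \<epsilon> = \<epsilon>"
    unfolding seq_act_append Mv seq_act_standard_seq[OF pair skew k]
    by (simp add: seq_act_map_Mut matrix_at_def foldr_mutate_rev)
  then have "permute_matrix \<sigma> (M y) = \<epsilon>" using seq_act_start[OF w e] by simp
  moreover have y: "y \<in> tv" using end_state_states[of "([], id)" ?w] w e perm_id by simp
  ultimately obtain \<gamma> where g: "(\<gamma>, \<sigma>) \<in> autos" "\<gamma> y = []" using auto_exists[OF _ \<sigma>] by blast
  have py: "pinv \<gamma> [] = y" using auto_inverses(2)[OF g(1), of y] g(2) by simp
  have "word_equiv (normal_form (y, \<sigma>)) ?w"
    using equivclp_sym[OF word_equiv_normal_form[OF w]] unfolding e .
  also have "word_equiv ?w (map Mut (rev v) @ [] @ map Mut v)"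
    using vs by (intro word_equiv_basic) (simp_all add: Mv basic_rel.standard[OF pair k])
  also have "word_equiv \<dots> []"
  proof (rule word_equiv_if_same_end_state)
    show "end_state (map Mut (rev v) @ [] @ map Mut v) ([], id) = end_state [] ([], id)"
      unfolding append_Nil end_state_simps(1,3) e1 end_state_map_Mut[OF perm_id]
      using act_rev_act[of "[]" v] act_Nil[OF tree_vertD(1)[OF v]] by (simp add: inv_id)
  qed (use vs in simp_all)
  finally have N: "(\<gamma>, \<sigma>) \<in> N" using g(1) unfolding ker_Phi_iff py by simp
  have "\<gamma> y = act (map \<sigma> (map (pinv \<sigma>) (rev v))) (\<gamma> v')"
    unfolding y_def using \<sigma> vs by (intro auto_act[OF g(1) v']) (auto simp: subset_iff)
  also have "map \<sigma> (map (pinv \<sigma>) (rev v)) = rev v" using \<sigma> by (simp add: map_idI)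
  finally have r: "act (rev v) (\<gamma> v') = []" using g(2) by simp
  have "\<gamma> v' \<in> tv" using auto_tv[OF g(1)] v' by simp
  then have "\<gamma> v' = act v (act (rev v) (\<gamma> v'))" using tree_vertD(1) by simp
  also have "\<dots> = v" unfolding r by (rule act_Nil[OF tree_vertD(1)[OF v]])
  finally show ?thesis using N unfolding v'_def \<sigma>_def by blast
qed

lemma standard_walk_closed:
  assumes v: "v \<in> tv" and pair: "standard_pair I I0 (M v) h i j" and ab: "(a, b) \<in> {(i, j), (j, i)}"
  shows "edge_walk K (vorb v) (map eorb (tree_walk v (alternate a b (h + 2)))) (vorb v)"
proof -
  have ij: "i \<in> J" "j \<in> J" using pair unfolding standard_pair_def by simp_all
  have a: "a \<in> {i, j}" and b: "b = Transposition.transpose i j a" using ab by auto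
  obtain \<gamma> where g: "(\<gamma>, Transposition.transpose i j ^^ (h + 2)) \<in> N"
    "\<gamma> (fold neighbour (alternate a b (h + 2)) v) = v"
    using standard_kernel_element[OF v pair a] unfolding b by blast
  note st = swap_word_state[OF perm_id ij, of a "h + 2" v, folded standard_seq_eq, unfolded pinv_id, folded b]
  have "edge_walk K (vorb v) (map eorb (tree_walk v (alternate a b (h + 2))))
      (vorb (fold neighbour (alternate a b (h + 2)) v))"
    using trace_walk[of "(v, id)" "standard_seq h i j a", unfolded st fst_conv]
      standard_seq_seqs[OF ij a] v perm_id by (simp only: states_simps simp_thms)
  moreover have "vorb (fold neighbour (alternate a b (h + 2)) v) = vorb v"
    using vorb_eq[OF g(1), of "fold neighbour (alternate a b (h + 2)) v"] unfolding g(2) by (rule sym)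
  ultimately show ?thesis by (simp only:)
qed

end


section \<open>Closed walks up to rotation and reversal\<close>

declare eh_trans [trans]

lemma edge_walk_edges: "edge_walk K v es w \<Longrightarrow> set es \<subseteq> edges K"
  by (induction es arbitrary: v) auto

lemma edge_walk_hd: "edge_walk K v es w \<Longrightarrow> es \<noteq> [] \<Longrightarrow> origin K (hd es) = v"
  by (cases es) auto

lemma edge_walk_last: "edge_walk K v es w \<Longrightarrow> es \<noteq> [] \<Longrightarrow> origin K (reversal K (last es)) = w"
  by (induction es arbitrary: v) auto

lemma edge_walk_consecutive:
  "edge_walk K v es w \<Longrightarrow> Suc m < length es \<Longrightarrow>
    origin K (es ! Suc m) = origin K (reversal K (es ! m))"
proof (induction es arbitrary: v m)
  case (Cons e es)
  then have es: "edge_walk K (origin K (reversal K e)) es w" by simp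
  show ?case
  proof (cases m)
    case 0
    then show ?thesis using edge_walk_hd[OF es] Cons.prems(2) by (cases es) auto
  next
    case (Suc l)
    then show ?thesis using Cons.IH[OF es, of l] Cons.prems(2) by simp
  qed
qed simp

text \<open>A face is given by a cycle, and its disc is attached along an arbitrary closed walk that represents
  the cycle. So being closed and being null-homotopic have to be carried over to the rotations and the
  reversal of a walk.\<close>

definition closed_walk :: "('v, 'e, 'f) two_complex \<Rightarrow> 'e list \<Rightarrow> bool" where
  "closed_walk K es \<longleftrightarrow> es \<noteq> [] \<and> (\<exists>v. edge_walk K v es v)"

definition null_walk :: "('v, 'e, 'f) two_complex \<Rightarrow> 'e list \<Rightarrow> bool" where
  "null_walk K es \<longleftrightarrow> (\<exists>v. edge_walk K v es v \<and> edge_homotopic K v es [])"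

definition reverse_walk :: "('v, 'e, 'f) two_complex \<Rightarrow> 'e list \<Rightarrow> 'e list" where
  "reverse_walk K es = rev (map (reversal K) es)"

context reversible_graph
begin

lemma edge_walk_single: "e \<in> edges K \<Longrightarrow> edge_walk K (origin K e) [e] (origin K (reversal K e))"
  by (simp add: origin_in_verts reversal_in_edges)

lemma edge_walk_single_reversal:
  "e \<in> edges K \<Longrightarrow> edge_walk K (origin K (reversal K e)) [reversal K e] (origin K e)"
  by (simp add: origin_in_verts reversal_in_edges reversal_reversal)

lemma edge_walk_reverse: "edge_walk K v es w \<Longrightarrow> edge_walk K w (reverse_walk K es) v"
proof (induction es arbitrary: v)
  case (Cons e es)
  then have "edge_walk K w (reverse_walk K es) (origin K (reversal K e))"
    "edge_walk K (origin K (reversal K e)) [reversal K e] v"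
    using edge_walk_single_reversal[of e] by auto
  from edge_walk_append[OF this] show ?case by (simp add: reverse_walk_def)
qed (simp add: reverse_walk_def)

lemma reverse_reverse_walk: "set es \<subseteq> edges K \<Longrightarrow> reverse_walk K (reverse_walk K es) = es"
  by (induction es) (simp_all add: reverse_walk_def reversal_reversal)

lemma closed_walk_rotate1: "closed_walk K es \<Longrightarrow> closed_walk K (rotate1 es)"
proof (cases es)
  case (Cons e p)
  assume "closed_walk K es"
  then obtain v where "edge_walk K v (e # p) v" unfolding closed_walk_def Cons by blast
  then have e: "e \<in> edges K" "origin K e = v" "edge_walk K (origin K (reversal K e)) p v" by simp_all
  show ?thesis
    using edge_walk_append[OF e(3)] edge_walk_single[OF e(1)] e(2)
    unfolding Cons closed_walk_def rotate1.simps by blast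
qed simp

lemma closed_walk_rotate: "closed_walk K es \<Longrightarrow> closed_walk K (rotate m es)"
  by (induction m) (simp_all add: closed_walk_rotate1)

lemma closed_walk_reverse: "closed_walk K es \<Longrightarrow> closed_walk K (reverse_walk K es)"
  using edge_walk_reverse unfolding closed_walk_def reverse_walk_def by fastforce

lemma edge_homotopic_reverse_walk:
  "edge_walk K v es w \<Longrightarrow> edge_homotopic K w (reverse_walk K es @ es) []"
proof (induction es arbitrary: v)
  case Nil
  then show ?case using eh_refl[of K v "[]"] by (auto simp: reverse_walk_def)
next
  case (Cons e es)
  then have e: "e \<in> edges K" "edge_walk K (origin K (reversal K e)) es w" by simp_all
  have 1: "edge_homotopic K (origin K (reversal K e)) ([reversal K e, e] @ es) ([] @ es)"
    using eh_append[OF eh_backtrack[OF reversal_in_edges[OF e(1)]] _ eh_refl[OF e(2)]]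
      e origin_in_verts reversal_in_edges reversal_reversal by simp
  have r: "edge_walk K w (reverse_walk K es) (origin K (reversal K e))" by (rule edge_walk_reverse[OF e(2)])
  have "edge_homotopic K w (reverse_walk K es @ ([reversal K e, e] @ es)) (reverse_walk K es @ ([] @ es))"
    by (rule eh_append[OF eh_refl[OF r] r 1])
  then show ?case using eh_trans[OF _ Cons.IH[OF e(2)]] by (simp add: reverse_walk_def)
qed

lemma null_walk_rotate1: "null_walk K es \<Longrightarrow> null_walk K (rotate1 es)"
proof (cases es)
  case (Cons e p)
  assume "null_walk K es"
  then obtain v where w: "edge_walk K v (e # p) v" and h: "edge_homotopic K v (e # p) []"
    unfolding null_walk_def Cons by blast
  then have e: "e \<in> edges K" "origin K e = v" "edge_walk K (origin K (reversal K e)) p v" by simp_all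
  (* Moving the first edge e to the end conjugates the walk by e. *)
  let ?u = "origin K (reversal K e)" and ?r = "reversal K e"
  note s = edge_walk_single[OF e(1), unfolded e(2)] and r = edge_walk_single_reversal[OF e(1), unfolded e(2)]
  have pe: "edge_walk K ?u (p @ [e]) ?u" by (rule edge_walk_append[OF e(3) s])
  have b: "edge_homotopic K ?u [?r, e] []"
    using eh_backtrack[OF reversal_in_edges[OF e(1)]] reversal_reversal[OF e(1)] by simp
  have "edge_homotopic K ?u ([?r, e] @ (p @ [e])) ([] @ (p @ [e]))"
    by (rule eh_append[OF b _ eh_refl[OF pe]]) (use edge_walk_append[OF r s] in simp)
  then have 1: "edge_homotopic K ?u (?r # (e # p) @ [e]) (p @ [e])" by simp
  have "edge_homotopic K v ((e # p) @ [e]) ([] @ [e])"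
    by (rule eh_append[OF h w eh_refl[OF s]])
  from eh_append[OF eh_refl[OF r] r this]
  have 2: "edge_homotopic K ?u (?r # (e # p) @ [e]) [?r, e]" by simp
  have "edge_homotopic K ?u (p @ [e]) []"
    by (rule eh_trans[OF eh_sym[OF 1] eh_trans[OF 2 b]])
  then show ?thesis unfolding null_walk_def Cons rotate1.simps using pe by blast
qed simp

lemma null_walk_rotate: "null_walk K es \<Longrightarrow> null_walk K (rotate m es)"
  by (induction m) (simp_all add: null_walk_rotate1)

lemma null_walk_rotateD:
  assumes "null_walk K (rotate m es)"
  shows "null_walk K es"
proof (cases "es = []")
  case False
  let ?n = "length es"
  have "(?n - 1) * m + m = ?n * m" using False by (cases ?n) simp_all
  then have "rotate ((?n - 1) * m) (rotate m es) = es"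
    using rotate_conv_mod[of "?n * m" es] by (simp add: rotate_rotate)
  then show ?thesis using null_walk_rotate[OF assms, of "(?n - 1) * m"] by simp
qed (use assms in simp)

lemma null_walk_reverse: "null_walk K es \<Longrightarrow> null_walk K (reverse_walk K es)"
proof -
  assume "null_walk K es"
  then obtain v where w: "edge_walk K v es v" and h: "edge_homotopic K v es []"
    unfolding null_walk_def by blast
  note r = edge_walk_reverse[OF w]
  have "edge_homotopic K v (reverse_walk K es @ es) (reverse_walk K es @ [])"
    by (rule eh_append[OF eh_refl[OF r] r h])
  then have "edge_homotopic K v (reverse_walk K es) []"
    using eh_trans[OF eh_sym edge_homotopic_reverse_walk[OF w]] by simp
  then show ?thesis unfolding null_walk_def using r by blast
qed

end

section \<open>The saturated modular complex\<close>

context exchange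
begin

lemma standard_walkE:
  assumes "p \<in> standard_walks I I0 \<epsilon>"
  obtains v h i j a b where "p = tree_walk v (alternate a b (h + 2))" "v \<in> tv"
    "standard_pair I I0 (M v) h i j" "(a, b) \<in> {(i, j), (j, i)}"
  using assms unfolding standard_walks_def alternate_eq by blast

lemma tree_walk_eq_Nil_iff: "tree_walk v ks = [] \<longleftrightarrow> ks = []"
  by (cases ks) auto

lemma reversible_graph_K: "reversible_graph K"
proof
  fix e assume e: "e \<in> edges K"
  then obtain v k where v: "v \<in> tv" "k \<in> J" "e = eorb (v, k)" "origin K e = vorb v"
    "reversal K e = eorb (neighbour k v, k)" by (rule edgeE)
  show "origin K e \<in> verts K" unfolding v(4) by (rule vorb_vert[OF v(1)])
  note n = neighbour_tree_vert[OF v(1,2)]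
  show "reversal K e \<in> edges K" unfolding v(5) by (rule eorb_edge[OF n v(2)])
  have "reversal K (reversal K e) = eorb (neighbour k (neighbour k v), k)"
    unfolding v(5) by (rule reversal_eorb[OF n v(2)])
  then show "reversal K (reversal K e) = e"
    unfolding neighbour_neighbour[OF tree_vertD(1)[OF v(1)]] v(3)[symmetric] .
qed

lemma faceE:
  assumes "f \<in> faces K"
  obtains p m u where "p \<in> standard_walks I I0 \<epsilon>" "boundary K f = rotate m u"
    "u \<in> {map eorb p, reverse_walk K (map eorb p)}"
    "f = {rotate m u | m u. u \<in> {map eorb p, reverse_walk K (map eorb p)}}"
proof -
  obtain p where p: "p \<in> standard_walks I I0 \<epsilon>"
    "f = {rotate m u | m u. u \<in> {map eorb p, reverse_walk K (map eorb p)}}"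
    using assms unfolding K_simps(6) reverse_walk_def[symmetric] by (rule imageE)
  have "rotate 0 (map eorb p) \<in> f" unfolding p(2) by blast
  then have "boundary K f \<in> f" unfolding K_simps(5) by (rule someI)
  then obtain m u where "boundary K f = rotate m u" "u \<in> {map eorb p, reverse_walk K (map eorb p)}"
    using p(2) by blast
  then show thesis using that p by blast
qed

lemma closed_walk_standard:
  assumes "p \<in> standard_walks I I0 \<epsilon>"
  shows "closed_walk K (map eorb p)"
proof -
  obtain v h i j a b where p: "p = tree_walk v (alternate a b (h + 2))" "v \<in> tv"
    "standard_pair I I0 (M v) h i j" "(a, b) \<in> {(i, j), (j, i)}"
    using assms by (rule standard_walkE)
  have "alternate a b (h + 2) \<noteq> []" by simp
  then have "map eorb p \<noteq> []" unfolding p(1) by (simp only: map_is_Nil_conv tree_walk_eq_Nil_iff not_False_eq_True)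
  then show ?thesis
    unfolding closed_walk_def using standard_walk_closed[OF p(2-4)] unfolding p(1) by blast
qed

lemma closed_walk_boundary:
  assumes "f \<in> faces K"
  shows "closed_walk K (boundary K f)"
proof -
  interpret reversible_graph K by (rule reversible_graph_K)
  obtain p m u where p: "p \<in> standard_walks I I0 \<epsilon>" "boundary K f = rotate m u"
    "u \<in> {map eorb p, reverse_walk K (map eorb p)}" using assms by (rule faceE)
  have "closed_walk K u"
    using p(3) closed_walk_standard[OF p(1)] closed_walk_reverse by (elim insertE emptyE) simp_all
  then show ?thesis unfolding p(2) by (rule closed_walk_rotate)
qed

lemma two_dim_complex_K: "two_dim_complex K"
proof -
  interpret reversible_graph K by (rule reversible_graph_K)
  show ?thesis
  proof
    fix f assume f: "f \<in> faces K"
    obtain v where b: "boundary K f \<noteq> []" and w: "edge_walk K v (boundary K f) v"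
      using closed_walk_boundary[OF f] unfolding closed_walk_def by blast
    show "boundary K f \<noteq> []" by (rule b)
    show "set (boundary K f) \<subseteq> edges K" by (rule edge_walk_edges[OF w])
    show "origin K (boundary K f ! Suc m) = origin K (reversal K (boundary K f ! m))"
      if "Suc m < length (boundary K f)" for m
      by (rule edge_walk_consecutive[OF w that])
    show "origin K (reversal K (last (boundary K f))) = origin K (hd (boundary K f))"
      unfolding edge_walk_last[OF w b] edge_walk_hd[OF w b] ..
  qed
qed

lemma null_walk_standard:
  assumes p: "p \<in> standard_walks I I0 \<epsilon>"
  shows "null_walk K (map eorb p)"
proof -
  interpret reversible_graph K by (rule reversible_graph_K)
  let ?f = "{rotate m u | m u. u \<in> {map eorb p, reverse_walk K (map eorb p)}}"
  have f: "?f \<in> faces K"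
    unfolding K_simps(6) reverse_walk_def[symmetric] using p by (rule imageI)
  have "rotate 0 (map eorb p) \<in> ?f" by blast
  then have "boundary K ?f \<in> ?f" unfolding K_simps(5) by (rule someI)
  then obtain m u where u: "boundary K ?f = rotate m u" "u \<in> {map eorb p, reverse_walk K (map eorb p)}"
    by blast
  obtain v where b: "boundary K ?f \<noteq> []" and w: "edge_walk K v (boundary K ?f) v"
    using closed_walk_boundary[OF f] unfolding closed_walk_def by blast
  have "edge_homotopic K v (boundary K ?f) []"
    using eh_face[OF f] unfolding edge_walk_hd[OF w b] .
  then have "null_walk K (rotate m u)" unfolding null_walk_def using w unfolding u(1) by blast
  then have "null_walk K u" by (rule null_walk_rotateD)
  then have "null_walk K (map eorb p) \<or> null_walk K (reverse_walk K (map eorb p))" using u(2) by auto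
  then show ?thesis
  proof
    assume "null_walk K (reverse_walk K (map eorb p))"
    then have "null_walk K (reverse_walk K (reverse_walk K (map eorb p)))" by (rule null_walk_reverse)
    moreover have "set (map eorb p) \<subseteq> edges K"
      using closed_walk_standard[OF p] unfolding closed_walk_def
      by (elim conjE exE) (rule edge_walk_edges)
    ultimately show ?thesis by (simp only: reverse_reverse_walk)
  qed
qed

lemma state_equiv_refl: "state_equiv s s"
  unfolding state_equiv_def by (intro exI[of _ id] conjI N_id) simp_all

text \<open>Seen from the tree, a transposition applied after \<open>\<tau>\<close> is the transposition of the labels that \<open>\<tau>\<close>
  takes to \<open>i\<close> and \<open>j\<close>.\<close>

lemma swap_transpose:
  assumes "\<tau> \<in> perms"
  shows "(Transposition.transpose i j ^^ n) \<circ> \<tau> =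
    \<tau> \<circ> (Transposition.transpose (pinv \<tau> i) (pinv \<tau> j) ^^ n)"
proof -
  let ?t = "Transposition.transpose i j" and ?u = "Transposition.transpose (pinv \<tau> i) (pinv \<tau> j)"
  have "?t (\<tau> x) = \<tau> (?u x)" for x
  proof -
    have "\<tau> x = i \<longleftrightarrow> x = pinv \<tau> i" "\<tau> x = j \<longleftrightarrow> x = pinv \<tau> j"
      using perm_inv_apply[OF assms] by metis+
    then show ?thesis using perm_inv_apply(1)[OF assms] by (simp add: Transposition.transpose_def)
  qed
  then have "(?t ^^ n) (\<tau> x) = \<tau> ((?u ^^ n) x)" for x
    by (induction n) simp_all
  then show ?thesis by (simp add: fun_eq_iff)
qed

text \<open>Only two kinds of relations change the walk: \<open>\<mu>\<^sub>k\<mu>\<^sub>k = 1\<close> contributes a backtrack, and a standard relation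
  the boundary of a face. The latter also changes the final state, but only by an element of the kernel.\<close>

lemma trace_basic_rel:
  assumes s: "(v, \<tau>) \<in> states" and A: "A = permute_matrix \<tau> (M v)" and rel: "basic_rel I I0 A x y"
  shows "edge_homotopic K (vorb v) (trace x (v, \<tau>)) (trace y (v, \<tau>)) \<and>
    state_equiv (end_state x (v, \<tau>)) (end_state y (v, \<tau>))"
proof -
  have v: "v \<in> tv" and \<tau>: "\<tau> \<in> perms" using s by simp_all
  have xy: "x \<in> seqs" "y \<in> seqs" using basic_rel_seqs[OF rel] by simp_all
  have same: "edge_homotopic K (vorb v) (trace x (v, \<tau>)) (trace y (v, \<tau>)) \<and>
      state_equiv (end_state x (v, \<tau>)) (end_state y (v, \<tau>))"
    if "trace x (v, \<tau>) = trace y (v, \<tau>)" "end_state x (v, \<tau>) = end_state y (v, \<tau>)"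
    using that eh_refl[OF trace_walk[OF s xy(2)]] state_equiv_refl by simp
  from rel show ?thesis
  proof cases
    case ident
    show ?thesis by (rule same) (simp_all add: ident)
  next
    case (comp \<sigma> \<sigma>')
    show ?thesis by (rule same) (simp_all add: comp comp_assoc)
  next
    case (invol k)
    then have k: "pinv \<tau> k \<in> J" using \<tau> by simp
    have "edge_homotopic K (vorb v) [eorb (v, pinv \<tau> k), eorb (neighbour (pinv \<tau> k) v, pinv \<tau> k)] []"
      using eh_backtrack[of "eorb (v, pinv \<tau> k)" K] v k reversal_eorb[OF v k] origin_eorb by simp
    moreover have "end_state x (v, \<tau>) = (v, \<tau>)"
      using neighbour_neighbour[OF tree_vertD(1)[OF v]] by (simp add: invol)
    ultimately show ?thesis using state_equiv_refl by (simp add: invol)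
  next
    case (conj \<sigma> k)
    have p: "pinv (pinv \<sigma> \<circ> \<tau>) k = pinv \<tau> (\<sigma> k)"
      using o_inv_distrib[OF perm_bij[OF perm_inv[OF conj(3)]] perm_bij[OF \<tau>]] conj(3) by simp
    have "\<sigma> \<circ> (pinv \<sigma> \<circ> \<tau>) = \<tau>" using conj(3) by (simp add: fun_eq_iff)
    then show ?thesis by (intro same) (simp_all add: conj(1,2) p)
  next
    case (standard h i j k)
    let ?i = "pinv \<tau> i" and ?j = "pinv \<tau> j" and ?k = "pinv \<tau> k"
    let ?t = "Transposition.transpose i j" and ?u = "Transposition.transpose ?i ?j"
    have ij: "i \<in> J" "j \<in> J" using standard(3) unfolding standard_pair_def by simp_all
    have pij: "?i = ?j \<longleftrightarrow> i = j" using perm_inv_apply(1)[OF \<tau>] by metis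
    have pair: "standard_pair I I0 (M v) h ?i ?j"
      using standard(3) ij \<tau> pij unfolding standard_pair_def A permute_matrix_def by simp
    have k: "?k \<in> {?i, ?j}" and ktab: "(?k, pinv \<tau> (?t k)) \<in> {(?i, ?j), (?j, ?i)}"
      and ku: "pinv \<tau> (?t k) = ?u ?k"
      using standard(4) by auto
    let ?p = "tree_walk v (alternate ?k (pinv \<tau> (?t k)) (h + 2))"
    note st = swap_word_state[OF \<tau> ij, of k "h + 2" v, folded standard_seq_eq]
    have p: "?p \<in> standard_walks I I0 \<epsilon>"
      unfolding standard_walks_def alternate_eq using v pair ktab by blast
    obtain w where w: "edge_walk K w (map eorb ?p) w" "edge_homotopic K w (map eorb ?p) []"
      using null_walk_standard[OF p] unfolding null_walk_def by (elim exE conjE)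
    have "map eorb ?p \<noteq> []" using closed_walk_standard[OF p] unfolding closed_walk_def by (rule conjunct1)
    then have "w = vorb v"
      using edge_walk_hd[OF w(1)] edge_walk_hd[OF standard_walk_closed[OF v pair ktab]] by metis
    with w(2) have 1: "edge_homotopic K (vorb v) (trace x (v, \<tau>)) (trace y (v, \<tau>))"
      unfolding standard(1,2) st trace.simps(1) by (simp only:)
    obtain \<gamma> where g: "(\<gamma>, ?u ^^ (h + 2)) \<in> N"
      "\<gamma> (fold neighbour (alternate ?k (?u ?k) (h + 2)) v) = v"
      using standard_kernel_element[OF v pair k] by (elim exE conjE)
    have "state_equiv (end_state x (v, \<tau>)) (end_state y (v, \<tau>))"
      unfolding state_equiv_def standard(1,2) st end_state_simps(1) fst_conv snd_conv
        swap_transpose[OF \<tau>] ku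
      using g by blast
    with 1 show ?thesis by (rule conjI)
  qed
qed

definition start :: "'i list \<times> ('i \<Rightarrow> 'i)" where
  "start = ([], id)"

lemma start_state: "start \<in> states"
  unfolding start_def states_simps by (intro conjI Nil_tree_vert perm_id)

lemma trace_start_walk: "w \<in> seqs \<Longrightarrow> edge_walk K (vorb []) (trace w start) (vorb (fst (end_state w start)))"
  using trace_walk[OF start_state] unfolding start_def fst_conv .

text \<open>The part of the word that is applied before the relation traces the same walk on both sides, and
  the part after it does so because its initial states are equivalent.\<close>

lemma trace_elementary_move:
  assumes "elementary_move I I0 \<epsilon> x y"
  shows "edge_homotopic K (vorb []) (trace x start) (trace y start)"
  using assms
proof cases
  case (1 u w p q)
  note u = \<open>u \<in> seqs\<close> and w = \<open>w \<in> seqs\<close> and rel = \<open>basic_rel I I0 (seq_act w \<epsilon>) p q\<close>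
  obtain v \<tau> where s: "end_state w start = (v, \<tau>)" by (cases "end_state w start")
  have vs: "(v, \<tau>) \<in> states" using end_state_states[OF start_state w] unfolding s .
  have A: "seq_act w \<epsilon> = permute_matrix \<tau> (M v)"
    by (rule seq_act_start[OF w s[unfolded start_def]])
  note b = trace_basic_rel[OF vs A rel]
  have pq: "p \<in> seqs" "q \<in> seqs" using basic_rel_seqs[OF rel] by simp_all
  note es = end_state_states[OF vs pq(1)] end_state_states[OF vs pq(2)]
  have u_eq: "trace u (end_state p (v, \<tau>)) = trace u (end_state q (v, \<tau>))"
    by (rule trace_cong[OF es conjunct2[OF b] u])
  have ww: "edge_walk K (vorb []) (trace w start) (vorb v)" using trace_start_walk[OF w] unfolding s fst_conv .
  have pw: "edge_walk K (vorb v) (trace p (v, \<tau>)) (vorb (fst (end_state p (v, \<tau>))))"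
    using trace_walk[OF vs pq(1)] unfolding fst_conv .
  have uw: "edge_walk K (vorb (fst (end_state p (v, \<tau>)))) (trace u (end_state p (v, \<tau>)))
      (vorb (fst (end_state u (end_state p (v, \<tau>)))))"
    by (rule trace_walk[OF es(1) u])
  have "edge_homotopic K (vorb v) (trace p (v, \<tau>) @ trace u (end_state p (v, \<tau>)))
      (trace q (v, \<tau>) @ trace u (end_state p (v, \<tau>)))"
    by (rule eh_append[OF conjunct1[OF b] pw eh_refl[OF uw]])
  from eh_append[OF eh_refl[OF ww] ww this]
  show ?thesis unfolding 1 trace_append end_state_simps(3) s u_eq append_assoc .
qed

lemma trace_word_equiv:
  assumes "word_equiv x y" "x \<in> seqs"
  shows "edge_homotopic K (vorb []) (trace x start) (trace y start)"
  using assms(1)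
proof (induction rule: equivclp_induct)
  case base
  show ?case by (rule eh_refl[OF trace_start_walk[OF assms(2)]])
next
  case (step y z)
  have "edge_homotopic K (vorb []) (trace y start) (trace z start)"
    using step(2) by (elim disjE) (erule trace_elementary_move, rule eh_sym, erule trace_elementary_move)
  with step(3) show ?case by (rule eh_trans)
qed

abbreviation "vertex_walk v \<equiv> trace (map Mut v) start"

lemma end_state_map_Mut_start:
  assumes "v \<in> tv"
  shows "end_state (map Mut v) start = (v, id)"
  using end_state_map_Mut[OF perm_id, of v "[]"] act_Nil[OF tree_vertD(1)[OF assms]]
  by (simp add: start_def inv_id)

lemma vertex_walk:
  assumes "v \<in> tv"
  shows "edge_walk K (vorb []) (vertex_walk v) (vorb v)"
  using trace_start_walk[of "map Mut v"] tree_vertD(2)[OF assms]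
  unfolding end_state_map_Mut_start[OF assms] map_Mut_seqs fst_conv by blast

lemma vertex_walk_edge:
  assumes v: "v \<in> tv" and k: "k \<in> J"
  shows "edge_homotopic K (vorb []) (vertex_walk v @ [eorb (v, k)]) (vertex_walk (neighbour k v))"
proof -
  have w: "Mut k # map Mut v \<in> seqs" using k tree_vertD(2)[OF v] by simp
  have "word_equiv ([] @ Mut k # map Mut v) ([] @ map Mut (neighbour k v))"
    by (rule word_equiv_Mut_neighbour[OF k v]) simp
  then have "edge_homotopic K (vorb []) (trace (Mut k # map Mut v) start) (vertex_walk (neighbour k v))"
    using trace_word_equiv[OF _ w] unfolding append_Nil by blast
  then show ?thesis unfolding trace.simps(2) end_state_map_Mut_start[OF v] fst_conv snd_conv pinv_id .
qed

text \<open>The edge path to \<open>\<gamma> v\<close> is the image under \<open>\<gamma>\<close> of the edge path to \<open>v\<close>, preceded by the edge path to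
  \<open>\<gamma> v\<^sub>0\<close>, up to backtracks. The word of \<open>\<gamma>\<inverse>\<close>, which is equivalent to the empty word, runs along the latter.\<close>

lemma vertex_walk_orbit:
  assumes g: "(\<gamma>, \<sigma>) \<in> N" and v: "v \<in> tv"
  shows "edge_homotopic K (vorb []) (vertex_walk v) (vertex_walk (\<gamma> v))"
proof -
  note ga = N_autos[OF g] and gi = N_inv[OF g]
  note s = autosD(2)[OF ga]
  have pp: "pinv (pinv \<gamma>) = \<gamma>" by (rule inv_inv_eq[OF permutes_bij[OF autosD(1)[OF ga]]])
  have gtv: "\<gamma> [] \<in> tv" "\<gamma> v \<in> tv" using auto_tv[OF ga] v by simp_all
  let ?n = "normal_form (\<gamma> [], pinv \<sigma>)"
  have vs: "map Mut v \<in> seqs" using tree_vertD(2)[OF v] by simp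
  have n: "?n \<in> seqs" by (rule normal_form_seqs[OF gtv(1) perm_inv[OF s]])
  have "word_equiv ?n []" using gi unfolding ker_Phi_iff pp by (rule conjunct2)
  from word_equiv_left[OF this vs] have 1: "word_equiv (map Mut v) (map Mut v @ ?n)"
    unfolding append_Nil2 by (rule equivclp_sym)
  have "act (map \<sigma> v) (\<gamma> []) = \<gamma> (act v [])"
    by (rule auto_act[OF ga Nil_tree_vert tree_vertD(2)[OF v], symmetric])
  then have a: "act (map \<sigma> v) (\<gamma> []) = \<gamma> v" unfolding act_Nil[OF tree_vertD(1)[OF v]] .
  have e: "end_state (map Mut v @ ?n) ([], id) = (\<gamma> v, pinv \<sigma>)"
    unfolding end_state_simps(3) end_state_normal_form_start[OF gtv(1)]
      end_state_map_Mut[OF perm_inv[OF s]] perm_inv_inv[OF s] a ..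
  have "word_equiv (map Mut v @ ?n) (normal_form (\<gamma> v, pinv \<sigma>))"
    using word_equiv_normal_form[of "map Mut v @ ?n"] vs n unfolding e by simp
  from trace_word_equiv[OF equivclp_trans[OF 1 this] vs]
  show ?thesis unfolding normal_form_def fst_conv snd_conv trace.simps(3) .
qed

theorem simply_connected_modular_complex: "simply_connected_space (realisation K)"
proof -
  interpret two_dim_complex K by (rule two_dim_complex_K)
  (* A vertex of the tree in each orbit; by the lemma on orbits, the homotopy class of its walk does
     not depend on the choice. *)
  define r where "r u = (SOME v. v \<in> tv \<and> vorb v = u)" for u
  have r: "r u \<in> tv \<and> vorb (r u) = u" if u: "u \<in> verts K" for u
  proof -
    obtain v where "v \<in> tv \<and> vorb v = u" using u unfolding K_simps(1) by blast
    then show ?thesis unfolding r_def by (rule someI)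
  qed
  have rv: "edge_homotopic K (vorb []) (vertex_walk (r (vorb v))) (vertex_walk v)" if v: "v \<in> tv" for v
  proof -
    note rv = r[OF vorb_vert[OF v]]
    obtain \<gamma> \<sigma> where "(\<gamma>, \<sigma>) \<in> N" "v = \<gamma> (r (vorb v))"
      using vorb_eqD[OF conjunct2[OF rv]] by (elim exE conjE)
    then show ?thesis using vertex_walk_orbit[OF _ conjunct1[OF rv]] by metis
  qed
  show ?thesis
  proof (rule simply_connected_realisation)
    show "edge_walk K (vorb []) (vertex_walk (r u)) u" if "u \<in> verts K" for u
      using vertex_walk[OF conjunct1[OF r[OF that]]] unfolding conjunct2[OF r[OF that]] .
    fix e assume "e \<in> edges K"
    then obtain v k where v: "v \<in> tv" "k \<in> J" "e = eorb (v, k)" "origin K e = vorb v"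
      "reversal K e = eorb (neighbour k v, k)" "origin K (reversal K e) = vorb (neighbour k v)"
      by (rule edgeE)
    have e: "edge_walk K (vorb v) [eorb (v, k)] (vorb (neighbour k v))"
      using v origin_in_verts[OF eorb_edge[OF v(1,2)]] by simp
    have w: "edge_walk K (vorb []) (vertex_walk (r (vorb v))) (vorb v)"
      using vertex_walk[OF conjunct1[OF r[OF vorb_vert[OF v(1)]]]]
      unfolding conjunct2[OF r[OF vorb_vert[OF v(1)]]] .
    have "edge_homotopic K (vorb []) (vertex_walk (r (vorb v)) @ [eorb (v, k)]) (vertex_walk v @ [eorb (v, k)])"
      by (rule eh_append[OF rv[OF v(1)] w eh_refl[OF e]])
    also have "edge_homotopic K (vorb []) \<dots> (vertex_walk (neighbour k v))"
      by (rule vertex_walk_edge[OF v(1,2)])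
    also have "edge_homotopic K (vorb []) \<dots> (vertex_walk (r (vorb (neighbour k v))))"
      by (rule eh_sym[OF rv[OF neighbour_tree_vert[OF v(1,2)]]])
    finally show "edge_homotopic K (vorb []) (vertex_walk (r (origin K e)) @ [e])
        (vertex_walk (r (origin K (reversal K e))))"
      unfolding v(6) unfolding v(3) origin_eorb .
  qed
qed

end

theorem lemma2p11:
  fixes I I0 :: "'i set" and \<epsilon> :: "'i \<Rightarrow> 'i \<Rightarrow> rat"
  assumes "exchange_matrix I I0 \<epsilon>"
  shows "simply_connected_space (saturated_modular_complex I I0 \<epsilon>)"
proof -
  interpret exchange I I0 \<epsilon> by unfold_locales (rule assms)
  show ?thesis
    unfolding saturated_modular_complex_def by (rule simply_connected_modular_complex)
qed

end
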